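(* Let $\rho_S$ be the marginal of a random graph state, as defined in the context. Let $p\ge 1$ be an integer, let $\mathcal S_p$ be the symmetric group on $p$ elements and let $\gamma=(1\,2\,\cdots\,p)\in\mathcal S_p$ be the full cycle. Assume $d_{C_i}N^{|C_i|}\ge p$ for every $i=1,\dots,k$. Then the following exact formula holds: $$\mathbb E\operatorname{Tr}(\rho_S^p)=\left(d_{[n]}N^n\right)^{-p/2}\sum_{\alpha_1,\dots,\alpha_k,\beta_1,\dots,\beta_k\in\mathcal S_p}\ \prod_{i=1}^k\left(d_{S_i}N^{|S_i|}\right)^{\#(\gamma^{-1}\alpha_i)}\prod_{i=1}^k\left(d_{T_i}N^{|T_i|}\right)^{\#\alpha_i}\prod_{1\le i<j\le k}\left(d_{E_{ij}}N^{|E_{ij}|}\right)^{\#(\beta_i^{-1}\beta_j)}\prod_{i=1}^k\left(d_{E_{ii}}N^{|E_{ii}|}\right)^p\prod_{i=1}^k\operatorname{Wg}\left(d_{C_i}N^{|C_i|},\alpha_i^{-1}\beta_i\right).$$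
   Context: Random graph states. $\Gamma$ is a finite undirected graph (multiple edges and loops allowed) with vertices $V_1,\dots,V_k$ (each of degree at least 1) and $m$ edges. Put $n=2m$ and label the $n$ edge-ends (subsystems) by $[n]=\{1,\dots,n\}$. The edges give a pair partition $\Pi_{\rm edge}$ of $[n]$, and the vertices give a partition $\Pi_{\rm vertex}=\{C_1,\dots,C_k\}$ of $[n]$, where $C_i$ is the set of edge-ends at $V_i$ (a loop contributes two). Real numbers $d_1,\dots,d_n>0$ are given with $d_i=d_j$ whenever $\{i,j\}\in\Pi_{\rm edge}$, and $N$ is a positive integer such that every $d_iN$ is an integer. $\mathcal H_i=\mathbb C^{d_iN}$ with a fixed orthonormal basis. For $\{i,j\}\in\Pi_{\rm edge}$, $|\Phi^+_{ij}\rangle=(d_iN)^{-1/2}\sum_{x=1}^{d_iN}|e_x\rangle\otimes|f_x\rangle\in\mathcal H_i\otimes\mathcal H_j$, where $(e_x),(f_x)$ are the fixed bases. The random graph state is the random unit vector $$|\Psi\rangle=\Big[\bigotimes_{i=1}^kU_i\Big]\Big(\bigotimes_{\{i,j\}\in\Pi_{\rm edge}}|\Phi^+_{ij}\rangle\Big)\in\bigotimes_{i=1}^n\mathcal H_i,$$ with $U_1,\dots,U_k$ independent Haar-distributed random unitaries, $U_i$ acting on $\bigotimes_{j\in C_i}\mathcal H_j$. Marginal: for a partition $[n]=S\sqcup T$, $\rho_S=\operatorname{Tr}_T|\Psi\rangle\langle\Psi|$ is the partial trace over $\bigotimes_{i\in T}\mathcal H_i$. Index sets: $S_i=S\cap C_i$,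 $T_i=T\cap C_i$; for $i<j$, $E_{ij}=\{a\in C_i:\exists b\in C_j,\ \{a,b\}\in\Pi_{\rm edge}\}$ (one element per edge between $V_i$ and $V_j$); $E_{ii}=\{a\in C_i:\exists b\in C_i,\ b>a,\ \{a,b\}\in\Pi_{\rm edge}\}$ (one element per loop at $V_i$). For $I\subseteq[n]$, $d_I=\prod_{i\in I}d_i$ ($d_\emptyset=1$). $\#\sigma$ is the number of cycles of $\sigma\in\mathcal S_p$ (fixed points included). The Weingarten function $\sigma\mapsto\operatorname{Wg}(D,\sigma)$ on $\mathcal S_p$ is the inverse, for convolution on the group $\mathcal S_p$, of the function $\sigma\mapsto D^{\#\sigma}$; it exists for $D\ge p$. *)

theory Defs
  imports
    "HOL-Probability.Probability"
    "HOL-Combinatorics.Cycles"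
    "HOL-Combinatorics.Orbits"
    "HOL-Library.Disjoint_Sets"
begin

section \<open>Operators on the space spanned by a finite index set\<close>

text \<open>
  For a finite set \<open>X\<close>, a vector of the Hilbert space with orthonormal basis indexed by \<open>X\<close> is
  given by its coordinates \<open>'x \<Rightarrow> complex\<close>, and an operator by its matrix entries
  \<open>'x \<Rightarrow> 'x \<Rightarrow> complex\<close> (row index first); only the values on \<open>X\<close> are significant.
\<close>

type_synonym 'x op = "'x \<Rightarrow> 'x \<Rightarrow> complex"

definition op_id :: "'x set \<Rightarrow> 'x op" where
  "op_id X = (\<lambda>x y. if x \<in> X \<and> x = y then 1 else 0)"

definition op_mult :: "'x set \<Rightarrow> 'x op \<Rightarrow> 'x op \<Rightarrow> 'x op" where
  "op_mult X A B = (\<lambda>x y. \<Sum>z\<in>X. A x z * B z y)"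

definition op_adjoint :: "'x op \<Rightarrow> 'x op" where
  "op_adjoint A = (\<lambda>x y. cnj (A y x))"

definition op_apply :: "'x set \<Rightarrow> 'x op \<Rightarrow> ('x \<Rightarrow> complex) \<Rightarrow> 'x \<Rightarrow> complex" where
  "op_apply X A v = (\<lambda>x. \<Sum>y\<in>X. A x y * v y)"

definition op_power :: "'x set \<Rightarrow> 'x op \<Rightarrow> nat \<Rightarrow> 'x op" where
  "op_power X A p = (op_mult X A ^^ p) (op_id X)"

definition op_trace :: "'x set \<Rightarrow> 'x op \<Rightarrow> complex" where
  "op_trace X A = (\<Sum>x\<in>X. A x x)"

definition ket_bra :: "('x \<Rightarrow> complex) \<Rightarrow> 'x op" where
  "ket_bra v = (\<lambda>x y. v x * cnj (v y))"


section \<open>Haar measure on the unitary group\<close>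

text \<open>
  Entries outside \<open>X \<times> X\<close> are required to vanish, so that the set below is in bijection with
  the group of unitary \<open>card X \<times> card X\<close> matrices.
\<close>

definition unitary_group :: "'x set \<Rightarrow> 'x op set" where
  "unitary_group X = {U. (\<forall>x y. x \<notin> X \<or> y \<notin> X \<longrightarrow> U x y = 0) \<and>
     op_mult X U (op_adjoint U) = op_id X \<and> op_mult X (op_adjoint U) U = op_id X}"

text \<open>
  The function space carries the topology of pointwise convergence; on \<open>unitary_group X\<close> with
  \<open>X\<close> finite this is the usual topology of entrywise convergence.
\<close>

definition unitary_borel :: "'x set \<Rightarrow> 'x op measure" where
  "unitary_borel X = restrict_space borel (unitary_group X)"

text \<open>
  Since the unitary group is compact, invariance under left translations determines the
  probability measure uniquely and implies invariance under right translations as well.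
\<close>

definition is_haar :: "'x set \<Rightarrow> 'x op measure \<Rightarrow> bool" where
  "is_haar X \<mu> \<longleftrightarrow> prob_space \<mu> \<and> sets \<mu> = sets (unitary_borel X) \<and>
     (\<forall>V\<in>unitary_group X. distr \<mu> \<mu> (op_mult X V) = \<mu>)"


section \<open>Multipartite systems\<close>

text \<open>
  \<open>D i\<close> is the dimension of the \<open>i\<close>-th subsystem, whose fixed basis is indexed by \<open>{..<D i}\<close>.
  The product basis of the tensor product of the subsystems in \<open>I\<close> is indexed by \<open>multi_index D I\<close>.
\<close>

definition multi_index :: "(nat \<Rightarrow> nat) \<Rightarrow> nat set \<Rightarrow> (nat \<Rightarrow> nat) set" where
  "multi_index D I = (\<Pi>\<^sub>E i\<in>I. {..<D i})"

definition tensor_vec :: "nat set set \<Rightarrow> (nat set \<Rightarrow> (nat \<Rightarrow> nat) \<Rightarrow> complex) \<Rightarrow> (nat \<Rightarrow> nat) \<Rightarrow> complex" where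
  "tensor_vec P v = (\<lambda>x. \<Prod>J\<in>P. v J (restrict x J))"

definition tensor_op :: "nat set \<Rightarrow> (nat \<Rightarrow> nat set) \<Rightarrow> (nat \<Rightarrow> (nat \<Rightarrow> nat) op) \<Rightarrow> (nat \<Rightarrow> nat) op" where
  "tensor_op K C A = (\<lambda>x y. \<Prod>i\<in>K. A i (restrict x (C i)) (restrict y (C i)))"

text \<open>
  \<open>partial_trace D S T A\<close> traces out the subsystems in \<open>T\<close> of an operator on the subsystems in
  the disjoint union \<open>S \<union> T\<close>.
\<close>

definition partial_trace :: "(nat \<Rightarrow> nat) \<Rightarrow> nat set \<Rightarrow> nat set \<Rightarrow> (nat \<Rightarrow> nat) op \<Rightarrow> (nat \<Rightarrow> nat) op" where
  "partial_trace D S T A = (\<lambda>x y. \<Sum>z\<in>multi_index D T. A (merge S T (x, z)) (merge S T (y, z)))"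


section \<open>Random graph states\<close>

text \<open>
  A graph with vertices \<open>1, \<dots>, k\<close> and \<open>m\<close> edges (loops and multiple edges allowed) is given by
  its \<open>2 * m\<close> edge-ends: \<open>C i\<close> is the set of edge-ends at the vertex \<open>i\<close>, and each element of
  \<open>E\<close> consists of the two ends of one edge.
\<close>

definition graph_data :: "nat \<Rightarrow> nat \<Rightarrow> (nat \<Rightarrow> nat set) \<Rightarrow> nat set set \<Rightarrow> bool" where
  "graph_data k m C E \<longleftrightarrow> k \<ge> 1 \<and>
     partition_on {1..2*m} E \<and> (\<forall>e\<in>E. card e = 2) \<and>
     (\<forall>i\<in>{1..k}. C i \<noteq> {}) \<and> disjoint_family_on C {1..k} \<and> (\<Union>i\<in>{1..k}. C i) = {1..2*m}"

definition local_dim :: "(nat \<Rightarrow> real) \<Rightarrow> nat \<Rightarrow> nat \<Rightarrow> nat" where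
  "local_dim d N i = nat \<lfloor>d i * real N\<rfloor>"

text \<open>
  The maximally entangled vector on the two subsystems in \<open>e\<close>: the product over \<open>a \<in> e\<close> is the
  coordinate at \<open>x\<close> of the product basis vector with both labels equal to \<open>z\<close>. The two
  subsystems of an edge have equal dimension, so the choice of \<open>Min e\<close> is immaterial.
\<close>

definition bell_vec :: "(nat \<Rightarrow> nat) \<Rightarrow> nat set \<Rightarrow> (nat \<Rightarrow> nat) \<Rightarrow> complex" where
  "bell_vec D e = (\<lambda>x. of_real (1 / sqrt (real (D (Min e)))) *
     (\<Sum>z<D (Min e). \<Prod>a\<in>e. if x a = z then 1 else 0))"

definition graph_state ::
    "(nat \<Rightarrow> nat) \<Rightarrow> nat \<Rightarrow> nat \<Rightarrow> (nat \<Rightarrow> nat set) \<Rightarrow> nat set set \<Rightarrow> (nat \<Rightarrow> (nat \<Rightarrow> nat) op) \<Rightarrow>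
     (nat \<Rightarrow> nat) \<Rightarrow> complex" where
  "graph_state D k m C E U =
     op_apply (multi_index D {1..2*m}) (tensor_op {1..k} C U) (tensor_vec E (bell_vec D))"

definition marginal ::
    "(nat \<Rightarrow> nat) \<Rightarrow> nat \<Rightarrow> nat \<Rightarrow> (nat \<Rightarrow> nat set) \<Rightarrow> nat set set \<Rightarrow> (nat \<Rightarrow> (nat \<Rightarrow> nat) op) \<Rightarrow>
     nat set \<Rightarrow> nat set \<Rightarrow> (nat \<Rightarrow> nat) op" where
  "marginal D k m C E U S T = partial_trace D S T (ket_bra (graph_state D k m C E U))"

definition edge_set :: "(nat \<Rightarrow> nat set) \<Rightarrow> nat set set \<Rightarrow> nat \<Rightarrow> nat \<Rightarrow> nat set" where
  "edge_set C E i j = (if i = j then {a \<in> C i. \<exists>b\<in>C i. b > a \<and> {a, b} \<in> E}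
                       else {a \<in> C i. \<exists>b\<in>C j. {a, b} \<in> E})"

text \<open>The number \<open>d\<^sub>I * N ^ card I\<close>, i.e. the dimension of the tensor product over \<open>I\<close>.\<close>

definition dim_prod :: "(nat \<Rightarrow> real) \<Rightarrow> nat \<Rightarrow> nat set \<Rightarrow> real" where
  "dim_prod d N I = (\<Prod>i\<in>I. d i) * real N ^ card I"


section \<open>Permutations and the Weingarten function\<close>

definition sym_group :: "nat \<Rightarrow> (nat \<Rightarrow> nat) set" where
  "sym_group p = {\<sigma>. \<sigma> permutes {1..p}}"

definition full_cycle :: "nat \<Rightarrow> nat \<Rightarrow> nat" where
  "full_cycle p = cycle_of_list [1..<Suc p]"

definition num_cycles :: "nat \<Rightarrow> (nat \<Rightarrow> nat) \<Rightarrow> nat" where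
  "num_cycles p \<sigma> = card (orbit \<sigma> ` {1..p})"

definition perm_conv :: "nat \<Rightarrow> ((nat \<Rightarrow> nat) \<Rightarrow> real) \<Rightarrow> ((nat \<Rightarrow> nat) \<Rightarrow> real) \<Rightarrow> (nat \<Rightarrow> nat) \<Rightarrow> real" where
  "perm_conv p f g = (\<lambda>\<sigma>. \<Sum>\<tau>\<in>sym_group p. f \<tau> * g (inv \<tau> \<circ> \<sigma>))"

definition is_conv_inverse :: "nat \<Rightarrow> ((nat \<Rightarrow> nat) \<Rightarrow> real) \<Rightarrow> ((nat \<Rightarrow> nat) \<Rightarrow> real) \<Rightarrow> bool" where
  "is_conv_inverse p f w \<longleftrightarrow>
     (\<forall>\<sigma>\<in>sym_group p. perm_conv p f w \<sigma> = (if \<sigma> = id then 1 else 0) \<and>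
                       perm_conv p w f \<sigma> = (if \<sigma> = id then 1 else 0))"

text \<open>Setting the function to 0 outside the symmetric group makes it unique.\<close>

definition Wg :: "nat \<Rightarrow> real \<Rightarrow> (nat \<Rightarrow> nat) \<Rightarrow> real" where
  "Wg p D = (THE w. is_conv_inverse p (\<lambda>\<sigma>. D ^ num_cycles p \<sigma>) w \<and> (\<forall>\<sigma>. \<sigma> \<notin> sym_group p \<longrightarrow> w \<sigma> = 0))"

end

theory Submission
  imports Defs
begin

text \<open>
  Schur--Weyl duality is only needed for \<open>p \<le> dim\<close>, where it is elementary. A matrix \<open>F\<close> that commutes
  with \<open>V \<otimes> \<dots> \<otimes> V\<close> for all unitaries \<open>V\<close> preserves weights (take \<open>V\<close> diagonal), so a row of \<open>F\<close> at an
  injective tuple \<open>e\<close> is supported on the rearrangements of \<open>e\<close>. If such a row vanishes, then so do all rows: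
  permutation matrices reach the other injective tuples, and a reflection mixing two basis vectors
  introduces repetitions one at a time. Hence \<open>F\<close> is the combination of permutation operators with the
  coefficients found in the row \<open>e\<close>.

  Applied to the matrix of Haar moments of order \<open>p\<close>, contracting with permutations and using unitarity turns this
  into a linear system for the coefficients whose matrix is \<open>D ^ num_cycles (\<sigma>\<inverse>\<tau>)\<close>; this yields the Weingarten
  formula. The trace is then a sum of products of entries of the independent unitaries; after taking
  expectations, the sum over the output labels factors over the subsystems and the sum over the input
  labels factors over the edges.
\<close>

section \<open>Permutations acting on tuples\<close>

text \<open>Left translation acts on the row labels of a unitary, so a Haar moment is viewed as a
  matrix in its row labels with the column labels as parameters. Rows are the output labels, matched
  by the \<alpha> permutations; columns are the input labels, matched by the \<beta> permutations.
  The two families therefore meet only in the Weingarten factors.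

  All exponents are counts of tuples: f o \<sigma> = f o \<tau> leaves one free value per cycle of
  inv \<tau> o \<sigma>. In a traced power the bra label is shifted by the full cycle on subsystems
  in S and shared with the ket on subsystems in T, so \<alpha> is compared with the full cycle or
  with the identity. A Bell vector identifies the labels at the two ends of an edge, so the \<beta>
  of its two vertices are compared; at a loop they coincide and all p labels stay free.

  Each edge of dimension q contributes 1/sqrt q to every ket and every bra, hence q^(-p). The total
  dimension is the square of the product of the q, which explains the exponent -p/2.\<close>

lemma finite_sym_group: "finite (sym_group p)"
  by (simp add: sym_group_def finite_permutations)

lemma sym_group_id: "id \<in> sym_group p"
  by (simp add: sym_group_def permutes_id)

lemma sym_group_comp: "\<sigma> \<in> sym_group p \<Longrightarrow> \<tau> \<in> sym_group p \<Longrightarrow> \<sigma> \<circ> \<tau> \<in> sym_group p"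
  by (simp add: sym_group_def permutes_compose)

lemma sym_group_inv: "\<sigma> \<in> sym_group p \<Longrightarrow> inv \<sigma> \<in> sym_group p"
  by (simp add: sym_group_def permutes_inv)

lemma sym_group_bij: "\<sigma> \<in> sym_group p \<Longrightarrow> bij \<sigma>"
  by (simp add: sym_group_def permutes_bij)

lemma sym_group_in: "\<sigma> \<in> sym_group p \<Longrightarrow> t \<in> {1..p} \<Longrightarrow> \<sigma> t \<in> {1..p}"
  using permutes_in_image[of \<sigma> "{1..p}" t] by (simp add: sym_group_def)

lemma sym_group_inv_o: "\<sigma> \<in> sym_group p \<Longrightarrow> inv \<sigma> \<circ> \<sigma> = id" "\<sigma> \<in> sym_group p \<Longrightarrow> \<sigma> \<circ> inv \<sigma> = id"
  unfolding sym_group_def using permutes_inv_o by blast+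

lemma sym_group_inv_comp:
  "\<sigma> \<in> sym_group p \<Longrightarrow> \<tau> \<in> sym_group p \<Longrightarrow> inv (\<sigma> \<circ> \<tau>) = inv \<tau> \<circ> inv \<sigma>"
  by (simp add: o_inv_distrib sym_group_bij)

lemma sym_group_inv_inv: "\<sigma> \<in> sym_group p \<Longrightarrow> inv (inv \<sigma>) = \<sigma>"
  by (simp add: inv_inv_eq sym_group_bij)

lemma sym_group_cancel:
  assumes "\<sigma> \<in> sym_group p"
  shows "inv \<sigma> \<circ> (\<sigma> \<circ> f) = f" "\<sigma> \<circ> (inv \<sigma> \<circ> f) = f" "(g \<circ> \<sigma>) \<circ> inv \<sigma> = g" "(g \<circ> inv \<sigma>) \<circ> \<sigma> = g"
  using sym_group_inv_o[OF assms] by (simp_all add: o_assoc[symmetric]) (simp_all add: o_assoc)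

lemma tuple_comp_sym:
  assumes "f \<in> {1..p} \<rightarrow>\<^sub>E X" "\<sigma> \<in> sym_group p"
  shows "f \<circ> \<sigma> \<in> {1..p} \<rightarrow>\<^sub>E X"
proof (rule PiE_I)
  fix t assume "t \<in> {1..p}"
  then show "(f \<circ> \<sigma>) t \<in> X" using assms sym_group_in by (metis PiE_mem comp_apply)
next
  fix t assume "t \<notin> {1..p}"
  \<comment> \<open>A permutation of {1..p} fixes every other number, so the composite keeps the
    value \<open>undefined\<close> there and needs no new restriction.\<close>
  moreover from this have "\<sigma> t = t" using assms(2) by (simp add: sym_group_def permutes_not_in)
  ultimately show "(f \<circ> \<sigma>) t = undefined" using PiE_arb[OF assms(1)] by simp
qed

lemma tuple_comp_eq_iff:
  assumes "f \<in> {1..p} \<rightarrow>\<^sub>E X" "g \<in> {1..p} \<rightarrow>\<^sub>E X" "\<sigma> \<in> sym_group p" "\<tau> \<in> sym_group p"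
  shows "f \<circ> \<sigma> = g \<circ> \<tau> \<longleftrightarrow> (\<forall>t\<in>{1..p}. f (\<sigma> t) = g (\<tau> t))"
  using PiE_ext[OF tuple_comp_sym[OF assms(1,3)] tuple_comp_sym[OF assms(2,4)]]
  by (auto simp: fun_eq_iff)

section \<open>Cycle counts as numbers of tuples\<close>

lemma orbit_eq_of_mem:
  assumes "\<sigma> \<in> sym_group p" "s \<in> orbit \<sigma> t"
  shows "orbit \<sigma> s = orbit \<sigma> t"
proof -
  have "permutation \<sigma>" using assms(1) unfolding sym_group_def by (auto simp: permutation_permutes)
  then have "t \<in> orbit \<sigma> s" using assms(2) permutation_self_in_orbit orbit_swap by metis
  with assms(2) show ?thesis by (auto intro: orbit_trans)
qed

text \<open>An invariant tuple is constant on every cycle, so it amounts to a free choice of one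
  value per cycle.\<close>

lemma card_tuples_fixed_by_perm:
  assumes \<sigma>: "\<sigma> \<in> sym_group p" and X: "finite X"
  shows "card {f \<in> {1..p} \<rightarrow>\<^sub>E X. f \<circ> \<sigma> = f} = card X ^ num_cycles p \<sigma>"
proof -
  let ?O = "orbit \<sigma> ` {1..p}"
  let ?h = "\<lambda>g. \<lambda>t\<in>{1..p}. g (orbit \<sigma> t)"
  have perm: "permutation \<sigma>" using \<sigma> unfolding sym_group_def by (auto simp: permutation_permutes)
  have self: "t \<in> orbit \<sigma> t" for t by (rule permutation_self_in_orbit[OF perm])
  have step: "orbit \<sigma> (\<sigma> t) = orbit \<sigma> t" for t
    by (rule orbit_eq_of_mem[OF \<sigma>]) (rule orbit.base)
  have "bij_betw ?h (?O \<rightarrow>\<^sub>E X) {f \<in> {1..p} \<rightarrow>\<^sub>E X. f \<circ> \<sigma> = f}"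
  proof (rule bij_betwI')
    fix g g' assume g: "g \<in> ?O \<rightarrow>\<^sub>E X" "g' \<in> ?O \<rightarrow>\<^sub>E X"
    show "(?h g = ?h g') \<longleftrightarrow> (g = g')"
    proof
      assume eq: "?h g = ?h g'"
      show "g = g'"
      proof (rule PiE_ext[OF g])
        fix c assume "c \<in> ?O"
        then obtain t where "t \<in> {1..p}" "c = orbit \<sigma> t" by auto
        then show "g c = g' c" using fun_cong[OF eq, of t] by simp
      qed
    qed simp
  next
    fix g assume g: "g \<in> ?O \<rightarrow>\<^sub>E X"
    have 1: "?h g \<in> {1..p} \<rightarrow>\<^sub>E X" using g by auto
    have "?h g \<circ> \<sigma> = ?h g \<circ> id"
      by (subst tuple_comp_eq_iff[OF 1 1 \<sigma> sym_group_id]) (use sym_group_in[OF \<sigma>] in \<open>simp add: step\<close>)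
    with 1 show "?h g \<in> {f \<in> {1..p} \<rightarrow>\<^sub>E X. f \<circ> \<sigma> = f}" by simp
  next
    fix f assume "f \<in> {f \<in> {1..p} \<rightarrow>\<^sub>E X. f \<circ> \<sigma> = f}"
    then have f: "f \<in> {1..p} \<rightarrow>\<^sub>E X" and inv: "\<And>t. f (\<sigma> t) = f t" by (auto simp: fun_eq_iff)
    have const: "f s = f t" if "s \<in> orbit \<sigma> t" for s t
      using that by induction (simp_all add: inv)
    \<comment> \<open>The representative chosen in a cycle is immaterial, since \<open>f\<close> is
      constant there by \<open>const\<close>.\<close>
    let ?g = "\<lambda>c\<in>?O. f (SOME s. s \<in> c)"
    have val: "?g (orbit \<sigma> t) = f t" if "t \<in> {1..p}" for t
      using that const[OF someI[of "\<lambda>s. s \<in> orbit \<sigma> t", OF self]] by simp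
    have "?g \<in> ?O \<rightarrow>\<^sub>E X"
    proof (rule PiE_I)
      fix c assume "c \<in> ?O"
      then obtain t where "t \<in> {1..p}" "c = orbit \<sigma> t" by auto
      then show "?g c \<in> X" using val[of t] f by auto
    qed auto
    moreover have "f = ?h ?g"
    proof (rule PiE_ext[OF f])
      show "?h ?g \<in> {1..p} \<rightarrow>\<^sub>E X" using val f by auto
    qed (use val in auto)
    ultimately show "\<exists>g\<in>?O \<rightarrow>\<^sub>E X. f = ?h g" by blast
  qed
  then have "card {f \<in> {1..p} \<rightarrow>\<^sub>E X. f \<circ> \<sigma> = f} = card (?O \<rightarrow>\<^sub>E X)"
    by (rule bij_betw_same_card[symmetric])
  also have "\<dots> = card X ^ card ?O" by (simp add: card_PiE)
  finally show ?thesis by (simp add: num_cycles_def)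
qed

text \<open>Composition with \<open>inv \<tau>\<close> turns invariance under
  \<open>inv \<tau> \<circ> \<sigma>\<close> into agreement of the two rearrangements. Both the Gram
  matrix of the permutation operators and the dimension factors of the theorem are obtained from
  this count.\<close>

lemma card_tuples_agree:
  assumes \<sigma>: "\<sigma> \<in> sym_group p" and \<tau>: "\<tau> \<in> sym_group p" and X: "finite X"
  shows "card {f \<in> {1..p} \<rightarrow>\<^sub>E X. f \<circ> \<sigma> = f \<circ> \<tau>} = card X ^ num_cycles p (inv \<tau> \<circ> \<sigma>)"
proof -
  have "bij_betw (\<lambda>f. f \<circ> inv \<tau>) {f \<in> {1..p} \<rightarrow>\<^sub>E X. f \<circ> (inv \<tau> \<circ> \<sigma>) = f} {f \<in> {1..p} \<rightarrow>\<^sub>E X. f \<circ> \<sigma> = f \<circ> \<tau>}"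
  proof (rule bij_betw_byWitness[where f' = "\<lambda>f. f \<circ> \<tau>"])
    show "(\<lambda>f. f \<circ> inv \<tau>) ` {f \<in> {1..p} \<rightarrow>\<^sub>E X. f \<circ> (inv \<tau> \<circ> \<sigma>) = f} \<subseteq> {f \<in> {1..p} \<rightarrow>\<^sub>E X. f \<circ> \<sigma> = f \<circ> \<tau>}"
      using tuple_comp_sym[OF _ sym_group_inv[OF \<tau>]] by (auto simp: sym_group_cancel[OF \<tau>] o_assoc)
    show "(\<lambda>f. f \<circ> \<tau>) ` {f \<in> {1..p} \<rightarrow>\<^sub>E X. f \<circ> \<sigma> = f \<circ> \<tau>} \<subseteq> {f \<in> {1..p} \<rightarrow>\<^sub>E X. f \<circ> (inv \<tau> \<circ> \<sigma>) = f}"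
      using tuple_comp_sym[OF _ \<tau>] by (auto simp: sym_group_cancel[OF \<tau>] o_assoc)
  qed (auto simp: sym_group_cancel[OF \<tau>])
  then show ?thesis
    using card_tuples_fixed_by_perm[OF sym_group_comp[OF sym_group_inv[OF \<tau>] \<sigma>] X]
    by (simp add: bij_betw_same_card[symmetric])
qed

lemma sum_tuples_agree:
  assumes \<sigma>: "\<sigma> \<in> sym_group p" and \<tau>: "\<tau> \<in> sym_group p" and X: "finite X"
  shows "(\<Sum>f\<in>{1..p} \<rightarrow>\<^sub>E X. of_bool (\<forall>t\<in>{1..p}. f (\<sigma> t) = f (\<tau> t))) =
    (of_nat (card X) ^ num_cycles p (inv \<tau> \<circ> \<sigma>) :: 'a :: comm_semiring_1)"
proof -
  have "(\<Sum>f\<in>{1..p} \<rightarrow>\<^sub>E X. of_bool (\<forall>t\<in>{1..p}. f (\<sigma> t) = f (\<tau> t))) =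
    (\<Sum>f\<in>{1..p} \<rightarrow>\<^sub>E X. (of_bool (f \<circ> \<sigma> = f \<circ> \<tau>)::'a))"
    by (intro sum.cong refl) (simp add: tuple_comp_eq_iff \<sigma> \<tau>)
  also have "\<dots> = of_nat (card {f \<in> {1..p} \<rightarrow>\<^sub>E X. f \<circ> \<sigma> = f \<circ> \<tau>})"
    by (simp add: sum_of_bool_eq finite_PiE X Int_def)
  finally show ?thesis unfolding card_tuples_agree[OF assms] of_nat_power .
qed

text \<open>Both symmetries of the cycle count follow by counting tuples over a two-element set.\<close>

lemma num_cycles_inv:
  assumes "\<sigma> \<in> sym_group p"
  shows "num_cycles p (inv \<sigma>) = num_cycles p \<sigma>"
proof -
  have "(2::nat) ^ num_cycles p (inv \<sigma>) = card {f \<in> {1..p} \<rightarrow>\<^sub>E {..<2::nat}. f \<circ> id = f \<circ> \<sigma>}"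
    using card_tuples_agree[OF sym_group_id assms, of "{..<2::nat}"] by simp
  also have "\<dots> = card {f \<in> {1..p} \<rightarrow>\<^sub>E {..<2::nat}. f \<circ> \<sigma> = f \<circ> id}" by metis
  also have "\<dots> = 2 ^ num_cycles p \<sigma>"
    using card_tuples_agree[OF assms sym_group_id, of "{..<2::nat}"] by simp
  finally show ?thesis by simp
qed

lemma num_cycles_commute:
  assumes \<sigma>: "\<sigma> \<in> sym_group p" and \<tau>: "\<tau> \<in> sym_group p"
  shows "num_cycles p (\<sigma> \<circ> \<tau>) = num_cycles p (\<tau> \<circ> \<sigma>)"
proof -
  have "(f \<circ> (\<sigma> \<circ> \<tau>) = f) = (f \<circ> \<sigma> = f \<circ> inv \<tau>)" for f :: "nat \<Rightarrow> nat"
    using sym_group_cancel(3,4)[OF \<tau>] by (metis o_assoc)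
  then have "(2::nat) ^ num_cycles p (\<sigma> \<circ> \<tau>) = 2 ^ num_cycles p (inv (inv \<tau>) \<circ> \<sigma>)"
    using card_tuples_agree[OF \<sigma> sym_group_inv[OF \<tau>], of "{..<2::nat}"]
      card_tuples_fixed_by_perm[OF sym_group_comp[OF \<sigma> \<tau>], of "{..<2::nat}"] by simp
  then show ?thesis by (simp add: sym_group_inv_inv[OF \<tau>])
qed

lemma num_cycles_id: "num_cycles p id = p"
proof -
  have "orbit id ` {1..p} = (\<lambda>x. {x}) ` {1..p}"
    by (intro image_cong refl) (simp add: orbit_eq_singleton_iff)
  then show ?thesis by (simp add: num_cycles_def card_image)
qed

section \<open>Convolution on the symmetric group and the Weingarten function\<close>

text \<open>In the group algebra the hypothesis on \<open>c\<close> reads c * f = g, so c = c * f *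
  w = g * w. The fact \<open>inner\<close> is the relation for f * w translated by \<rho>. The
  moments to be solved for are complex, while \<open>f\<close> and \<open>w\<close> are real as in
  \<open>Wg\<close>.\<close>

lemma perm_conv_solve:
  fixes c g :: "(nat \<Rightarrow> nat) \<Rightarrow> complex"
  assumes w: "\<And>\<sigma>. \<sigma> \<in> sym_group p \<Longrightarrow> perm_conv p f w \<sigma> = (if \<sigma> = id then 1 else 0)"
    and c: "\<And>\<tau>. \<tau> \<in> sym_group p \<Longrightarrow> (\<Sum>\<sigma>\<in>sym_group p. c \<sigma> * of_real (f (inv \<sigma> \<circ> \<tau>))) = g \<tau>"
    and \<sigma>: "\<sigma> \<in> sym_group p"
  shows "c \<sigma> = (\<Sum>\<tau>\<in>sym_group p. g \<tau> * of_real (w (inv \<tau> \<circ> \<sigma>)))"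
proof -
  let ?S = "sym_group p"
  have inner: "(\<Sum>\<tau>\<in>?S. f (inv \<rho> \<circ> \<tau>) * w (inv \<tau> \<circ> \<sigma>)) = (if \<rho> = \<sigma> then 1 else 0)" if \<rho>: "\<rho> \<in> ?S" for \<rho>
  proof -
    have "(\<Sum>\<tau>\<in>?S. f (inv \<rho> \<circ> \<tau>) * w (inv \<tau> \<circ> \<sigma>)) = perm_conv p f w (inv \<rho> \<circ> \<sigma>)"
      unfolding perm_conv_def
    proof (rule sum.reindex_bij_witness[of _ "\<lambda>\<kappa>. \<rho> \<circ> \<kappa>" "\<lambda>\<tau>. inv \<rho> \<circ> \<tau>"])
      fix \<tau> assume "\<tau> \<in> ?S"
      then show "f (inv \<rho> \<circ> \<tau>) * w (inv (inv \<rho> \<circ> \<tau>) \<circ> (inv \<rho> \<circ> \<sigma>)) = f (inv \<rho> \<circ> \<tau>) * w (inv \<tau> \<circ> \<sigma>)"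
        using \<rho> by (simp add: sym_group_inv_comp[of _ p] sym_group_inv sym_group_inv_inv[OF \<rho>] o_assoc[symmetric] sym_group_cancel[OF \<rho>])
    qed (use \<rho> in \<open>auto simp: sym_group_cancel sym_group_comp sym_group_inv\<close>)
    also have "inv \<rho> \<circ> \<sigma> = id \<longleftrightarrow> \<rho> = \<sigma>"
      using sym_group_cancel[OF \<rho>] sym_group_inv_o[OF \<rho>] by (metis comp_id)
    then have "perm_conv p f w (inv \<rho> \<circ> \<sigma>) = (if \<rho> = \<sigma> then 1 else 0)"
      using w[of "inv \<rho> \<circ> \<sigma>"] \<rho> \<sigma> by (simp add: sym_group_comp sym_group_inv)
    finally show ?thesis .
  qed
  have "(\<Sum>\<tau>\<in>?S. g \<tau> * of_real (w (inv \<tau> \<circ> \<sigma>))) =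
    (\<Sum>\<tau>\<in>?S. \<Sum>\<rho>\<in>?S. c \<rho> * of_real (f (inv \<rho> \<circ> \<tau>) * w (inv \<tau> \<circ> \<sigma>)))"
    by (intro sum.cong refl) (simp add: c[symmetric] sum_distrib_right mult.assoc)
  also have "\<dots> = (\<Sum>\<rho>\<in>?S. c \<rho> * of_real (\<Sum>\<tau>\<in>?S. f (inv \<rho> \<circ> \<tau>) * w (inv \<tau> \<circ> \<sigma>)))"
    by (subst sum.swap) (simp add: sum_distrib_left)
  also have "\<dots> = (\<Sum>\<rho>\<in>?S. if \<rho> = \<sigma> then c \<rho> else 0)"
    by (intro sum.cong refl) (simp add: inner)
  also have "\<dots> = c \<sigma>" using \<sigma> by (simp add: finite_sym_group)
  finally show ?thesis by simp
qed

text \<open>A class function is central in the group algebra: taking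
  \<open>inv \<sigma> \<circ> \<tau>\<close> as summation variable exchanges the two factors and
  conjugates the argument of \<open>f\<close> by \<tau>.\<close>

lemma perm_conv_commute:
  assumes f: "\<And>\<sigma> \<tau>. \<sigma> \<in> sym_group p \<Longrightarrow> \<tau> \<in> sym_group p \<Longrightarrow> f (\<sigma> \<circ> \<tau>) = f (\<tau> \<circ> \<sigma>)"
    and \<tau>: "\<tau> \<in> sym_group p"
  shows "perm_conv p f w \<tau> = perm_conv p w f \<tau>"
  unfolding perm_conv_def
proof (rule sum.reindex_bij_witness[of _ "\<lambda>\<rho>. \<tau> \<circ> inv \<rho>" "\<lambda>\<sigma>. inv \<sigma> \<circ> \<tau>"])
  fix \<sigma> assume \<sigma>: "\<sigma> \<in> sym_group p"
  have "inv (inv \<sigma> \<circ> \<tau>) \<circ> \<tau> = inv \<tau> \<circ> (\<sigma> \<circ> \<tau>)"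
    using \<sigma> \<tau> by (simp add: sym_group_inv_comp[of _ p] sym_group_inv sym_group_inv_inv o_assoc)
  moreover have "f (inv \<tau> \<circ> (\<sigma> \<circ> \<tau>)) = f ((\<sigma> \<circ> \<tau>) \<circ> inv \<tau>)"
    using \<sigma> \<tau> by (simp add: f sym_group_inv sym_group_comp)
  ultimately show "w (inv \<sigma> \<circ> \<tau>) * f (inv (inv \<sigma> \<circ> \<tau>) \<circ> \<tau>) = f \<sigma> * w (inv \<sigma> \<circ> \<tau>)"
    by (simp add: sym_group_cancel[OF \<tau>])
  show "\<tau> \<circ> inv (inv \<sigma> \<circ> \<tau>) = \<sigma>"
    using \<sigma> \<tau> by (simp add: sym_group_inv_comp[of _ p] sym_group_inv sym_group_inv_inv sym_group_cancel)
next
  fix \<sigma> assume \<sigma>: "\<sigma> \<in> sym_group p"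
  then show "inv (\<tau> \<circ> inv \<sigma>) \<circ> \<tau> = \<sigma>"
    using \<tau> by (simp add: sym_group_inv_comp[of _ p] sym_group_inv sym_group_inv_inv o_assoc[symmetric] sym_group_inv_o)
qed (use \<tau> in \<open>auto simp: sym_group_comp sym_group_inv\<close>)

text \<open>One left inverse suffices to evaluate the definite description: the powers form a class
  function, so it is also a right inverse, and an inverse is unique. Since \<sigma> and its inverse
  have equally many cycles, composing an inverse with inversion gives an inverse again; uniqueness
  then yields the symmetry of \<open>Wg\<close>.\<close>

lemma Wg_properties:
  assumes w: "\<And>\<tau>. \<tau> \<in> sym_group p \<Longrightarrow> perm_conv p w (\<lambda>\<sigma>. D ^ num_cycles p \<sigma>) \<tau> = (if \<tau> = id then 1 else 0)"
  shows "is_conv_inverse p (\<lambda>\<sigma>. D ^ num_cycles p \<sigma>) (Wg p D)"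
    and "\<sigma> \<in> sym_group p \<Longrightarrow> Wg p D (inv \<sigma>) = Wg p D \<sigma>"
proof -
  let ?S = "sym_group p" and ?f = "\<lambda>\<sigma>. D ^ num_cycles p \<sigma>"
  let ?Q = "\<lambda>w. is_conv_inverse p ?f w \<and> (\<forall>\<sigma>. \<sigma> \<notin> ?S \<longrightarrow> w \<sigma> = 0)"
  \<comment> \<open>Cut off outside the group to meet the normalisation in the definition of
    \<open>Wg\<close>.\<close>
  let ?w = "\<lambda>\<sigma>. if \<sigma> \<in> ?S then w \<sigma> else 0"
  have comm: "perm_conv p ?f v \<tau> = perm_conv p v ?f \<tau>" if "\<tau> \<in> ?S" for \<tau> v
    using that by (intro perm_conv_commute) (simp_all add: num_cycles_commute)
  have "perm_conv p ?w ?f \<tau> = perm_conv p w ?f \<tau>" for \<tau>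
    unfolding perm_conv_def by (intro sum.cong) auto
  then have ex: "?Q ?w" using w by (auto simp: is_conv_inverse_def comm)
  \<comment> \<open>Uniqueness is \<open>perm_conv_solve\<close> with the delta at the identity as
    right-hand side: v = delta * v' = v' on the group.\<close>
  have uniq: "v \<sigma> = v' \<sigma>" if v: "is_conv_inverse p ?f v" "is_conv_inverse p ?f v'" and \<sigma>: "\<sigma> \<in> ?S" for v v' \<sigma>
  proof -
    have "of_real (v \<sigma>) = (\<Sum>\<tau>\<in>?S. of_bool (\<tau> = id) * complex_of_real (v' (inv \<tau> \<circ> \<sigma>)))"
    proof (rule perm_conv_solve[OF _ _ \<sigma>])
      show "(\<Sum>\<sigma>\<in>?S. complex_of_real (v \<sigma>) * of_real (?f (inv \<sigma> \<circ> \<tau>))) = of_bool (\<tau> = id)" if "\<tau> \<in> ?S" for \<tau>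
      proof -
        have "(\<Sum>\<sigma>\<in>?S. v \<sigma> * ?f (inv \<sigma> \<circ> \<tau>)) = of_bool (\<tau> = id)"
          using v(1) that by (simp add: is_conv_inverse_def perm_conv_def)
        from arg_cong[OF this, of complex_of_real] show ?thesis by simp
      qed
    qed (use v(2) in \<open>auto simp: is_conv_inverse_def\<close>)
    also have "\<dots> = (\<Sum>\<tau>\<in>?S. if \<tau> = id then complex_of_real (v' (inv \<tau> \<circ> \<sigma>)) else 0)"
      by (intro sum.cong) auto
    also have "\<dots> = complex_of_real (v' \<sigma>)"
      using sym_group_id finite_sym_group by simp
    finally show ?thesis by simp
  qed
  have Q: "?Q (Wg p D)"
    unfolding Wg_def
  proof (rule theI[of ?Q ?w])
    show "?Q ?w" by (fact ex)
    show "v = ?w" if "?Q v" for v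
    proof
      fix \<sigma>
      show "v \<sigma> = ?w \<sigma>" using that ex uniq[of v ?w \<sigma>] by (cases "\<sigma> \<in> ?S") auto
    qed
  qed
  then show inverse: "is_conv_inverse p ?f (Wg p D)" by blast
  assume \<sigma>: "\<sigma> \<in> ?S"
  have "is_conv_inverse p ?f (\<lambda>\<sigma>. Wg p D (inv \<sigma>))"
  proof -
    have "perm_conv p (\<lambda>\<sigma>. Wg p D (inv \<sigma>)) ?f \<tau> = (if \<tau> = id then 1 else 0)" if \<tau>: "\<tau> \<in> ?S" for \<tau>
    proof -
      have "perm_conv p (\<lambda>\<sigma>. Wg p D (inv \<sigma>)) ?f \<tau> = perm_conv p (Wg p D) ?f (inv \<tau>)"
        unfolding perm_conv_def
      proof (rule sum.reindex_bij_witness[of _ inv inv])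
        fix \<rho> assume \<rho>: "\<rho> \<in> ?S"
        have "num_cycles p (inv (inv \<rho>) \<circ> inv \<tau>) = num_cycles p (inv \<tau> \<circ> \<rho>)"
          using \<rho> \<tau> by (simp add: sym_group_inv_inv num_cycles_commute sym_group_inv)
        also have "\<dots> = num_cycles p (inv (inv \<tau> \<circ> \<rho>))"
          using \<rho> \<tau> by (simp add: num_cycles_inv sym_group_inv sym_group_comp)
        also have "inv (inv \<tau> \<circ> \<rho>) = inv \<rho> \<circ> \<tau>"
          using \<rho> \<tau> by (simp add: sym_group_inv_comp[of _ p] sym_group_inv sym_group_inv_inv)
        finally show "Wg p D (inv \<rho>) * D ^ num_cycles p (inv (inv \<rho>) \<circ> inv \<tau>) =
            Wg p D (inv \<rho>) * D ^ num_cycles p (inv \<rho> \<circ> \<tau>)" by (simp only:)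
      qed (auto simp: sym_group_inv sym_group_inv_inv)
      moreover have "inv \<tau> = id \<longleftrightarrow> \<tau> = id"
        using sym_group_inv_inv[OF \<tau>] by (metis inv_id)
      ultimately show ?thesis
        using inverse sym_group_inv[OF \<tau>] by (simp add: is_conv_inverse_def)
    qed
    then show ?thesis by (simp add: is_conv_inverse_def comm)
  qed
  from uniq[OF this inverse \<sigma>] show "Wg p D (inv \<sigma>) = Wg p D \<sigma>" .
qed

section \<open>Operators commuting with tensor powers of unitaries\<close>

lemma op_mult_assoc:
  assumes "finite X"
  shows "op_mult X A (op_mult X B C) = op_mult X (op_mult X A B) C"
proof (intro ext)
  fix x y
  have "op_mult X A (op_mult X B C) x y = (\<Sum>z\<in>X. \<Sum>z'\<in>X. A x z * B z z' * C z' y)"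
    by (simp add: op_mult_def sum_distrib_left mult.assoc)
  also have "\<dots> = op_mult X (op_mult X A B) C x y"
    by (subst sum.swap) (simp add: op_mult_def sum_distrib_right)
  finally show "op_mult X A (op_mult X B C) x y = op_mult X (op_mult X A B) C x y" .
qed

lemma op_adjoint_mult: "op_adjoint (op_mult X A B) = op_mult X (op_adjoint B) (op_adjoint A)"
  by (simp add: op_adjoint_def op_mult_def mult.commute)

lemma op_mult_id_left:
  assumes "finite X" "\<And>x y. x \<notin> X \<Longrightarrow> A x y = 0"
  shows "op_mult X (op_id X) A = A"
proof (intro ext)
  fix x y
  have "op_mult X (op_id X) A x y = (\<Sum>z\<in>X. if x = z then A z y else 0)"
    unfolding op_mult_def op_id_def by (intro sum.cong) auto
  then show "op_mult X (op_id X) A x y = A x y" using assms by simp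
qed

lemma unitary_groupI:
  assumes "\<And>x y. x \<notin> X \<or> y \<notin> X \<Longrightarrow> V x y = 0"
    and "\<And>x y. x \<in> X \<Longrightarrow> y \<in> X \<Longrightarrow> (\<Sum>z\<in>X. V x z * cnj (V y z)) = of_bool (x = y)"
    and "\<And>x y. x \<in> X \<Longrightarrow> y \<in> X \<Longrightarrow> (\<Sum>z\<in>X. cnj (V z x) * V z y) = of_bool (x = y)"
  shows "V \<in> unitary_group X"
proof -
  have "op_mult X V (op_adjoint V) x y = op_id X x y" for x y
    using assms(1,2) by (cases "x \<in> X \<and> y \<in> X") (auto simp: op_mult_def op_adjoint_def op_id_def)
  moreover have "op_mult X (op_adjoint V) V x y = op_id X x y" for x y
    using assms(1,3) by (cases "x \<in> X \<and> y \<in> X") (auto simp: op_mult_def op_adjoint_def op_id_def)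
  ultimately show ?thesis using assms(1) by (simp add: unitary_group_def fun_eq_iff)
qed

lemma unitary_groupD:
  assumes "V \<in> unitary_group X"
  shows "x \<notin> X \<or> y \<notin> X \<Longrightarrow> V x y = 0"
    and "op_mult X V (op_adjoint V) = op_id X"
    and "op_mult X (op_adjoint V) V = op_id X"
    and "x \<in> X \<Longrightarrow> (\<Sum>z\<in>X. V x z * cnj (V y z)) = of_bool (x = y)"
    and "x \<in> X \<Longrightarrow> (\<Sum>z\<in>X. cnj (V z x) * V z y) = of_bool (x = y)"
proof -
  show zero: "x \<notin> X \<or> y \<notin> X \<Longrightarrow> V x y = 0" for x y using assms by (auto simp: unitary_group_def)
  show 1: "op_mult X V (op_adjoint V) = op_id X" and 2: "op_mult X (op_adjoint V) V = op_id X"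
    using assms by (auto simp: unitary_group_def)
  show "x \<in> X \<Longrightarrow> (\<Sum>z\<in>X. V x z * cnj (V y z)) = of_bool (x = y)"
    using fun_cong[OF fun_cong[OF 1], of x y] by (simp add: op_mult_def op_adjoint_def op_id_def)
  show "x \<in> X \<Longrightarrow> (\<Sum>z\<in>X. cnj (V z x) * V z y) = of_bool (x = y)"
    using fun_cong[OF fun_cong[OF 2], of x y] by (simp add: op_mult_def op_adjoint_def op_id_def)
qed

lemma unitary_group_adjoint_mult:
  assumes "finite X" "V \<in> unitary_group X" "U \<in> unitary_group X"
  shows "op_mult X (op_adjoint V) (op_mult X V U) = U"
  using assms by (simp add: op_mult_assoc unitary_groupD(3) op_mult_id_left unitary_groupD(1))

lemma unitary_group_mult:
  assumes X: "finite X" and V: "V \<in> unitary_group X" and U: "U \<in> unitary_group X"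
  shows "op_mult X V U \<in> unitary_group X"
proof -
  note [simp] = op_adjoint_mult op_mult_assoc[OF X, symmetric]
  have "op_mult X U (op_mult X (op_adjoint U) (op_adjoint V)) = op_adjoint V"
    unfolding op_mult_assoc[OF X] unitary_groupD(2)[OF U]
    by (rule op_mult_id_left[OF X]) (simp add: op_adjoint_def unitary_groupD(1)[OF V])
  moreover have "op_mult X (op_adjoint V) (op_mult X V U) = U"
    by (rule unitary_group_adjoint_mult[OF X V U])
  moreover have "op_mult X V U x y = 0" if "x \<notin> X \<or> y \<notin> X" for x y
    using that unitary_groupD(1)[OF V, of x] unitary_groupD(1)[OF U, of _ y] by (auto simp: op_mult_def)
  ultimately show ?thesis
    using unitary_groupD(2)[OF V] unitary_groupD(3)[OF U] unfolding unitary_group_def by simp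
qed

text \<open>Every row is a unit vector. The bound makes all monomials in the entries integrable for
  a probability measure on the group.\<close>

lemma unitary_group_entry_le:
  assumes X: "finite X" and U: "U \<in> unitary_group X"
  shows "norm (U x y) \<le> 1"
proof (cases "x \<in> X \<and> y \<in> X")
  case True
  have "complex_of_real (\<Sum>z\<in>X. (norm (U x z))\<^sup>2) = 1"
    using unitary_groupD(4)[OF U, of x x] True
    by (simp only: of_real_sum complex_norm_square of_bool_eq simp_thms)
  then have "(\<Sum>z\<in>X. (norm (U x z))\<^sup>2) = 1" by (simp only: of_real_eq_1_iff)
  moreover have "(norm (U x y))\<^sup>2 \<le> (\<Sum>z\<in>X. (norm (U x z))\<^sup>2)"
    using True X by (intro member_le_sum) auto
  ultimately show ?thesis by (simp add: power_le_one_iff abs_square_le_1)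
next
  case False
  then show ?thesis using unitary_groupD(1)[OF U, of x y] by auto
qed

lemma diagonal_unitary:
  assumes "finite X" "\<And>x. norm (v x) = 1"
  shows "(\<lambda>x y. if x \<in> X \<and> x = y then v x else 0) \<in> unitary_group X"
proof -
  have [simp]: "v x * cnj (v x) = 1" "cnj (v x) * v x = 1" for x
    using assms(2)[of x] by (simp_all add: complex_norm_square[symmetric] mult.commute)
  show ?thesis
  proof (rule unitary_groupI)
    fix x y assume "x \<in> X" "y \<in> X"
    then show "(\<Sum>z\<in>X. (if x \<in> X \<and> x = z then v x else 0) * cnj (if y \<in> X \<and> y = z then v y else 0)) = of_bool (x = y)"
      using assms(1) by (simp add: if_distrib[of cnj] if_distribR mult_if_delta if_distrib[of "\<lambda>a. a * _"] cong: if_cong)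
    show "(\<Sum>z\<in>X. cnj (if z \<in> X \<and> z = x then v z else 0) * (if z \<in> X \<and> z = y then v z else 0)) = of_bool (x = y)"
      using assms(1) \<open>x \<in> X\<close> \<open>y \<in> X\<close>
      by (simp add: if_distrib[of cnj] mult_if_delta if_distrib[of "\<lambda>a. a * _"] cong: if_cong conj_cong)
  qed auto
qed

lemma permutation_unitary:
  assumes X: "finite X" and \<pi>: "\<pi> permutes X"
  shows "(\<lambda>x y. if x \<in> X \<and> y = \<pi> x then 1 else 0) \<in> unitary_group X"
proof (rule unitary_groupI)
  fix x y assume xy: "x \<in> X" "y \<in> X"
  have inj: "\<pi> x = \<pi> y \<longleftrightarrow> x = y" using permutes_inj[OF \<pi>] by (auto dest: injD)
  have "(\<Sum>z\<in>X. (if x \<in> X \<and> z = \<pi> x then 1 else 0) * cnj (if y \<in> X \<and> z = \<pi> y then 1 else 0)) =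
    (\<Sum>z\<in>X. if z = \<pi> x then of_bool (x = y) else (0::complex))"
    using xy inj by (intro sum.cong) auto
  then show "(\<Sum>z\<in>X. (if x \<in> X \<and> z = \<pi> x then 1 else 0) * cnj (if y \<in> X \<and> z = \<pi> y then 1 else 0)) = (of_bool (x = y) :: complex)"
    using X xy permutes_in_image[OF \<pi>] by simp
  have "(\<Sum>z\<in>X. cnj (if z \<in> X \<and> x = \<pi> z then 1 else 0) * (if z \<in> X \<and> y = \<pi> z then 1 else 0)) =
    (\<Sum>z\<in>X. if z = inv \<pi> x then of_bool (x = y) else (0::complex))"
    using xy permutes_inverses[OF \<pi>] by (intro sum.cong) auto
  then show "(\<Sum>z\<in>X. cnj (if z \<in> X \<and> x = \<pi> z then 1 else 0) * (if z \<in> X \<and> y = \<pi> z then 1 else 0)) = (of_bool (x = y) :: complex)"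
    using X xy permutes_in_image[OF permutes_inv[OF \<pi>]] by simp
qed (use permutes_in_image[OF \<pi>] in auto)

text \<open>This is the Householder reflection 1 - 2 v v^T. It is symmetric, and in its square the
  cross terms -4 v v^T cancel against 4 v v^T because \<open>v\<close> is a unit vector; one
  computation thus gives both unitarity relations.\<close>

lemma reflection_unitary:
  fixes v :: "'x \<Rightarrow> real"
  assumes X: "finite X" and v0: "\<And>x. x \<notin> X \<Longrightarrow> v x = 0" and v: "(\<Sum>x\<in>X. (v x)\<^sup>2) = 1"
  shows "(\<lambda>x y. of_real (of_bool (x \<in> X \<and> x = y) - 2 * v x * v y)) \<in> unitary_group X"
proof -
  let ?h = "\<lambda>x y. of_bool (x \<in> X \<and> x = y) - 2 * v x * v y"
  have sym: "?h x y = ?h y x" for x y by auto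
  have *: "(\<Sum>z\<in>X. ?h x z * ?h y z) = of_bool (x = y)" if "x \<in> X" "y \<in> X" for x y
  proof -
    have "(\<Sum>z\<in>X. ?h x z * ?h y z) =
      (\<Sum>z\<in>X. (if z = x then of_bool (x = y) else 0) - (if z = x then 2 * v x * v y else 0)
         - (if z = y then 2 * v x * v y else 0) + 4 * v x * v y * (v z)\<^sup>2)"
      using that by (intro sum.cong) (auto simp: algebra_simps power2_eq_square)
    also have "\<dots> = of_bool (x = y) - 2 * v x * v y - 2 * v x * v y + 4 * v x * v y * (\<Sum>z\<in>X. (v z)\<^sup>2)"
      using that X by (simp add: sum.distrib sum_subtractf sum_distrib_left[symmetric])
    finally show ?thesis by (simp add: v)
  qed
  show ?thesis
  proof (rule unitary_groupI)
    fix x y assume xy: "x \<in> X" "y \<in> X"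
    from arg_cong[OF *[OF this], of complex_of_real]
    show "(\<Sum>z\<in>X. of_real (?h x z) * cnj (of_real (?h y z))) = of_bool (x = y)"
      by (cases "x = y") (simp_all only: complex_cnj_complex_of_real of_real_sum of_real_mult of_bool_eq of_real_0 of_real_1 simp_thms)
    from arg_cong[OF *[OF xy], of complex_of_real]
    show "(\<Sum>z\<in>X. cnj (of_real (?h z x)) * of_real (?h z y)) = of_bool (x = y)"
      unfolding sym[of _ x] sym[of _ y]
      by (cases "x = y") (simp_all only: complex_cnj_complex_of_real of_real_sum of_real_mult of_bool_eq of_real_0 of_real_1 simp_thms)
  qed (auto simp: v0)
qed

text \<open>The matrices on \<open>p\<close>-fold tensor powers that commute with \<open>V \<otimes> \<dots> \<otimes> V\<close> for every unitary \<open>V\<close>.\<close>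

definition tensor_commutant :: "nat \<Rightarrow> 'x set \<Rightarrow> ((nat \<Rightarrow> 'x) \<Rightarrow> (nat \<Rightarrow> 'x) \<Rightarrow> complex) set" where
  "tensor_commutant p X = {F. \<forall>V\<in>unitary_group X. \<forall>u\<in>{1..p} \<rightarrow>\<^sub>E X. \<forall>w\<in>{1..p} \<rightarrow>\<^sub>E X.
     (\<Sum>x\<in>{1..p} \<rightarrow>\<^sub>E X. (\<Prod>t\<in>{1..p}. V (u t) (x t)) * F x w) =
     (\<Sum>y\<in>{1..p} \<rightarrow>\<^sub>E X. F u y * (\<Prod>t\<in>{1..p}. V (y t) (w t)))}"

lemma tensor_commutantD:
  assumes "F \<in> tensor_commutant p X" "V \<in> unitary_group X" "u \<in> {1..p} \<rightarrow>\<^sub>E X" "w \<in> {1..p} \<rightarrow>\<^sub>E X"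
  shows "(\<Sum>x\<in>{1..p} \<rightarrow>\<^sub>E X. (\<Prod>t\<in>{1..p}. V (u t) (x t)) * F x w) =
     (\<Sum>y\<in>{1..p} \<rightarrow>\<^sub>E X. F u y * (\<Prod>t\<in>{1..p}. V (y t) (w t)))"
  using assms by (auto simp: tensor_commutant_def)

lemma prod_delta_tuples:
  fixes x :: "nat \<Rightarrow> 'x"
  assumes "x \<in> {1..p} \<rightarrow>\<^sub>E X" "y \<in> {1..p} \<rightarrow>\<^sub>E X"
  shows "(\<Prod>t\<in>{1..p}. if x t = y t then f t else 0) = (if x = y then \<Prod>t\<in>{1..p}. f t else (0::complex))"
proof (cases "x = y")
  case False
  then obtain t where "t \<in> {1..p}" "x t \<noteq> y t" using PiE_ext[OF assms] by blast
  then have "(\<Prod>t\<in>{1..p}. if x t = y t then f t else 0) = 0" by (intro prod_zero) auto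
  then show ?thesis using False by simp
qed simp

text \<open>Commuting with the diagonal unitary that is \<open>z\<close> at \<open>c\<close> and 1
  elsewhere multiplies the entry at (u, w) by z to the multiplicity of \<open>c\<close> in
  \<open>u\<close> on one side, and in \<open>w\<close> on the other. A nonzero entry forces the two
  powers to agree.\<close>

lemma tensor_commutant_weight:
  assumes nz: "F u w \<noteq> 0" and X: "finite X" and F: "F \<in> tensor_commutant p X"
    and u: "u \<in> {1..p} \<rightarrow>\<^sub>E X" and w: "w \<in> {1..p} \<rightarrow>\<^sub>E X"
  shows "card {t\<in>{1..p}. u t = c} = card {t\<in>{1..p}. w t = c}"
proof -
  \<comment> \<open>A primitive root of unity of order p + 1: multiplicities in a p-tuple lie
    between 0 and p, where the powers of \<open>z\<close> are distinct.\<close>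
  define z where "z = cis (2 * pi / real (Suc p))"
  define v where "v x = (if x = c then z else 1)" for x
  let ?V = "\<lambda>x y. if x \<in> X \<and> x = y then v x else 0"
  have V: "?V \<in> unitary_group X"
    by (rule diagonal_unitary[OF X]) (simp add: v_def z_def)
  have fin: "finite ({1..p} \<rightarrow>\<^sub>E X)" using X by (simp add: finite_PiE)
  have prod: "(\<Prod>t\<in>{1..p}. ?V (x t) (y t)) = (if x = y then \<Prod>t\<in>{1..p}. v (x t) else 0)"
    if "x \<in> {1..p} \<rightarrow>\<^sub>E X" "y \<in> {1..p} \<rightarrow>\<^sub>E X" for x y
  proof -
    have "(\<Prod>t\<in>{1..p}. ?V (x t) (y t)) = (\<Prod>t\<in>{1..p}. if x t = y t then v (x t) else 0)"
      using that by (intro prod.cong) auto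
    then show ?thesis by (simp only: prod_delta_tuples[OF that])
  qed
  have pow: "(\<Prod>t\<in>{1..p}. v (x t)) = z ^ card {t\<in>{1..p}. x t = c}" for x
  proof -
    have "(\<Prod>t\<in>{1..p}. v (x t)) = (\<Prod>t\<in>{t\<in>{1..p}. x t = c}. z)"
      unfolding v_def by (rule prod.inter_filter[symmetric]) simp
    then show ?thesis by simp
  qed
  have "(\<Sum>x\<in>{1..p} \<rightarrow>\<^sub>E X. (\<Prod>t\<in>{1..p}. ?V (u t) (x t)) * F x w) =
      (\<Sum>x\<in>{1..p} \<rightarrow>\<^sub>E X. if u = x then (\<Prod>t\<in>{1..p}. v (u t)) * F u w else 0)"
    by (intro sum.cong refl) (simp only: prod[OF u], simp)
  also have "\<dots> = (\<Prod>t\<in>{1..p}. v (u t)) * F u w" using u fin by simp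
  finally have L: "(\<Sum>x\<in>{1..p} \<rightarrow>\<^sub>E X. (\<Prod>t\<in>{1..p}. ?V (u t) (x t)) * F x w) = (\<Prod>t\<in>{1..p}. v (u t)) * F u w" .
  have "(\<Sum>y\<in>{1..p} \<rightarrow>\<^sub>E X. F u y * (\<Prod>t\<in>{1..p}. ?V (y t) (w t))) =
      (\<Sum>y\<in>{1..p} \<rightarrow>\<^sub>E X. if y = w then F u w * (\<Prod>t\<in>{1..p}. v (w t)) else 0)"
    by (intro sum.cong refl) (simp only: prod[OF _ w], simp)
  also have "\<dots> = F u w * (\<Prod>t\<in>{1..p}. v (w t))" using w fin by simp
  finally have R: "(\<Sum>y\<in>{1..p} \<rightarrow>\<^sub>E X. F u y * (\<Prod>t\<in>{1..p}. ?V (y t) (w t))) = F u w * (\<Prod>t\<in>{1..p}. v (w t))" .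
  from tensor_commutantD[OF F V u w]
  have "(\<Prod>t\<in>{1..p}. v (u t)) * F u w = F u w * (\<Prod>t\<in>{1..p}. v (w t))"
    unfolding L R .
  then have eq: "z ^ card {t\<in>{1..p}. u t = c} = z ^ card {t\<in>{1..p}. w t = c}"
    using nz by (simp only: pow) simp
  have bound: "card {t\<in>{1..p}. x t = c} < Suc p" for x :: "nat \<Rightarrow> 'a"
    using card_mono[of "{1..p}" "{t\<in>{1..p}. x t = c}"] by (simp add: subset_iff)
  have zpow: "z ^ l = cis (2 * pi * real l / real (Suc p))" for l
    unfolding z_def Complex.DeMoivre by (rule arg_cong[of _ _ cis]) simp
  have "inj_on (\<lambda>l. cis (2 * pi * real l / real (Suc p))) {..<Suc p}"
    using bij_betw_imp_inj_on[OF Complex.bij_betw_roots_unity[of "Suc p"]] by simp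
  then show ?thesis using eq bound unfolding zpow by (auto dest: inj_onD)
qed

text \<open>The complements of the two images have equal size, so any bijection between them
  completes the prescribed part. It serves to carry one injective tuple to another by a permutation
  matrix.\<close>

lemma extend_to_permutation:
  assumes X: "finite X" and f: "inj_on f A" "f ` A \<subseteq> X" and g: "inj_on g A" "g ` A \<subseteq> X"
  obtains \<pi> where "\<pi> permutes X" "\<And>a. a \<in> A \<Longrightarrow> \<pi> (f a) = g a"
proof -
  have "card (X - f ` A) = card (X - g ` A)"
    using X f g by (simp add: card_Diff_subset finite_subset card_image)
  then obtain h where h: "bij_betw h (X - f ` A) (X - g ` A)"
    using X by (meson finite_Diff finite_same_card_bij)
  define k where "k = g \<circ> the_inv_into A f"
  define \<pi> where "\<pi> x = (if x \<in> f ` A then k x else if x \<in> X then h x else x)" for x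
  have "bij_betw k (f ` A) (g ` A)"
    unfolding k_def using f(1) g(1)
    by (intro bij_betw_trans[OF bij_betw_the_inv_into[OF inj_on_imp_bij_betw]] inj_on_imp_bij_betw)
  then have "bij_betw \<pi> (f ` A) (g ` A)"
    by (rule bij_betw_cong[THEN iffD1, rotated]) (simp add: \<pi>_def)
  moreover have "bij_betw \<pi> (X - f ` A) (X - g ` A)"
    using h by (rule bij_betw_cong[THEN iffD1, rotated]) (simp add: \<pi>_def)
  ultimately have "bij_betw \<pi> (f ` A \<union> (X - f ` A)) (g ` A \<union> (X - g ` A))"
    by (rule bij_betw_combine) auto
  moreover have "f ` A \<union> (X - f ` A) = X" "g ` A \<union> (X - g ` A) = X" using f g by auto
  ultimately have "bij_betw \<pi> X X" by simp
  then have "\<pi> permutes X"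
    by (rule bij_imp_permutes) (use f in \<open>auto simp: \<pi>_def\<close>)
  moreover have "\<pi> (f a) = g a" if "a \<in> A" for a
    using that f(1) by (simp add: \<pi>_def k_def the_inv_into_f_f)
  ultimately show thesis by (rule that)
qed

text \<open>Let W be the p-th tensor power of the permutation matrix that takes \<open>e\<close> to
  \<open>x\<close>. Row \<open>e\<close> of W F is row \<open>x\<close> of F, whereas row
  \<open>e\<close> of F W is built from the vanishing row \<open>e\<close> of F.\<close>

lemma tensor_commutant_zero_row_injective:
  assumes X: "finite X" and F: "F \<in> tensor_commutant p X"
    and e: "e \<in> {1..p} \<rightarrow>\<^sub>E X" "inj_on e {1..p}" and zero: "\<And>w. w \<in> {1..p} \<rightarrow>\<^sub>E X \<Longrightarrow> F e w = 0"
    and x: "x \<in> {1..p} \<rightarrow>\<^sub>E X" "inj_on x {1..p}" and w: "w \<in> {1..p} \<rightarrow>\<^sub>E X"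
  shows "F x w = 0"
proof -
  obtain \<pi> where \<pi>: "\<pi> permutes X" "\<And>t. t \<in> {1..p} \<Longrightarrow> \<pi> (e t) = x t"
    using extend_to_permutation[OF X e(2) _ x(2)] e(1) x(1) by (metis PiE_mem image_subsetI)
  let ?V = "\<lambda>x y. if x \<in> X \<and> y = \<pi> x then 1 else (0::complex)"
  have "(\<Prod>t\<in>{1..p}. ?V (e t) (y t)) = (\<Prod>t\<in>{1..p}. if x t = y t then 1 else 0)"
    for y using e(1) \<pi>(2) by (intro prod.cong) auto
  then have "(\<Sum>y\<in>{1..p} \<rightarrow>\<^sub>E X. (\<Prod>t\<in>{1..p}. ?V (e t) (y t)) * F y w) =
      (\<Sum>y\<in>{1..p} \<rightarrow>\<^sub>E X. if x = y then F y w else 0)"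
    by (intro sum.cong refl) (simp only: prod_delta_tuples[OF x(1)], simp)
  also have "\<dots> = F x w" using x(1) X by (simp add: finite_PiE)
  finally show ?thesis
    using tensor_commutantD[OF F permutation_unitary[OF X \<pi>(1)] e(1) w] zero by simp
qed

text \<open>A reflection mixing \<open>a\<close> and \<open>b\<close> turns the basis tensor \<open>x(s := a)\<close> into a combination of
  basis tensors, among which \<open>x\<close> is the only one of its weight.\<close>

lemma tensor_commutant_zero_row_step:
  assumes X: "finite X" and F: "F \<in> tensor_commutant p X"
    and x: "x \<in> {1..p} \<rightarrow>\<^sub>E X" and s: "s \<in> {1..p}" and a: "a \<in> X" "a \<notin> x ` {1..p}"
    and zero: "\<And>w. w \<in> {1..p} \<rightarrow>\<^sub>E X \<Longrightarrow> F (x(s := a)) w = 0"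
    and w: "w \<in> {1..p} \<rightarrow>\<^sub>E X"
  shows "F x w = 0"
proof (rule ccontr)
  assume nz: "F x w \<noteq> 0"
  define b where "b = x s"
  have ab: "a \<noteq> b" and b: "b \<in> X" using a s x by (auto simp: b_def)
  \<comment> \<open>The triple 3, 4, 5 gives a rational unit vector with unequal coordinates. With
    equal ones the diagonal entry \<open>V b b\<close> would be 0, and the coefficient of
    \<open>x\<close> would vanish as soon as \<open>x\<close> repeats \<open>b\<close>; here it is
    -7/25, and \<open>V a b\<close> is -24/25.\<close>
  define v :: "'a \<Rightarrow> real" where "v c = (if c = a then 3/5 else if c = b then 4/5 else 0)" for c
  define V where "V c c' = complex_of_real (of_bool (c \<in> X \<and> c = c') - 2 * v c * v c')" for c c'
  have "(\<Sum>c\<in>X. (v c)\<^sup>2) = (\<Sum>c\<in>X. (if c = a then 9/25 else 0) + (if c = b then 16/25 else 0))"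
    using ab by (intro sum.cong) (auto simp: v_def power2_eq_square)
  also have "\<dots> = 1" using a(1) b X by (simp add: sum.distrib)
  finally have V: "V \<in> unitary_group X"
    unfolding V_def using a(1) b by (intro reflection_unitary[OF X]) (auto simp: v_def)
  let ?u = "x(s := a)"
  have u: "?u \<in> {1..p} \<rightarrow>\<^sub>E X" using x a(1) s by (auto simp: PiE_iff extensional_def)
  \<comment> \<open>A contributing \<open>y\<close> has the weight of \<open>w\<close>, which is
    that of \<open>x\<close>, so it avoids \<open>a\<close>. As \<open>V\<close> only mixes
    \<open>a\<close> with \<open>b\<close>, every position where \<open>x(s := a)\<close> has
    \<open>a\<close> or \<open>b\<close> must carry \<open>b\<close> in \<open>y\<close>, and all
    other positions are unchanged.\<close>
  have other: "(\<Prod>t\<in>{1..p}. V (?u t) (y t)) * F y w = 0" if y: "y \<in> {1..p} \<rightarrow>\<^sub>E X" "y \<noteq> x" for y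
  proof (rule ccontr)
    assume "\<not> ?thesis"
    then have Fy: "F y w \<noteq> 0" and Vy: "(\<Prod>t\<in>{1..p}. V (?u t) (y t)) \<noteq> 0" by auto
    have "card {t\<in>{1..p}. y t = a} = card {t\<in>{1..p}. x t = a}"
      by (rule trans[OF tensor_commutant_weight[OF Fy X F y(1) w] tensor_commutant_weight[OF nz X F x w, symmetric]])
    also have "{t\<in>{1..p}. x t = a} = {}" using a(2) by auto
    finally have ya: "y t \<noteq> a" if "t \<in> {1..p}" for t using that by auto
    have "y t = x t" if t: "t \<in> {1..p}" for t
    proof -
      have "V (?u t) (y t) \<noteq> 0" using Vy t by auto
      then show ?thesis using ya[OF t] t a(2) by (auto simp: V_def v_def b_def split: if_splits)
    qed
    then have "y = x" using PiE_ext[OF y(1) x] by blast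
    with y(2) show False by simp
  qed
  have "(\<Prod>t\<in>{1..p}. V (?u t) (x t)) \<noteq> 0"
    using ab x a(1) b by (auto simp: V_def v_def b_def)
  moreover have "(\<Sum>y\<in>{1..p} \<rightarrow>\<^sub>E X. (\<Prod>t\<in>{1..p}. V (?u t) (y t)) * F y w) = (\<Prod>t\<in>{1..p}. V (?u t) (x t)) * F x w"
    using x X other
    by (subst sum.mono_neutral_right[where S = "{x}"]) (auto simp: finite_PiE)
  ultimately show False
    using tensor_commutantD[OF F V u w] zero nz by simp
qed

text \<open>The induction measure is the number of values that \<open>x\<close> lacks for being
  injective. Replacing one of two equal entries by a value outside the image lowers it; such a value
  exists because the image has fewer than p elements and \<open>p \<le> card X\<close>.\<close>

lemma tensor_commutant_zero_row:
  assumes X: "finite X" "p \<le> card X" and F: "F \<in> tensor_commutant p X"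
    and e: "e \<in> {1..p} \<rightarrow>\<^sub>E X" "inj_on e {1..p}" and zero: "\<And>w. w \<in> {1..p} \<rightarrow>\<^sub>E X \<Longrightarrow> F e w = 0"
    and x: "x \<in> {1..p} \<rightarrow>\<^sub>E X" and w: "w \<in> {1..p} \<rightarrow>\<^sub>E X"
  shows "F x w = 0"
  using x w
proof (induction "p - card (x ` {1..p})" arbitrary: x w rule: less_induct)
  case less
  show ?case
  proof (cases "inj_on x {1..p}")
    case True
    show ?thesis by (rule tensor_commutant_zero_row_injective[OF X(1) F e zero less.prems(1) True less.prems(2)])
  next
    case False
    then have card: "card (x ` {1..p}) < p"
      using card_image_le[of "{1..p}" x] eq_card_imp_inj_on[of "{1..p}" x] by fastforce
    obtain s s' where s: "s \<in> {1..p}" "s' \<in> {1..p}" "s \<noteq> s'" "x s = x s'"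
      using False by (auto simp: inj_on_def)
    have sub: "x ` {1..p} \<subseteq> X" using less.prems(1) by auto
    then obtain a where a: "a \<in> X" "a \<notin> x ` {1..p}"
      using card X(2) by (metis leD order_refl subsetI subset_antisym)
    \<comment> \<open>Position \<open>s'\<close> still carries the value at \<open>s\<close>, so
      overwriting \<open>s\<close> loses nothing from the image.\<close>
    have "x t \<in> x ` ({1..p} - {s})" if "t \<in> {1..p}" for t
      using that s imageI[of s' "{1..p} - {s}" x] by (cases "t = s") auto
    then have "x ` ({1..p} - {s}) = x ` {1..p}" by blast
    then have "(x(s := a)) ` {1..p} = insert a (x ` {1..p})"
      using s(1) by (simp only: fun_upd_image if_True)
    then have "p - card ((x(s := a)) ` {1..p}) < p - card (x ` {1..p})"
      using card a(2) by simp
    moreover have "x(s := a) \<in> {1..p} \<rightarrow>\<^sub>E X" using less.prems(1) a(1) s by (auto simp: PiE_iff extensional_def)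
    ultimately have "F (x(s := a)) w = 0" if "w \<in> {1..p} \<rightarrow>\<^sub>E X" for w
      using less.hyps that by blast
    then show ?thesis
      by (rule tensor_commutant_zero_row_step[OF X(1) F less.prems(1) s(1) a _ less.prems(2)])
  qed
qed

text \<open>Permuting tensor factors commutes with applying the same matrix to each factor:
  reindexing the product over positions moves \<sigma> from one tuple to the other.\<close>

lemma permutation_operator_commutes:
  assumes X: "finite X" and \<sigma>: "\<sigma> \<in> sym_group p"
  shows "(\<lambda>x y. of_bool (y = x \<circ> \<sigma>)) \<in> tensor_commutant p X"
  unfolding tensor_commutant_def mem_Collect_eq
proof (intro ballI)
  fix V :: "'a op" and u w assume u: "u \<in> {1..p} \<rightarrow>\<^sub>E X" and w: "w \<in> {1..p} \<rightarrow>\<^sub>E X"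
  have fin: "finite ({1..p} \<rightarrow>\<^sub>E X)" using X by (simp add: finite_PiE)
  have eq: "w = x \<circ> \<sigma> \<longleftrightarrow> x = w \<circ> inv \<sigma>" for x
    using sym_group_cancel(3,4)[OF \<sigma>] by metis
  have "(\<Sum>x\<in>{1..p} \<rightarrow>\<^sub>E X. (\<Prod>t\<in>{1..p}. V (u t) (x t)) * of_bool (w = x \<circ> \<sigma>)) =
     (\<Sum>x\<in>{1..p} \<rightarrow>\<^sub>E X. if x = w \<circ> inv \<sigma> then \<Prod>t\<in>{1..p}. V (u t) (x t) else 0)"
    by (intro sum.cong refl) (simp add: eq)
  also have "\<dots> = (\<Prod>t\<in>{1..p}. V (u t) (w (inv \<sigma> t)))"
    using tuple_comp_sym[OF w sym_group_inv[OF \<sigma>]] fin by simp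
  also have "\<dots> = (\<Prod>t\<in>{1..p}. V (u (\<sigma> t)) (w t))"
    using prod.permute[of \<sigma> "{1..p}" "\<lambda>t. V (u t) (w (inv \<sigma> t))"] \<sigma> sym_group_inv_o(1)[OF \<sigma>]
    by (simp add: sym_group_def fun_eq_iff comp_def)
  also have "\<dots> = (\<Sum>y\<in>{1..p} \<rightarrow>\<^sub>E X. if y = u \<circ> \<sigma> then \<Prod>t\<in>{1..p}. V (y t) (w t) else 0)"
    using tuple_comp_sym[OF u \<sigma>] fin by simp
  also have "\<dots> = (\<Sum>y\<in>{1..p} \<rightarrow>\<^sub>E X. of_bool (y = u \<circ> \<sigma>) * (\<Prod>t\<in>{1..p}. V (y t) (w t)))"
    by (intro sum.cong refl) simp
  finally show "(\<Sum>x\<in>{1..p} \<rightarrow>\<^sub>E X. (\<Prod>t\<in>{1..p}. V (u t) (x t)) * of_bool (w = x \<circ> \<sigma>)) =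
     (\<Sum>y\<in>{1..p} \<rightarrow>\<^sub>E X. of_bool (y = u \<circ> \<sigma>) * (\<Prod>t\<in>{1..p}. V (y t) (w t)))" .
qed

lemma tensor_commutant_sum:
  assumes "\<And>i. i \<in> I \<Longrightarrow> F i \<in> tensor_commutant p X"
  shows "(\<lambda>x y. \<Sum>i\<in>I. c i * F i x y) \<in> tensor_commutant p X"
  unfolding tensor_commutant_def mem_Collect_eq
proof (intro ballI)
  fix V u w assume V: "V \<in> unitary_group X" and u: "u \<in> {1..p} \<rightarrow>\<^sub>E X" and w: "w \<in> {1..p} \<rightarrow>\<^sub>E X"
  let ?X = "{1..p} \<rightarrow>\<^sub>E X"
  have "(\<Sum>x\<in>?X. (\<Prod>t\<in>{1..p}. V (u t) (x t)) * (\<Sum>i\<in>I. c i * F i x w)) =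
      (\<Sum>i\<in>I. c i * (\<Sum>x\<in>?X. (\<Prod>t\<in>{1..p}. V (u t) (x t)) * F i x w))"
    unfolding sum_distrib_left by (subst sum.swap) (simp only: mult_ac)
  also have "\<dots> = (\<Sum>i\<in>I. c i * (\<Sum>y\<in>?X. F i u y * (\<Prod>t\<in>{1..p}. V (y t) (w t))))"
    by (intro sum.cong refl arg_cong2[where f = "(*)"] tensor_commutantD assms V u w)
  also have "\<dots> = (\<Sum>y\<in>?X. (\<Sum>i\<in>I. c i * F i u y) * (\<Prod>t\<in>{1..p}. V (y t) (w t)))"
    unfolding sum_distrib_left sum_distrib_right by (subst sum.swap) (simp only: mult_ac)
  finally show "(\<Sum>x\<in>?X. (\<Prod>t\<in>{1..p}. V (u t) (x t)) * (\<Sum>i\<in>I. c i * F i x w)) =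
    (\<Sum>y\<in>?X. (\<Sum>i\<in>I. c i * F i u y) * (\<Prod>t\<in>{1..p}. V (y t) (w t)))" .
qed

lemma tensor_commutant_diff:
  assumes "F \<in> tensor_commutant p X" "G \<in> tensor_commutant p X"
  shows "(\<lambda>x y. F x y - G x y) \<in> tensor_commutant p X"
  \<comment> \<open>The difference is the combination with coefficients 1 and -1 indexed by the two
    truth values.\<close>
  using tensor_commutant_sum[of UNIV "\<lambda>b. if b then F else G" p X "\<lambda>b. if b then 1 else -1"] assms
  by (simp add: UNIV_bool split: if_splits)

text \<open>All multiplicities in \<open>e\<close> are 0 or 1, so \<open>w\<close> is injective with
  the same image, and \<sigma> is \<open>w\<close> followed by the inverse of
  \<open>e\<close>.\<close>

lemma rearrangement_of_injective:
  assumes e: "e \<in> {1..p} \<rightarrow>\<^sub>E X" "inj_on e {1..p}" and w: "w \<in> {1..p} \<rightarrow>\<^sub>E X"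
    and card: "\<And>c. card {t\<in>{1..p}. e t = c} = card {t\<in>{1..p}. w t = c}"
  obtains \<sigma> where "\<sigma> \<in> sym_group p" "w = e \<circ> \<sigma>"
proof -
  define \<sigma> where "\<sigma> t = (if t \<in> {1..p} then the_inv_into {1..p} e (w t) else t)" for t
  have mem: "w t \<in> e ` {1..p}" if t: "t \<in> {1..p}" for t
  proof -
    have "card {s\<in>{1..p}. w s = w t} > 0" using t by (auto simp: card_gt_0_iff)
    then have "{s\<in>{1..p}. e s = w t} \<noteq> {}" using card[of "w t"] by (metis card.empty less_irrefl)
    then show ?thesis by force
  qed
  have e\<sigma>: "e (\<sigma> t) = w t" if "t \<in> {1..p}" for t
    using that mem[OF that] e(2) by (simp add: \<sigma>_def f_the_inv_into_f)
  have inj_w: "inj_on w {1..p}"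
  proof (rule inj_onI)
    fix s t assume st: "s \<in> {1..p}" "t \<in> {1..p}" "w s = w t"
    have "r = r'" if "r \<in> {r\<in>{1..p}. e r = w t}" "r' \<in> {r\<in>{1..p}. e r = w t}" for r r'
      using that inj_onD[OF e(2), of r r'] by simp
    then have "card {r\<in>{1..p}. e r = w t} \<le> 1"
      unfolding One_nat_def by (subst card_le_Suc0_iff_eq) auto
    then have "card {r\<in>{1..p}. w r = w t} \<le> 1" using card[of "w t"] by simp
    then show "s = t"
      unfolding One_nat_def by (subst (asm) card_le_Suc0_iff_eq) (use st in auto)
  qed
  have sub: "\<sigma> ` {1..p} \<subseteq> {1..p}"
    using the_inv_into_into[OF e(2) mem subset_refl] by (intro image_subsetI) (simp add: \<sigma>_def)
  have "inj_on \<sigma> {1..p}"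
    using e\<sigma> inj_w by (metis (no_types, lifting) inj_onD inj_onI)
  then have "bij_betw \<sigma> {1..p} {1..p}"
    using sub by (simp add: bij_betw_def endo_inj_surj)
  then have \<sigma>: "\<sigma> \<in> sym_group p"
    unfolding sym_group_def by (auto intro!: bij_imp_permutes simp: \<sigma>_def)
  have "w = e \<circ> \<sigma>"
    using PiE_ext[OF w tuple_comp_sym[OF e(1) \<sigma>]] e\<sigma> by simp
  with \<sigma> show thesis by (rule that)
qed

text \<open>In row \<open>e\<close> different permutation operators have their entry 1 in different
  columns, so each coefficient can be read off separately.\<close>

lemma comp_injective_tuple_eq_iff:
  assumes "inj_on e {1..p}" "\<sigma> \<in> sym_group p" "\<tau> \<in> sym_group p"
  shows "e \<circ> \<sigma> = e \<circ> \<tau> \<longleftrightarrow> \<sigma> = \<tau>"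
proof
  assume eq: "e \<circ> \<sigma> = e \<circ> \<tau>"
  show "\<sigma> = \<tau>"
  proof
    fix t show "\<sigma> t = \<tau> t"
    proof (cases "t \<in> {1..p}")
      case True
      then show ?thesis using fun_cong[OF eq, of t] inj_onD[OF assms(1)] sym_group_in assms(2,3) by simp
    next
      case False
      then show ?thesis using assms(2,3) by (simp add: sym_group_def permutes_not_in)
    qed
  qed
qed simp

text \<open>Schur--Weyl duality, in the range \<open>p \<le> dim\<close> where the coefficients can be read off from one row.\<close>

theorem tensor_commutant_expansion:
  assumes X: "finite X" "p \<le> card X" and F: "F \<in> tensor_commutant p X"
    and e: "e \<in> {1..p} \<rightarrow>\<^sub>E X" "inj_on e {1..p}"
    and x: "x \<in> {1..p} \<rightarrow>\<^sub>E X" and y: "y \<in> {1..p} \<rightarrow>\<^sub>E X"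
  shows "F x y = (\<Sum>\<sigma>\<in>sym_group p. F e (e \<circ> \<sigma>) * of_bool (y = x \<circ> \<sigma>))"
proof -
  let ?G = "\<lambda>x y. F x y - (\<Sum>\<sigma>\<in>sym_group p. F e (e \<circ> \<sigma>) * of_bool (y = x \<circ> \<sigma>))"
  have G: "?G \<in> tensor_commutant p X"
    by (intro tensor_commutant_diff F tensor_commutant_sum permutation_operator_commutes X(1))
  \<comment> \<open>In a column that rearranges \<open>e\<close> exactly one summand survives and it
    equals the entry of \<open>F\<close>; in any other column that entry vanishes by weight.\<close>
  have "?G e w = 0" if w: "w \<in> {1..p} \<rightarrow>\<^sub>E X" for w
  proof (cases "\<exists>\<sigma>\<in>sym_group p. w = e \<circ> \<sigma>")
    case True
    then obtain \<tau> where \<tau>: "\<tau> \<in> sym_group p" "w = e \<circ> \<tau>" by blast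
    then have "(\<Sum>\<sigma>\<in>sym_group p. F e (e \<circ> \<sigma>) * of_bool (w = e \<circ> \<sigma>)) =
      (\<Sum>\<sigma>\<in>sym_group p. if \<sigma> = \<tau> then F e (e \<circ> \<sigma>) else 0)"
      by (intro sum.cong refl) (auto simp: comp_injective_tuple_eq_iff[OF e(2)])
    then show ?thesis using \<tau> by (simp add: finite_sym_group)
  next
    case False
    then have "F e w = 0"
      using tensor_commutant_weight[OF _ X(1) F e(1) w] rearrangement_of_injective[OF e w] by metis
    moreover have "(\<Sum>\<sigma>\<in>sym_group p. F e (e \<circ> \<sigma>) * of_bool (w = e \<circ> \<sigma>)) = 0"
      using False by (intro sum.neutral) auto
    ultimately show ?thesis by simp
  qed
  then have "?G x y = 0" by (intro tensor_commutant_zero_row[OF X G e _ x y])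
  then show ?thesis by simp
qed

section \<open>Moments of the Haar measure\<close>

lemma entry_continuous: "continuous_on UNIV (\<lambda>U :: 'x op. U x y)"
  by (rule continuous_on_product_then_coordinatewise[OF continuous_on_product_coordinates])

lemma entry_measurable [measurable]: "(\<lambda>U. U x y) \<in> borel_measurable (unitary_borel X)"
  unfolding unitary_borel_def
  by (intro measurable_restrict_space1 borel_measurable_continuous_onI entry_continuous)

lemma cnj_measurable [measurable]: "cnj \<in> borel_measurable borel"
  by (intro borel_measurable_continuous_onI continuous_on_cnj continuous_on_id)

lemma space_unitary_borel: "space (unitary_borel X) = unitary_group X"
  by (simp add: unitary_borel_def space_restrict_space)

lemma left_mult_measurable:
  assumes X: "finite X" and V: "V \<in> unitary_group X"
  shows "op_mult X V \<in> measurable (unitary_borel X) (unitary_borel X)"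
proof -
  have "continuous_on UNIV (\<lambda>U. op_mult X V U x y)" for x y
    unfolding op_mult_def by (intro continuous_on_sum continuous_on_mult continuous_on_const entry_continuous)
  then have "continuous_on UNIV (op_mult X V)"
    by (intro continuous_on_coordinatewise_then_product)
  then show ?thesis
    unfolding unitary_borel_def
    by (intro measurable_restrict_space3 borel_measurable_continuous_onI)
       (use unitary_group_mult[OF X V] in auto)
qed

context
  fixes X :: "'x set" and \<mu> :: "'x op measure"
  assumes X: "finite X" and haar: "is_haar X \<mu>"
begin

lemma haar_prob: "prob_space \<mu>"
  using haar by (simp add: is_haar_def)

lemma haar_sets [measurable_cong]: "sets \<mu> = sets (unitary_borel X)"
  using haar by (simp add: is_haar_def)

lemma haar_space: "space \<mu> = unitary_group X"
  using sets_eq_imp_space_eq[OF haar_sets] by (simp add: space_unitary_borel)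

lemma haar_invariant_integral:
  fixes g :: "'x op \<Rightarrow> complex"
  assumes V: "V \<in> unitary_group X" and g [measurable]: "g \<in> borel_measurable (unitary_borel X)"
  shows "(\<integral>U. g (op_mult X V U) \<partial>\<mu>) = (\<integral>U. g U \<partial>\<mu>)"
proof -
  have [measurable]: "op_mult X V \<in> measurable \<mu> \<mu>"
    using left_mult_measurable[OF X V] by (simp add: measurable_cong_sets[OF haar_sets haar_sets])
  have [measurable]: "g \<in> borel_measurable \<mu>"
    using g by (simp add: measurable_cong_sets[OF haar_sets refl])
  have "(\<integral>U. g (op_mult X V U) \<partial>\<mu>) = (\<integral>U. g U \<partial>distr \<mu> \<mu> (op_mult X V))"
    by (rule integral_distr[symmetric]) measurable
  also have "distr \<mu> \<mu> (op_mult X V) = \<mu>" using haar V by (simp add: is_haar_def)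
  finally show ?thesis .
qed

end

text \<open>Formulated for any probability measure on the Borel sets of the group, so that it covers
  the law of each random unitary as well as a Haar measure.\<close>

lemma unitary_monomial_integrable:
  assumes X: "finite X" and \<mu>: "prob_space \<mu>" "sets \<mu> = sets (unitary_borel X)"
  shows "integrable \<mu> (\<lambda>U. \<Prod>t\<in>I. U (x t) (j t) * cnj (U (y t) (j' t)))"
proof -
  interpret prob_space \<mu> by (fact \<mu>(1))
  have [measurable]: "(\<lambda>U. U x y) \<in> borel_measurable \<mu>" for x y
    by (simp add: measurable_cong_sets[OF \<mu>(2) refl] entry_measurable)
  have "space \<mu> = unitary_group X"
    using sets_eq_imp_space_eq[OF \<mu>(2)] by (simp add: space_unitary_borel)
  then have "norm (\<Prod>t\<in>I. U (x t) (j t) * cnj (U (y t) (j' t))) \<le> 1" if "U \<in> space \<mu>" for U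
    unfolding prod_norm[symmetric] using that unitary_group_entry_le[OF X]
    by (intro prod_le_1) (auto simp: norm_mult intro!: mult_le_one)
  moreover have "(\<lambda>U. \<Prod>t\<in>I. U (x t) (j t) * cnj (U (y t) (j' t))) \<in> borel_measurable \<mu>" by measurable
  ultimately show ?thesis
    by (intro integrable_const_bound[where B = 1]) auto
qed

text \<open>The column labels come first: partial application to them leaves the matrix in the row
  labels that is an element of \<open>tensor_commutant\<close>.\<close>

definition unitary_moment where
  "unitary_moment p \<mu> j j' x y = (\<integral>U. (\<Prod>t\<in>{1..p}. U (x t) (j t) * cnj (U (y t) (j' t))) \<partial>\<mu>)"

text \<open>For fixed column labels this is the mean of the rank-one operator formed from two
  columns of the p-th tensor power of U. Replacing U by V U conjugates it with the tensor power of
  V, and left invariance leaves the mean unchanged.\<close>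

lemma unitary_moment_commutant:
  assumes X: "finite X" and haar: "is_haar X \<mu>"
  shows "unitary_moment p \<mu> j j' \<in> tensor_commutant p X"
  unfolding tensor_commutant_def mem_Collect_eq
proof (intro ballI)
  let ?T = "{1..p} \<rightarrow>\<^sub>E X"
  fix V u w assume V: "V \<in> unitary_group X" and u: "u \<in> ?T" and w: "w \<in> ?T"
  note int = unitary_monomial_integrable[OF X haar_prob[OF X haar] haar_sets[OF X haar]]
  let ?I = "\<lambda>U x y. \<Prod>t\<in>{1..p}. U (x t) (j t) * cnj (U (y t) (j' t))"
  have pointwise: "(\<Sum>x\<in>?T. (\<Prod>t\<in>{1..p}. V (u t) (x t)) * ?I U x w) =
      (\<Sum>y\<in>?T. ?I (op_mult X V U) u y * (\<Prod>t\<in>{1..p}. V (y t) (w t)))"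
    if U: "U \<in> unitary_group X" for U
  proof -
    \<comment> \<open>The conjugated entries of V* V U = U: the factors \<open>V (y t) (w t)\<close>
      undo the translation in the conjugated half of the monomial.\<close>
    have VU: "(\<Sum>c\<in>X. cnj (op_mult X V U c l) * V c b) = cnj (U b l)" for b l
    proof -
      have "(\<Sum>c\<in>X. cnj (op_mult X V U c l) * V c b) = cnj (op_mult X (op_adjoint V) (op_mult X V U) b l)"
        unfolding op_mult_def[of X "op_adjoint V"] by (simp add: op_adjoint_def mult.commute)
      then show ?thesis by (simp only: unitary_group_adjoint_mult[OF X V U])
    qed
    have "(\<Sum>y\<in>?T. ?I (op_mult X V U) u y * (\<Prod>t\<in>{1..p}. V (y t) (w t))) =
        (\<Sum>y\<in>?T. \<Prod>t\<in>{1..p}. op_mult X V U (u t) (j t) * (cnj (op_mult X V U (y t) (j' t)) * V (y t) (w t)))"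
      by (simp only: prod.distrib[symmetric] mult.assoc)
    also have "\<dots> = (\<Prod>t\<in>{1..p}. \<Sum>c\<in>X. op_mult X V U (u t) (j t) * (cnj (op_mult X V U c (j' t)) * V c (w t)))"
      by (rule prod_sum_PiE[symmetric]) (use X in auto)
    also have "\<dots> = (\<Prod>t\<in>{1..p}. \<Sum>c\<in>X. V (u t) c * (U c (j t) * cnj (U (w t) (j' t))))"
      by (simp only: sum_distrib_left[symmetric] VU)
         (simp only: op_mult_def sum_distrib_right mult.assoc)
    also have "\<dots> = (\<Sum>x\<in>?T. \<Prod>t\<in>{1..p}. V (u t) (x t) * (U (x t) (j t) * cnj (U (w t) (j' t))))"
      by (rule prod_sum_PiE) (use X in auto)
    also have "\<dots> = (\<Sum>x\<in>?T. (\<Prod>t\<in>{1..p}. V (u t) (x t)) * ?I U x w)"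
      by (simp only: prod.distrib)
    finally show ?thesis by simp
  qed
  have invariant: "(\<integral>U. ?I (op_mult X V U) u y \<partial>\<mu>) = unitary_moment p \<mu> j j' u y" for y
    unfolding unitary_moment_def by (rule haar_invariant_integral[OF X haar V]) measurable
  have int': "integrable \<mu> (\<lambda>U. ?I (op_mult X V U) u y)" for y
  proof -
    interpret prob_space \<mu> by (rule haar_prob[OF X haar])
    have [measurable]: "(\<lambda>U. U x y) \<in> borel_measurable \<mu>" for x y
      by (simp add: measurable_cong_sets[OF haar_sets[OF X haar] refl] entry_measurable)
    have "norm (?I (op_mult X V U) u y) \<le> 1" if "U \<in> space \<mu>" for U
      unfolding prod_norm[symmetric]
      using that unitary_group_entry_le[OF X unitary_group_mult[OF X V]] haar_space[OF X haar]
      by (intro prod_le_1) (auto simp: norm_mult intro!: mult_le_one)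
    moreover have "(\<lambda>U. op_mult X V U x y) \<in> borel_measurable \<mu>" for x y
      unfolding op_mult_def by measurable
    then have "(\<lambda>U. ?I (op_mult X V U) u y) \<in> borel_measurable \<mu>" by measurable
    ultimately show ?thesis
      by (intro integrable_const_bound[where B = 1]) auto
  qed
  have "(\<Sum>x\<in>?T. (\<Prod>t\<in>{1..p}. V (u t) (x t)) * unitary_moment p \<mu> j j' x w) =
      (\<integral>U. (\<Sum>x\<in>?T. (\<Prod>t\<in>{1..p}. V (u t) (x t)) * ?I U x w) \<partial>\<mu>)"
    unfolding unitary_moment_def
    by (subst Bochner_Integration.integral_sum) (auto intro!: int)
  also have "\<dots> = (\<integral>U. (\<Sum>y\<in>?T. ?I (op_mult X V U) u y * (\<Prod>t\<in>{1..p}. V (y t) (w t))) \<partial>\<mu>)"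
    by (rule Bochner_Integration.integral_cong) (simp_all only: pointwise haar_space[OF X haar])
  also have "\<dots> = (\<Sum>y\<in>?T. unitary_moment p \<mu> j j' u y * (\<Prod>t\<in>{1..p}. V (y t) (w t)))"
    unfolding invariant[symmetric]
    using int' by (subst Bochner_Integration.integral_sum) auto
  finally show "(\<Sum>x\<in>?T. (\<Prod>t\<in>{1..p}. V (u t) (x t)) * unitary_moment p \<mu> j j' x w) =
      (\<Sum>y\<in>?T. unitary_moment p \<mu> j j' u y * (\<Prod>t\<in>{1..p}. V (y t) (w t)))" .
qed

text \<open>With \<open>x \<circ> \<tau>\<close> as second row tuple, the conjugated entry at
  position t shares its row with the plain entry at position \<tau> t. Summing over that row gives
  the inner product of two columns, a delta for every single unitary.\<close>

lemma unitary_moment_contraction: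
  assumes X: "finite X" and haar: "is_haar X \<mu>" and \<tau>: "\<tau> \<in> sym_group p"
    and j: "j \<in> {1..p} \<rightarrow>\<^sub>E X" and j': "j' \<in> {1..p} \<rightarrow>\<^sub>E X"
  shows "(\<Sum>x\<in>{1..p} \<rightarrow>\<^sub>E X. unitary_moment p \<mu> j j' x (x \<circ> \<tau>)) = of_bool (j' = j \<circ> \<tau>)"
proof -
  let ?T = "{1..p} \<rightarrow>\<^sub>E X"
  note int = unitary_monomial_integrable[OF X haar_prob[OF X haar] haar_sets[OF X haar]]
  interpret prob_space \<mu> by (rule haar_prob[OF X haar])
  have "(\<Sum>x\<in>?T. \<Prod>t\<in>{1..p}. U (x t) (j t) * cnj (U ((x \<circ> \<tau>) t) (j' t))) = of_bool (j' = j \<circ> \<tau>)"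
    if U: "U \<in> unitary_group X" for U
  proof -
    have "(\<Sum>x\<in>?T. \<Prod>t\<in>{1..p}. U (x t) (j t) * cnj (U ((x \<circ> \<tau>) t) (j' t))) =
      (\<Sum>x\<in>?T. \<Prod>t\<in>{1..p}. cnj (U (x (\<tau> t)) (j' t)) * U (x (\<tau> t)) (j (\<tau> t)))"
    proof (rule sum.cong[OF refl])
      fix x
      have "(\<Prod>t\<in>{1..p}. U (x t) (j t)) = (\<Prod>t\<in>{1..p}. U (x (\<tau> t)) (j (\<tau> t)))"
        using prod.permute[of \<tau> "{1..p}" "\<lambda>t. U (x t) (j t)"] \<tau> by (simp add: sym_group_def comp_def)
      then show "(\<Prod>t\<in>{1..p}. U (x t) (j t) * cnj (U ((x \<circ> \<tau>) t) (j' t))) =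
        (\<Prod>t\<in>{1..p}. cnj (U (x (\<tau> t)) (j' t)) * U (x (\<tau> t)) (j (\<tau> t)))"
        by (simp only: prod.distrib comp_apply mult.commute)
    qed
    \<comment> \<open>Rearranging by \<tau> permutes the tuples, so \<open>x \<circ> \<tau>\<close>
      may be renamed to \<open>x\<close>.\<close>
    also have "\<dots> = (\<Sum>x\<in>?T. \<Prod>t\<in>{1..p}. cnj (U (x t) (j' t)) * U (x t) (j (\<tau> t)))"
    proof (rule sum.reindex_bij_witness[of _ "\<lambda>x. x \<circ> inv \<tau>" "\<lambda>x. x \<circ> \<tau>"])
      show "x \<circ> \<tau> \<circ> inv \<tau> = x" "x \<circ> inv \<tau> \<circ> \<tau> = x" for x :: "nat \<Rightarrow> 'a"
        by (rule sym_group_cancel[OF \<tau>])+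
      show "x \<circ> \<tau> \<in> ?T" if "x \<in> ?T" for x by (rule tuple_comp_sym[OF that \<tau>])
      show "x \<circ> inv \<tau> \<in> ?T" if "x \<in> ?T" for x by (rule tuple_comp_sym[OF that sym_group_inv[OF \<tau>]])
    qed simp
    also have "\<dots> = (\<Prod>t\<in>{1..p}. \<Sum>c\<in>X. cnj (U c (j' t)) * U c (j (\<tau> t)))"
      by (rule prod_sum_PiE[symmetric]) (use X in auto)
    also have "\<dots> = (\<Prod>t\<in>{1..p}. if j' t = (j \<circ> \<tau>) t then 1 else 0)"
    proof (rule prod.cong[OF refl])
      fix t assume "t \<in> {1..p}"
      then have "j' t \<in> X" using j' by auto
      then show "(\<Sum>c\<in>X. cnj (U c (j' t)) * U c (j (\<tau> t))) = (if j' t = (j \<circ> \<tau>) t then 1 else 0)"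
        by (simp add: unitary_groupD(5)[OF U])
    qed
    also have "\<dots> = of_bool (j' = j \<circ> \<tau>)"
      by (simp only: prod_delta_tuples[OF j' tuple_comp_sym[OF j \<tau>]]) simp
    finally show ?thesis .
  qed
  note pointwise = this
  have "(\<Sum>x\<in>?T. unitary_moment p \<mu> j j' x (x \<circ> \<tau>)) =
      (\<integral>U. (\<Sum>x\<in>?T. \<Prod>t\<in>{1..p}. U (x t) (j t) * cnj (U ((x \<circ> \<tau>) t) (j' t))) \<partial>\<mu>)"
    unfolding unitary_moment_def by (rule Bochner_Integration.integral_sum[symmetric]) (rule int)
  also have "\<dots> = (\<integral>U. of_bool (j' = j \<circ> \<tau>) \<partial>\<mu>)"
    by (rule Bochner_Integration.integral_cong) (simp_all only: pointwise haar_space[OF X haar])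
  also have "\<dots> = of_bool (j' = j \<circ> \<tau>)" by (simp add: prob_space)
  finally show ?thesis .
qed

text \<open>The permutation operator of \<sigma> contracted with \<tau> counts the tuples on which
  \<sigma> and \<tau> agree; this is how the powers of the dimension enter.\<close>

lemma unitary_moment_linear_system:
  assumes X: "finite X" "p \<le> card X" and haar: "is_haar X \<mu>" and \<tau>: "\<tau> \<in> sym_group p"
    and e: "e \<in> {1..p} \<rightarrow>\<^sub>E X" "inj_on e {1..p}"
    and j: "j \<in> {1..p} \<rightarrow>\<^sub>E X" and j': "j' \<in> {1..p} \<rightarrow>\<^sub>E X"
  shows "(\<Sum>\<sigma>\<in>sym_group p. unitary_moment p \<mu> j j' e (e \<circ> \<sigma>) *
      of_real (real (card X) ^ num_cycles p (inv \<sigma> \<circ> \<tau>))) = of_bool (j' = j \<circ> \<tau>)"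
proof -
  let ?T = "{1..p} \<rightarrow>\<^sub>E X"
  let ?c = "\<lambda>\<sigma>. unitary_moment p \<mu> j j' e (e \<circ> \<sigma>)"
  have count: "(\<Sum>x\<in>?T. of_bool (x \<circ> \<tau> = x \<circ> \<sigma>)) = complex_of_real (real (card X) ^ num_cycles p (inv \<sigma> \<circ> \<tau>))"
    if \<sigma>: "\<sigma> \<in> sym_group p" for \<sigma>
  proof -
    have "(\<Sum>x\<in>?T. of_bool (x \<circ> \<tau> = x \<circ> \<sigma>)) = (\<Sum>x\<in>?T. of_bool (\<forall>t\<in>{1..p}. x (\<tau> t) = x (\<sigma> t)) :: complex)"
      by (intro sum.cong refl) (simp add: tuple_comp_eq_iff[OF _ _ \<tau> \<sigma>])
    then show ?thesis unfolding sum_tuples_agree[OF \<tau> \<sigma> X(1)] by simp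
  qed
  have "of_bool (j' = j \<circ> \<tau>) = (\<Sum>x\<in>?T. unitary_moment p \<mu> j j' x (x \<circ> \<tau>))"
    by (rule unitary_moment_contraction[OF X(1) haar \<tau> j j', symmetric])
  also have "\<dots> = (\<Sum>x\<in>?T. \<Sum>\<sigma>\<in>sym_group p. ?c \<sigma> * of_bool (x \<circ> \<tau> = x \<circ> \<sigma>))"
    by (intro sum.cong refl tensor_commutant_expansion[OF X unitary_moment_commutant[OF X(1) haar] e]
        tuple_comp_sym \<tau>)
  also have "\<dots> = (\<Sum>\<sigma>\<in>sym_group p. ?c \<sigma> * (\<Sum>x\<in>?T. of_bool (x \<circ> \<tau> = x \<circ> \<sigma>)))"
    by (subst sum.swap) (simp only: sum_distrib_left)
  also have "\<dots> = (\<Sum>\<sigma>\<in>sym_group p. ?c \<sigma> * of_real (real (card X) ^ num_cycles p (inv \<sigma> \<circ> \<tau>)))"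
    by (intro sum.cong refl) (simp only: count)
  finally show ?thesis by (rule sym)
qed

lemma injective_tuple_exists:
  assumes "finite X" "p \<le> card X"
  obtains e where "e \<in> {1..p} \<rightarrow>\<^sub>E X" "inj_on e {1..p}"
proof -
  obtain f where "f ` {1..p} \<subseteq> X" "inj_on f {1..p}"
    using card_le_inj[of "{1..p}" X] assms by auto
  then have "restrict f {1..p} \<in> {1..p} \<rightarrow>\<^sub>E X" "inj_on (restrict f {1..p}) {1..p}"
    by (auto simp: inj_on_restrict_eq)
  then show thesis by (rule that)
qed

text \<open>The convolution inverse is itself a table of Haar moments, so no invertibility of the Gram
  matrix of the permutation operators has to be shown.\<close>

lemma Wg_of_haar:
  assumes X: "finite X" "p \<le> card X" and haar: "is_haar X \<mu>"
  shows "is_conv_inverse p (\<lambda>\<sigma>. real (card X) ^ num_cycles p \<sigma>) (Wg p (real (card X)))"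
    and "\<sigma> \<in> sym_group p \<Longrightarrow> Wg p (real (card X)) (inv \<sigma>) = Wg p (real (card X)) \<sigma>"
proof -
  obtain e where e: "e \<in> {1..p} \<rightarrow>\<^sub>E X" "inj_on e {1..p}" by (rule injective_tuple_exists[OF X])
  \<comment> \<open>For \<open>j = j' = e\<close> the right-hand side of the linear system is the
    delta at the identity. Real parts are taken because \<open>Wg\<close> is real-valued; the matrix
    of the system is real, so the equation survives.\<close>
  have "perm_conv p (\<lambda>\<sigma>. Re (unitary_moment p \<mu> e e e (e \<circ> \<sigma>))) (\<lambda>\<sigma>. real (card X) ^ num_cycles p \<sigma>) \<tau> =
     (if \<tau> = id then 1 else 0)" if \<tau>: "\<tau> \<in> sym_group p" for \<tau>
  proof -
    have "e = e \<circ> \<tau> \<longleftrightarrow> \<tau> = id"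
      using comp_injective_tuple_eq_iff[OF e(2) sym_group_id \<tau>] by auto
    then show ?thesis
      using arg_cong[OF unitary_moment_linear_system[OF X haar \<tau> e e(1) e(1)], of Re]
      by (simp add: perm_conv_def)
  qed
  from Wg_properties[OF this]
  show "is_conv_inverse p (\<lambda>\<sigma>. real (card X) ^ num_cycles p \<sigma>) (Wg p (real (card X)))"
    and "\<sigma> \<in> sym_group p \<Longrightarrow> Wg p (real (card X)) (inv \<sigma>) = Wg p (real (card X)) \<sigma>"
    by auto
qed

text \<open>Solving the linear system produces \<open>Wg\<close> at
  \<open>inv \<beta> \<circ> \<alpha>\<close>; the symmetry of \<open>Wg\<close> under inversion
  brings it into the form of the theorem.\<close>

theorem unitary_moment_Weingarten:
  assumes X: "finite X" "p \<le> card X" and haar: "is_haar X \<mu>"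
    and x: "x \<in> {1..p} \<rightarrow>\<^sub>E X" and y: "y \<in> {1..p} \<rightarrow>\<^sub>E X"
    and j: "j \<in> {1..p} \<rightarrow>\<^sub>E X" and j': "j' \<in> {1..p} \<rightarrow>\<^sub>E X"
  shows "unitary_moment p \<mu> j j' x y = (\<Sum>\<alpha>\<in>sym_group p. \<Sum>\<beta>\<in>sym_group p.
     of_bool (y = x \<circ> \<alpha>) * of_bool (j' = j \<circ> \<beta>) * of_real (Wg p (real (card X)) (inv \<alpha> \<circ> \<beta>)))"
proof -
  obtain e where e: "e \<in> {1..p} \<rightarrow>\<^sub>E X" "inj_on e {1..p}" by (rule injective_tuple_exists[OF X])
  have coeff: "unitary_moment p \<mu> j j' e (e \<circ> \<alpha>) =
      (\<Sum>\<beta>\<in>sym_group p. of_bool (j' = j \<circ> \<beta>) * of_real (Wg p (real (card X)) (inv \<alpha> \<circ> \<beta>)))"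
    if \<alpha>: "\<alpha> \<in> sym_group p" for \<alpha>
  proof -
    have "unitary_moment p \<mu> j j' e (e \<circ> \<alpha>) =
      (\<Sum>\<beta>\<in>sym_group p. of_bool (j' = j \<circ> \<beta>) * of_real (Wg p (real (card X)) (inv \<beta> \<circ> \<alpha>)))"
      using Wg_of_haar(1)[OF X haar]
      by (intro perm_conv_solve[OF _ unitary_moment_linear_system[OF X haar _ e j j'] \<alpha>])
         (auto simp: is_conv_inverse_def)
    also have "\<dots> = (\<Sum>\<beta>\<in>sym_group p. of_bool (j' = j \<circ> \<beta>) * of_real (Wg p (real (card X)) (inv \<alpha> \<circ> \<beta>)))"
    proof (intro sum.cong refl)
      fix \<beta> assume \<beta>: "\<beta> \<in> sym_group p"
      have "inv (inv \<beta> \<circ> \<alpha>) = inv \<alpha> \<circ> \<beta>"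
        using \<alpha> \<beta> by (simp add: sym_group_inv_comp[of _ p] sym_group_inv sym_group_inv_inv)
      then show "of_bool (j' = j \<circ> \<beta>) * complex_of_real (Wg p (real (card X)) (inv \<beta> \<circ> \<alpha>)) =
        of_bool (j' = j \<circ> \<beta>) * of_real (Wg p (real (card X)) (inv \<alpha> \<circ> \<beta>))"
        using Wg_of_haar(2)[OF X haar sym_group_comp[OF sym_group_inv[OF \<beta>] \<alpha>]] by (simp only:)
    qed
    finally show ?thesis .
  qed
  have "unitary_moment p \<mu> j j' x y = (\<Sum>\<alpha>\<in>sym_group p. unitary_moment p \<mu> j j' e (e \<circ> \<alpha>) * of_bool (y = x \<circ> \<alpha>))"
    by (rule tensor_commutant_expansion[OF X unitary_moment_commutant[OF X(1) haar] e x y])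
  also have "\<dots> = (\<Sum>\<alpha>\<in>sym_group p. \<Sum>\<beta>\<in>sym_group p.
     of_bool (y = x \<circ> \<alpha>) * of_bool (j' = j \<circ> \<beta>) * of_real (Wg p (real (card X)) (inv \<alpha> \<circ> \<beta>)))"
    by (intro sum.cong refl) (simp only: coeff sum_distrib_right sum_distrib_left mult_ac)
  finally show ?thesis .
qed

section \<open>Sums over tuples of multi-indices\<close>

lemma sum_PiE_insert:
  assumes "x \<notin> S"
  shows "(\<Sum>f\<in>Pi\<^sub>E (insert x S) T. h f) = (\<Sum>y\<in>T x. \<Sum>f\<in>Pi\<^sub>E S T. h (f(x := y)))"
  unfolding PiE_insert_eq sum.cartesian_product
  by (subst sum.reindex[OF inj_combinator[OF assms]]) (simp add: case_prod_unfold)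

text \<open>\<open>op_power\<close> multiplies from the left, while the path expansion below is
  extended at its last label; this moves the factor across. The indices must lie in
  \<open>X\<close>, where \<open>op_id\<close> acts as the identity.\<close>

lemma op_mult_power_commute:
  assumes X: "finite X" and "x \<in> X" "y \<in> X"
  shows "op_mult X R (op_power X R q) x y = op_mult X (op_power X R q) R x y"
  using assms(2,3)
proof (induction q arbitrary: x y)
  case 0
  have "op_mult X R (op_id X) x y = (\<Sum>z\<in>X. if z = y then R x z else 0)"
    unfolding op_mult_def op_id_def by (intro sum.cong) auto
  moreover have "op_mult X (op_id X) R x y = (\<Sum>z\<in>X. if z = x then R z y else 0)"
    unfolding op_mult_def op_id_def using 0 by (intro sum.cong) auto
  ultimately show ?case using 0 X by (simp add: op_power_def)
next
  case (Suc q)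
  have eq: "op_power X R (Suc q) = op_mult X R (op_power X R q)" by (simp add: op_power_def)
  have "op_mult X R (op_power X R (Suc q)) x y = (\<Sum>z\<in>X. R x z * op_mult X R (op_power X R q) z y)"
    unfolding eq by (subst op_mult_def) simp
  also have "\<dots> = (\<Sum>z\<in>X. R x z * op_mult X (op_power X R q) R z y)"
    using Suc by (intro sum.cong) auto
  also have "\<dots> = op_mult X R (op_mult X (op_power X R q) R) x y"
    by (subst (2) op_mult_def) simp
  also have "\<dots> = op_mult X (op_power X R (Suc q)) R x y"
    by (simp only: op_mult_assoc[OF X] eq)
  finally show ?case .
qed

text \<open>Paths of q steps have q + 1 labels. The end points are imposed by indicators, which lets
  the induction append a label and the trace later identify both ends.\<close>

lemma op_power_entry:
  assumes X: "finite X" and x: "x \<in> X" and y: "y \<in> X"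
  shows "op_power X R q x y = (\<Sum>s\<in>{1..Suc q} \<rightarrow>\<^sub>E X.
    of_bool (s 1 = x) * of_bool (s (Suc q) = y) * (\<Prod>t\<in>{1..q}. R (s t) (s (Suc t))))"
  using y
proof (induction q arbitrary: y)
  case 0
  have "{1..Suc 0} = insert (1::nat) {}" by auto
  then have "(\<Sum>s\<in>{1..Suc 0} \<rightarrow>\<^sub>E X. of_bool (s 1 = x) * of_bool (s (Suc 0) = y) * (\<Prod>t\<in>{1..0}. R (s t) (s (Suc t)))) =
    (\<Sum>z\<in>X. of_bool (z = x) * of_bool (z = y))"
    by (simp only: sum_PiE_insert[OF empty_iff[THEN iffD1, THEN notI]]) simp
  also have "\<dots> = (\<Sum>z\<in>X. if z = x then of_bool (x = y) else 0)"
    by (intro sum.cong) auto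
  also have "\<dots> = op_power X R 0 x y" using X x by (simp add: op_power_def op_id_def)
  finally show ?case by simp
next
  case (Suc q)
  let ?w = "\<lambda>s. \<Prod>t\<in>{1..q}. R (s t) (s (Suc t))"
  have ins: "{1..Suc (Suc q)} = insert (Suc (Suc q)) {1..Suc q}" by auto
  have "(\<Sum>s\<in>{1..Suc (Suc q)} \<rightarrow>\<^sub>E X. of_bool (s 1 = x) * of_bool (s (Suc (Suc q)) = y) *
        (\<Prod>t\<in>{1..Suc q}. R (s t) (s (Suc t)))) =
      (\<Sum>z\<in>X. \<Sum>s\<in>{1..Suc q} \<rightarrow>\<^sub>E X. of_bool (s 1 = x) * of_bool (z = y) * (?w s * R (s (Suc q)) z))"
    unfolding ins
  proof (subst sum_PiE_insert, simp, intro sum.cong refl)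
    fix z s
    have "{1..Suc q} = insert (Suc q) {1..q}" by auto
    then have "(\<Prod>t\<in>{1..Suc q}. R ((s(Suc (Suc q) := z)) t) ((s(Suc (Suc q) := z)) (Suc t))) = ?w s * R (s (Suc q)) z"
      by (auto simp: mult.commute intro!: prod.cong arg_cong2[where f = "(*)"])
    then show "of_bool ((s(Suc (Suc q) := z)) 1 = x) * of_bool ((s(Suc (Suc q) := z)) (Suc (Suc q)) = y) *
        (\<Prod>t\<in>{1..Suc q}. R ((s(Suc (Suc q) := z)) t) ((s(Suc (Suc q) := z)) (Suc t))) =
      of_bool (s 1 = x) * of_bool (z = y) * (?w s * R (s (Suc q)) z)"
      by (simp only:) simp
  qed
  also have "\<dots> = (\<Sum>s\<in>{1..Suc q} \<rightarrow>\<^sub>E X. \<Sum>z\<in>X. if z = y then of_bool (s 1 = x) * (?w s * R (s (Suc q)) y) else 0)"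
    by (subst sum.swap) (auto intro!: sum.cong)
  also have "\<dots> = (\<Sum>s\<in>{1..Suc q} \<rightarrow>\<^sub>E X. of_bool (s 1 = x) * (?w s * R (s (Suc q)) y))"
    using X Suc.prems by simp
  \<comment> \<open>The last label is named \<open>z\<close> again, so that the sum over
    \<open>z\<close> is a matrix product.\<close>
  also have "\<dots> = (\<Sum>s\<in>{1..Suc q} \<rightarrow>\<^sub>E X. \<Sum>z\<in>X. if z = s (Suc q) then of_bool (s 1 = x) * (?w s * R z y) else 0)"
    using X by (intro sum.cong refl) (simp add: PiE_iff)
  also have "\<dots> = (\<Sum>z\<in>X. \<Sum>s\<in>{1..Suc q} \<rightarrow>\<^sub>E X. of_bool (s 1 = x) * of_bool (s (Suc q) = z) * ?w s * R z y)"
    by (subst sum.swap) (auto intro!: sum.cong)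
  also have "\<dots> = op_mult X (op_power X R q) R x y"
    unfolding op_mult_def by (intro sum.cong refl) (simp add: Suc.IH sum_distrib_right)
  also have "\<dots> = op_power X R (Suc q) x y"
    by (simp add: op_mult_power_commute[OF X x Suc.prems, symmetric]) (simp add: op_power_def)
  finally show ?case by simp
qed

lemma full_cycle_apply:
  assumes "t \<in> {1..p}"
  shows "full_cycle p t = (if t = p then 1 else Suc t)"
proof -
  have "map (full_cycle p) [1..<Suc p] = rotate1 [1..<Suc p]"
    using cyclic_rotation[of "[1..<Suc p]" 1] by (simp add: full_cycle_def)
  then have "map (full_cycle p) [1..<Suc p] ! (t - 1) = rotate1 [1..<Suc p] ! (t - 1)" by simp
  moreover have "t - 1 < length [1..<Suc p]" using assms by auto
  ultimately show ?thesis using assms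
    by (simp only: nth_map nth_rotate1) (auto simp: nth_append not_less simp del: upt_Suc)
qed

lemma full_cycle_in_sym_group: "full_cycle p \<in> sym_group p"
  using cycle_permutes[of "[1..<Suc p]"]
  by (simp add: sym_group_def full_cycle_def atLeastLessThanSuc_atLeastAtMost del: upt_Suc)

text \<open>The trace closes a path of p steps by identifying label p + 1 with label 1, so the
  successor of a position becomes its image under the full cycle.\<close>

lemma trace_op_power:
  assumes X: "finite X" and p: "p \<ge> 1"
  shows "op_trace X (op_power X R p) = (\<Sum>s\<in>{1..p} \<rightarrow>\<^sub>E X. \<Prod>t\<in>{1..p}. R (s t) (s (full_cycle p t)))"
proof -
  let ?w = "\<lambda>s. \<Prod>t\<in>{1..p}. R (s t) (s (Suc t))"
  have "op_trace X (op_power X R p) =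
      (\<Sum>s\<in>{1..Suc p} \<rightarrow>\<^sub>E X. \<Sum>x\<in>X. if x = s 1 then of_bool (s (Suc p) = s 1) * ?w s else 0)"
    unfolding op_trace_def
    by (subst sum.swap) (auto simp: op_power_entry[OF X] intro!: sum.cong)
  also have "\<dots> = (\<Sum>s\<in>{1..Suc p} \<rightarrow>\<^sub>E X. of_bool (s (Suc p) = s 1) * ?w s)"
    using X by (intro sum.cong refl) (simp add: PiE_iff)
  also have "{1..Suc p} = insert (Suc p) {1..p}" by auto
  also have "(\<Sum>s\<in>insert (Suc p) {1..p} \<rightarrow>\<^sub>E X. of_bool (s (Suc p) = s 1) * ?w s) =
      (\<Sum>z\<in>X. \<Sum>s\<in>{1..p} \<rightarrow>\<^sub>E X. if z = s 1 then \<Prod>t\<in>{1..p}. R (s t) (s (full_cycle p t)) else 0)"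
  proof (subst sum_PiE_insert, simp, intro sum.cong refl)
    fix z s assume "s \<in> {1..p} \<rightarrow>\<^sub>E X"
    have "?w (s(Suc p := s 1)) = (\<Prod>t\<in>{1..p}. R (s t) (s (full_cycle p t)))"
      by (intro prod.cong refl) (auto simp: full_cycle_apply)
    then show "of_bool ((s(Suc p := z)) (Suc p) = (s(Suc p := z)) 1) * ?w (s(Suc p := z)) =
      (if z = s 1 then \<Prod>t\<in>{1..p}. R (s t) (s (full_cycle p t)) else 0)"
      using p by auto
  qed
  also have "\<dots> = (\<Sum>s\<in>{1..p} \<rightarrow>\<^sub>E X. \<Prod>t\<in>{1..p}. R (s t) (s (full_cycle p t)))"
    using X p by (subst sum.swap) (intro sum.cong refl, simp add: PiE_iff)
  finally show ?thesis .
qed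

section \<open>Sums over labels factor over subsystems and over blocks\<close>

lemma finite_multi_index: "finite J \<Longrightarrow> finite (multi_index D J)"
  by (simp add: multi_index_def finite_PiE)

lemma card_multi_index: "finite J \<Longrightarrow> card (multi_index D J) = (\<Prod>a\<in>J. D a)"
  by (simp add: multi_index_def card_PiE)

text \<open>A p-tuple of multi-indices is regarded as a family of p-tuples, one per subsystem. The
  restrictions translate between the two conventions for undefined values.\<close>

lemma sum_tuples_transpose:
  "(\<Sum>s\<in>P \<rightarrow>\<^sub>E multi_index D J. h s) =
   (\<Sum>f\<in>(\<Pi>\<^sub>E a\<in>J. P \<rightarrow>\<^sub>E {..<D a}). h (\<lambda>t\<in>P. \<lambda>a\<in>J. f a t))"
proof (rule sum.reindex_bij_witness[of _ "\<lambda>f. \<lambda>t\<in>P. \<lambda>a\<in>J. f a t" "\<lambda>s. \<lambda>a\<in>J. \<lambda>t\<in>P. s t a"])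
  fix s assume s: "s \<in> P \<rightarrow>\<^sub>E multi_index D J"
  have mem: "s t a \<in> {..<D a}" if "t \<in> P" "a \<in> J" for t a
    using PiE_mem[OF s that(1)] that(2) by (auto simp: multi_index_def)
  have und: "s t a = undefined" if "t \<in> P" "a \<notin> J" for t a
    using PiE_mem[OF s that(1)] that(2) by (auto simp: multi_index_def)
  show eq: "(\<lambda>t\<in>P. \<lambda>a\<in>J. (\<lambda>a\<in>J. \<lambda>t\<in>P. s t a) a t) = s"
    using und PiE_arb[OF s] by (auto simp: restrict_def fun_eq_iff)
  show "(\<lambda>a\<in>J. \<lambda>t\<in>P. s t a) \<in> (\<Pi>\<^sub>E a\<in>J. P \<rightarrow>\<^sub>E {..<D a})"
    using mem by auto
  show "h (\<lambda>t\<in>P. \<lambda>a\<in>J. (\<lambda>a\<in>J. \<lambda>t\<in>P. s t a) a t) = h s" by (simp only: eq)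
next
  fix f assume f: "f \<in> (\<Pi>\<^sub>E a\<in>J. P \<rightarrow>\<^sub>E {..<D a})"
  have und: "f a t = undefined" if "a \<in> J" "t \<notin> P" for t a
    using PiE_mem[OF f that(1)] that(2) by auto
  show "(\<lambda>a\<in>J. \<lambda>t\<in>P. (\<lambda>t\<in>P. \<lambda>a\<in>J. f a t) t a) = f"
    using und PiE_arb[OF f] by (auto simp: restrict_def fun_eq_iff)
  show "(\<lambda>t\<in>P. \<lambda>a\<in>J. f a t) \<in> P \<rightarrow>\<^sub>E multi_index D J"
    using f by (auto simp: multi_index_def PiE_iff)
qed

text \<open>After transposition each condition involves a single subsystem, so the count is a
  product. The permutations may vary with the subsystem because each vertex has its own.\<close>

lemma sum_tuples_agree_multi_index:
  fixes D :: "nat \<Rightarrow> nat"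
  assumes J: "finite J" and \<sigma>: "\<And>a. a \<in> J \<Longrightarrow> \<sigma> a \<in> sym_group p" and \<tau>: "\<And>a. a \<in> J \<Longrightarrow> \<tau> a \<in> sym_group p"
  shows "(\<Sum>s\<in>{1..p} \<rightarrow>\<^sub>E multi_index D J. of_bool (\<forall>a\<in>J. \<forall>t\<in>{1..p}. s (\<sigma> a t) a = s (\<tau> a t) a)) =
    (\<Prod>a\<in>J. of_nat (D a) ^ num_cycles p (inv (\<tau> a) \<circ> \<sigma> a) :: complex)"
proof -
  have "(\<Sum>s\<in>{1..p} \<rightarrow>\<^sub>E multi_index D J. of_bool (\<forall>a\<in>J. \<forall>t\<in>{1..p}. s (\<sigma> a t) a = s (\<tau> a t) a)) =
    (\<Sum>f\<in>(\<Pi>\<^sub>E a\<in>J. {1..p} \<rightarrow>\<^sub>E {..<D a}). \<Prod>a\<in>J. of_bool (\<forall>t\<in>{1..p}. f a (\<sigma> a t) = f a (\<tau> a t)) :: complex)"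
    unfolding sum_tuples_transpose
  proof (intro sum.cong refl)
    fix f
    have mem: "\<sigma> a t \<in> {1..p}" "\<tau> a t \<in> {1..p}" if "a \<in> J" "t \<in> {1..p}" for a t
      using that \<sigma> \<tau> sym_group_in by blast+
    have "of_bool (\<forall>a\<in>J. \<forall>t\<in>{1..p}. (\<lambda>t\<in>{1..p}. \<lambda>a\<in>J. f a t) (\<sigma> a t) a = (\<lambda>t\<in>{1..p}. \<lambda>a\<in>J. f a t) (\<tau> a t) a) =
      (of_bool (\<forall>a\<in>J. \<forall>t\<in>{1..p}. f a (\<sigma> a t) = f a (\<tau> a t)) :: complex)"
      using mem by (intro arg_cong[of _ _ of_bool] ball_cong refl) (simp del: atLeastAtMost_iff)
    also have "\<dots> = (\<Prod>a\<in>J. of_bool (\<forall>t\<in>{1..p}. f a (\<sigma> a t) = f a (\<tau> a t)))"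
      using J by (induction J) auto
    finally show "of_bool (\<forall>a\<in>J. \<forall>t\<in>{1..p}. (\<lambda>t\<in>{1..p}. \<lambda>a\<in>J. f a t) (\<sigma> a t) a = (\<lambda>t\<in>{1..p}. \<lambda>a\<in>J. f a t) (\<tau> a t) a) =
      (\<Prod>a\<in>J. of_bool (\<forall>t\<in>{1..p}. f a (\<sigma> a t) = f a (\<tau> a t)) :: complex)" .
  qed
  also have "\<dots> = (\<Prod>a\<in>J. \<Sum>h\<in>{1..p} \<rightarrow>\<^sub>E {..<D a}. of_bool (\<forall>t\<in>{1..p}. h (\<sigma> a t) = h (\<tau> a t)))"
    by (rule prod_sum_PiE[symmetric]) (use J in \<open>auto intro: finite_PiE\<close>)
  also have "\<dots> = (\<Prod>a\<in>J. of_nat (D a) ^ num_cycles p (inv (\<tau> a) \<circ> \<sigma> a))"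
    by (intro prod.cong refl) (simp only: sum_tuples_agree[OF \<sigma> \<tau>] finite_lessThan card_lessThan)
  finally show ?thesis .
qed

text \<open>A function on \<open>A\<close> is a family of functions on the blocks, so this is the
  distributive law. It will be applied with the edges as blocks.\<close>

lemma sum_PiE_partition:
  fixes g :: "'a set \<Rightarrow> ('a \<Rightarrow> 'b) \<Rightarrow> 'c :: comm_semiring_1"
  assumes E: "partition_on A E" and A: "finite A" and B: "\<And>a. a \<in> A \<Longrightarrow> finite (B a)"
  shows "(\<Sum>f\<in>Pi\<^sub>E A B. \<Prod>e\<in>E. g e (restrict f e)) = (\<Prod>e\<in>E. \<Sum>h\<in>Pi\<^sub>E e B. g e h)"
proof -
  have finE: "finite E" by (rule finite_elements[OF A E])
  have sub: "e \<subseteq> A" if "e \<in> E" for e using E that by (auto simp: partition_on_def)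
  have uniq: "e = e'" if "e \<in> E" "e' \<in> E" "a \<in> e" "a \<in> e'" for a e e'
    using E that by (auto simp: partition_on_def dest: disjointD)
  define c where "c a = (THE e. e \<in> E \<and> a \<in> e)" for a
  have c_eq: "c a = e" if "e \<in> E" "a \<in> e" for a e
    unfolding c_def using that uniq by (intro the_equality) auto
  have c: "c a \<in> E" "a \<in> c a" if a: "a \<in> A" for a
  proof -
    from a E obtain e where "e \<in> E" "a \<in> e" by (auto simp: partition_on_def)
    then show "c a \<in> E" "a \<in> c a" using c_eq by auto
  qed
  have "(\<Prod>e\<in>E. \<Sum>h\<in>Pi\<^sub>E e B. g e h) = (\<Sum>H\<in>(\<Pi>\<^sub>E e\<in>E. Pi\<^sub>E e B). \<Prod>e\<in>E. g e (H e))"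
    by (rule prod_sum_PiE[OF finE]) (use sub A B in \<open>auto intro!: finite_PiE dest: finite_subset\<close>)
  also have "\<dots> = (\<Sum>f\<in>Pi\<^sub>E A B. \<Prod>e\<in>E. g e (restrict f e))"
  proof (rule sum.reindex_bij_witness[of _ "\<lambda>f. \<lambda>e\<in>E. restrict f e" "\<lambda>H. \<lambda>a\<in>A. H (c a) a"])
    fix H assume H: "H \<in> (\<Pi>\<^sub>E e\<in>E. Pi\<^sub>E e B)"
    have He: "restrict (\<lambda>a\<in>A. H (c a) a) e = H e" if e: "e \<in> E" for e
    proof
      fix a
      show "restrict (\<lambda>a\<in>A. H (c a) a) e a = H e a"
      proof (cases "a \<in> e")
        case True
        then have "a \<in> A" using sub[OF e] by blast
        then show ?thesis using True by (simp add: c_eq[OF e True])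
      next
        case False
        then show ?thesis using PiE_arb[OF PiE_mem[OF H e] False] by simp
      qed
    qed
    show "(\<lambda>e\<in>E. restrict (\<lambda>a\<in>A. H (c a) a) e) = H"
      using He PiE_arb[OF H] by (auto simp: restrict_def[of _ E])
    show "(\<lambda>a\<in>A. H (c a) a) \<in> Pi\<^sub>E A B" using H c by (auto simp: PiE_iff)
    show "(\<Prod>e\<in>E. g e (restrict (\<lambda>a\<in>A. H (c a) a) e)) = (\<Prod>e\<in>E. g e (H e))"
      by (intro prod.cong refl) (simp only: He)
  next
    fix f assume f: "f \<in> Pi\<^sub>E A B"
    show "(\<lambda>a\<in>A. (\<lambda>e\<in>E. restrict f e) (c a) a) = f"
      using c PiE_arb[OF f] by (auto simp: restrict_def[of _ A])
    show "(\<lambda>e\<in>E. restrict f e) \<in> (\<Pi>\<^sub>E e\<in>E. Pi\<^sub>E e B)" using f sub by (fastforce simp: PiE_iff)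
  qed
  finally show ?thesis by simp
qed

text \<open>The labels of the graph state are functions of every t, so the formula is needed for
  tuples prescribed on {1..p} but not \<open>undefined\<close> elsewhere.\<close>

lemma unitary_moment_Weingarten_Pi:
  assumes X: "finite X" "p \<le> card X" and haar: "is_haar X \<mu>"
    and x: "x \<in> {1..p} \<rightarrow> X" and y: "y \<in> {1..p} \<rightarrow> X" and j: "j \<in> {1..p} \<rightarrow> X" and j': "j' \<in> {1..p} \<rightarrow> X"
  shows "unitary_moment p \<mu> j j' x y = (\<Sum>\<alpha>\<in>sym_group p. \<Sum>\<beta>\<in>sym_group p.
     of_bool (\<forall>t\<in>{1..p}. y t = x (\<alpha> t)) * of_bool (\<forall>t\<in>{1..p}. j' t = j (\<beta> t)) *
     of_real (Wg p (real (card X)) (inv \<alpha> \<circ> \<beta>)))"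
proof -
  let ?r = "\<lambda>f. restrict f {1..p}"
  have r: "?r f \<in> {1..p} \<rightarrow>\<^sub>E X" if "f \<in> {1..p} \<rightarrow> X" for f using that by auto
  have eq: "?r g = ?r f \<circ> \<sigma> \<longleftrightarrow> (\<forall>t\<in>{1..p}. g t = f (\<sigma> t))"
    if "f \<in> {1..p} \<rightarrow> X" "g \<in> {1..p} \<rightarrow> X" "\<sigma> \<in> sym_group p" for f g \<sigma>
    using tuple_comp_eq_iff[OF r[OF that(2)] r[OF that(1)] sym_group_id that(3)] sym_group_in[OF that(3)]
    by (simp del: atLeastAtMost_iff)
  have "unitary_moment p \<mu> j j' x y = unitary_moment p \<mu> (?r j) (?r j') (?r x) (?r y)"
    by (simp add: unitary_moment_def)
  also have "\<dots> = (\<Sum>\<alpha>\<in>sym_group p. \<Sum>\<beta>\<in>sym_group p.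
     of_bool (?r y = ?r x \<circ> \<alpha>) * of_bool (?r j' = ?r j \<circ> \<beta>) * of_real (Wg p (real (card X)) (inv \<alpha> \<circ> \<beta>)))"
    by (rule unitary_moment_Weingarten[OF X haar r[OF x] r[OF y] r[OF j] r[OF j']])
  also have "\<dots> = (\<Sum>\<alpha>\<in>sym_group p. \<Sum>\<beta>\<in>sym_group p.
     of_bool (\<forall>t\<in>{1..p}. y t = x (\<alpha> t)) * of_bool (\<forall>t\<in>{1..p}. j' t = j (\<beta> t)) *
     of_real (Wg p (real (card X)) (inv \<alpha> \<circ> \<beta>)))"
    by (intro sum.cong refl) (simp only: eq[OF x y] eq[OF j j'])
  finally show ?thesis .
qed

section \<open>Expansion of the graph state\<close>

lemma prod_of_bool:
  assumes "finite I"
  shows "(\<Prod>i\<in>I. of_bool (Q i)) = (of_bool (\<forall>i\<in>I. Q i) :: 'a :: comm_semiring_1)"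
  using assms by (induction I) auto

text \<open>This is where the full cycle enters: multiplying the copies of the marginal shifts the
  S-part of the bra label, while the partial trace makes ket and bra share the T-part.\<close>

lemma trace_power_partial_trace_ket_bra:
  assumes S: "finite S" and T: "finite T" and p: "p \<ge> 1"
  shows "op_trace (multi_index D S) (op_power (multi_index D S) (partial_trace D S T (ket_bra \<psi>)) p) =
    (\<Sum>s\<in>{1..p} \<rightarrow>\<^sub>E multi_index D S. \<Sum>z\<in>{1..p} \<rightarrow>\<^sub>E multi_index D T.
       \<Prod>t\<in>{1..p}. \<psi> (merge S T (s t, z t)) * cnj (\<psi> (merge S T (s (full_cycle p t), z t))))"
  unfolding trace_op_power[OF finite_multi_index[OF S] p] partial_trace_def ket_bra_def
  by (intro sum.cong refl prod_sum_PiE) (simp_all add: finite_multi_index[OF T])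

text \<open>Kets and bras get separate input labels \<open>y\<close> and \<open>y'\<close>; only the
  expectation will tie them together.\<close>

lemma prod_op_apply_tensor_op:
  assumes X: "finite X" and P: "finite P"
  shows "(\<Prod>t\<in>P. op_apply X (tensor_op I C U) \<phi> (x t) * cnj (op_apply X (tensor_op I C U) \<phi> (x' t))) =
    (\<Sum>y\<in>P \<rightarrow>\<^sub>E X. \<Sum>y'\<in>P \<rightarrow>\<^sub>E X. (\<Prod>t\<in>P. \<phi> (y t) * cnj (\<phi> (y' t))) *
      (\<Prod>i\<in>I. \<Prod>t\<in>P. U i (restrict (x t) (C i)) (restrict (y t) (C i)) *
         cnj (U i (restrict (x' t) (C i)) (restrict (y' t) (C i)))))"
proof -
  let ?u = "\<lambda>x y. \<Prod>i\<in>I. U i (restrict x (C i)) (restrict y (C i))"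
  have "(\<Prod>t\<in>P. op_apply X (tensor_op I C U) \<phi> (x t) * cnj (op_apply X (tensor_op I C U) \<phi> (x' t))) =
    (\<Prod>t\<in>P. \<Sum>y\<in>X. ?u (x t) y * \<phi> y) * (\<Prod>t\<in>P. \<Sum>y'\<in>X. cnj (?u (x' t) y') * cnj (\<phi> y'))"
    by (simp add: op_apply_def tensor_op_def prod.distrib)
  also have "\<dots> = (\<Sum>y\<in>P \<rightarrow>\<^sub>E X. \<Prod>t\<in>P. ?u (x t) (y t) * \<phi> (y t)) *
      (\<Sum>y'\<in>P \<rightarrow>\<^sub>E X. \<Prod>t\<in>P. cnj (?u (x' t) (y' t)) * cnj (\<phi> (y' t)))"
    by (simp only: prod_sum_PiE[OF P X])
  also have "\<dots> = (\<Sum>y\<in>P \<rightarrow>\<^sub>E X. \<Sum>y'\<in>P \<rightarrow>\<^sub>E X. (\<Prod>t\<in>P. \<phi> (y t) * cnj (\<phi> (y' t))) *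
      (\<Prod>i\<in>I. \<Prod>t\<in>P. U i (restrict (x t) (C i)) (restrict (y t) (C i)) *
         cnj (U i (restrict (x' t) (C i)) (restrict (y' t) (C i)))))"
    unfolding sum_product
    by (intro sum.cong refl) (simp add: prod.distrib mult_ac prod.swap[where A = P and B = I])
  finally show ?thesis .
qed

section \<open>Expectations over independent unitaries and separation of the sums\<close>

lemma indep_unitary_monomials:
  fixes x y j j' :: "'i \<Rightarrow> nat \<Rightarrow> 'x" and p :: nat
  assumes M: "prob_space M" and indep: "prob_space.indep_vars M (\<lambda>i. unitary_borel (X i)) U I"
    and I: "finite I" and X: "\<And>i. i \<in> I \<Longrightarrow> finite (X i)"
  defines "Y \<equiv> \<lambda>\<omega>. \<Prod>i\<in>I. \<Prod>t\<in>{1..p}. U i \<omega> (x i t) (j i t) * cnj (U i \<omega> (y i t) (j' i t))"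
  shows "integrable M Y"
    and "prob_space.expectation M Y =
      (\<Prod>i\<in>I. unitary_moment p (distr M (unitary_borel (X i)) (U i)) (j i) (j' i) (x i) (y i))"
proof -
  interpret prob_space M by (fact M)
  let ?g = "\<lambda>i U. \<Prod>t\<in>{1..p}. U (x i t) (j i t) * cnj (U (y i t) (j' i t)) :: complex"
  have U: "U i \<in> measurable M (unitary_borel (X i))" if "i \<in> I" for i
    using indep that by (simp add: indep_vars_def)
  have g: "?g i \<in> borel_measurable (unitary_borel (X i))" for i
    by measurable
  have int: "integrable (distr M (unitary_borel (X i)) (U i)) (?g i)" if "i \<in> I" for i
    by (rule unitary_monomial_integrable[OF X[OF that] prob_space_distr[OF U[OF that]]]) simp
  have int': "integrable M (\<lambda>\<omega>. ?g i (U i \<omega>))" if "i \<in> I" for i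
    using int[OF that] by (simp only: integrable_distr_eq[OF U[OF that] g])
  have ind: "indep_vars (\<lambda>_. borel) (\<lambda>i \<omega>. ?g i (U i \<omega>)) I"
    by (rule indep_vars_compose2[OF indep g])
  show "integrable M Y" unfolding Y_def by (rule indep_vars_integrable[OF I ind int'])
  have "expectation Y = (\<Prod>i\<in>I. \<integral>\<omega>. ?g i (U i \<omega>) \<partial>M)"
    unfolding Y_def by (rule indep_vars_lebesgue_integral[OF I ind int'])
  also have "\<dots> = (\<Prod>i\<in>I. unitary_moment p (distr M (unitary_borel (X i)) (U i)) (j i) (j' i) (x i) (y i))"
    unfolding unitary_moment_def
    by (intro prod.cong refl integral_distr[symmetric] U g)
  finally show "expectation Y = \<dots>" .
qed

lemma prod_double_sum_PiE:
  fixes f :: "'i \<Rightarrow> 'a \<Rightarrow> 'b \<Rightarrow> 'c :: comm_semiring_1"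
  assumes "finite I" "finite G" "finite H"
  shows "(\<Prod>i\<in>I. \<Sum>\<alpha>\<in>G. \<Sum>\<beta>\<in>H. f i \<alpha> \<beta>) = (\<Sum>\<alpha>\<in>I \<rightarrow>\<^sub>E G. \<Sum>\<beta>\<in>I \<rightarrow>\<^sub>E H. \<Prod>i\<in>I. f i (\<alpha> i) (\<beta> i))"
  by (simp only: prod_sum_PiE[OF assms(1,2)] prod_sum_PiE[OF assms(1,3)])

text \<open>For fixed permutations, indexed by \<open>c\<close>, the output labels \<open>u\<close>
  and the input labels \<open>y\<close> no longer interact, so their sums split.\<close>

lemma separate_double_sums:
  fixes \<phi> :: "'y \<Rightarrow> complex"
  shows "(\<Sum>u\<in>S. \<Sum>y\<in>T. \<phi> y * (\<Sum>c\<in>R. A u c * B y c * W c)) =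
    (\<Sum>c\<in>R. (\<Sum>u\<in>S. A u c) * (\<Sum>y\<in>T. \<phi> y * B y c) * W c)"
proof -
  let ?g = "\<lambda>u y c. A u c * (\<phi> y * B y c) * W c"
  have "(\<Sum>u\<in>S. \<Sum>y\<in>T. \<phi> y * (\<Sum>c\<in>R. A u c * B y c * W c)) = (\<Sum>u\<in>S. \<Sum>y\<in>T. \<Sum>c\<in>R. ?g u y c)"
    by (simp add: sum_distrib_left mult_ac)
  also have "\<dots> = (\<Sum>u\<in>S. \<Sum>c\<in>R. \<Sum>y\<in>T. ?g u y c)"
    by (intro sum.cong refl sum.swap)
  also have "\<dots> = (\<Sum>c\<in>R. \<Sum>u\<in>S. \<Sum>y\<in>T. ?g u y c)" by (rule sum.swap)
  also have "\<dots> = (\<Sum>c\<in>R. (\<Sum>u\<in>S. A u c) * (\<Sum>y\<in>T. \<phi> y * B y c) * W c)"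
    by (intro sum.cong refl) (subst sum_product, simp only: sum_distrib_right)
  finally show ?thesis .
qed

lemma separate_sums:
  fixes \<phi> :: "'y \<Rightarrow> 'z \<Rightarrow> complex"
  shows "(\<Sum>s\<in>S1. \<Sum>z\<in>S2. \<Sum>y\<in>S3. \<Sum>y'\<in>S4. \<phi> y y' * (\<Sum>\<alpha>\<in>S5. \<Sum>\<beta>\<in>S6. A s z \<alpha> * B y y' \<beta> * W \<alpha> \<beta>)) =
    (\<Sum>\<alpha>\<in>S5. \<Sum>\<beta>\<in>S6. (\<Sum>s\<in>S1. \<Sum>z\<in>S2. A s z \<alpha>) * (\<Sum>y\<in>S3. \<Sum>y'\<in>S4. \<phi> y y' * B y y' \<beta>) * W \<alpha> \<beta>)"
  \<comment> \<open>Each of the three pairs of summation variables is packed into one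
    variable.\<close>
  using separate_double_sums[of "\<lambda>(y, y'). \<phi> y y'" "\<lambda>(s, z) (\<alpha>, \<beta>). A s z \<alpha>" "\<lambda>(y, y') (\<alpha>, \<beta>). B y y' \<beta>"
      "\<lambda>(\<alpha>, \<beta>). W \<alpha> \<beta>" "S5 \<times> S6" "S3 \<times> S4" "S1 \<times> S2"]
  by (simp only: sum.cartesian_product' prod.case)

section \<open>Combinatorics of the graph\<close>

definition vertex_of :: "nat \<Rightarrow> (nat \<Rightarrow> nat set) \<Rightarrow> nat \<Rightarrow> nat" where
  "vertex_of k C a = (THE i. i \<in> {1..k} \<and> a \<in> C i)"

definition mate :: "nat set set \<Rightarrow> nat \<Rightarrow> nat" where
  "mate E a = (THE b. {a, b} \<in> E)"

context
  fixes k m :: nat and C :: "nat \<Rightarrow> nat set" and E :: "nat set set"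
  assumes graph: "graph_data k m C E"
begin

lemma edges_partition: "partition_on {1..2 * m} E" and edge_card: "e \<in> E \<Longrightarrow> card e = 2"
  and vertices_disjoint: "disjoint_family_on C {1..k}" and vertices_cover: "(\<Union>i\<in>{1..k}. C i) = {1..2 * m}"
  using graph by (auto simp: graph_data_def)

lemma vertex_subset: "i \<in> {1..k} \<Longrightarrow> C i \<subseteq> {1..2 * m}"
  using vertices_cover by blast

lemma vertex_of_eq:
  assumes "i \<in> {1..k}" "a \<in> C i"
  shows "vertex_of k C a = i"
  unfolding vertex_of_def
  by (rule the_equality) (use assms vertices_disjoint in \<open>unfold disjoint_family_on_def, blast+\<close>)

lemma vertex_of_mem:
  assumes "a \<in> {1..2 * m}"
  shows "vertex_of k C a \<in> {1..k}" "a \<in> C (vertex_of k C a)"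
proof -
  obtain i where "i \<in> {1..k}" "a \<in> C i" using assms vertices_cover by blast
  then show "vertex_of k C a \<in> {1..k}" "a \<in> C (vertex_of k C a)" using vertex_of_eq by simp_all
qed

lemma all_vertices_iff: "(\<forall>i\<in>{1..k}. \<forall>a\<in>C i. Q i a) \<longleftrightarrow> (\<forall>a\<in>{1..2 * m}. Q (vertex_of k C a) a)"
  using vertex_of_eq vertex_of_mem vertex_subset by (metis subsetD)

lemma edge_eq: "e \<in> E \<Longrightarrow> e' \<in> E \<Longrightarrow> a \<in> e \<Longrightarrow> a \<in> e' \<Longrightarrow> e = e'"
  using edges_partition by (auto simp: partition_on_def dest: disjointD)

lemma edge_subset: "e \<in> E \<Longrightarrow> e \<subseteq> {1..2 * m}"
  using edges_partition by (auto simp: partition_on_def)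

lemma edge_ends:
  assumes "{a, b} \<in> E"
  shows "a \<noteq> b" "a \<in> {1..2 * m}" "b \<in> {1..2 * m}" "mate E a = b" "mate E b = a"
proof -
  show ab: "a \<noteq> b" using edge_card[OF assms] by (auto simp: card_insert_if)
  show "a \<in> {1..2 * m}" "b \<in> {1..2 * m}" using edge_subset[OF assms] by blast+
  show "mate E a = b" unfolding mate_def
  proof (rule the_equality, rule assms)
    fix c assume "{a, c} \<in> E"
    then have "{a, c} = {a, b}" using edge_eq[OF _ assms, of _ a] by blast
    with ab show "c = b" by (auto simp: doubleton_eq_iff)
  qed
  have assms': "{b, a} \<in> E" using assms by (simp add: insert_commute)
  show "mate E b = a" unfolding mate_def
  proof (rule the_equality, rule assms')
    fix c assume "{b, c} \<in> E"
    then have "{b, c} = {b, a}" using edge_eq[OF _ assms', of _ b] by blast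
    with ab show "c = a" by (auto simp: doubleton_eq_iff)
  qed
qed

lemma edge_obtain:
  assumes "e \<in> E"
  obtains a b where "e = {a, b}"
  using edge_card[OF assms] by (auto simp: card_2_iff)

lemma mate_edge:
  assumes "a \<in> {1..2 * m}"
  shows "{a, mate E a} \<in> E"
proof -
  obtain e where e: "e \<in> E" "a \<in> e" using assms partition_onD1[OF edges_partition] by blast
  then obtain b where "e = {a, b}" by (metis edge_obtain insert_commute insertE singletonD)
  then show ?thesis using e edge_ends by simp
qed

text \<open>The inner set selects one end of every edge: the end at the lower vertex, and for a loop
  the smaller label. It is filtered by the pair of vertices so that \<open>prod.group\<close> can be
  used.\<close>

lemma edge_set_eq:
  assumes ij: "i \<in> {1..k}" "j \<in> {1..k}" "i \<le> j"
  shows "edge_set C E i j = {a \<in> {a \<in> {1..2 * m}. vertex_of k C a < vertex_of k C (mate E a) \<or> vertex_of k C a = vertex_of k C (mate E a) \<and> a < mate E a}. (vertex_of k C a, vertex_of k C (mate E a)) = (i, j)}"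
proof (intro set_eqI iffI)
  fix a assume "a \<in> edge_set C E i j"
  then obtain b where b: "a \<in> C i" "b \<in> C j" "{a, b} \<in> E" "i = j \<longrightarrow> a < b"
    by (auto simp: edge_set_def split: if_splits)
  then show "a \<in> {a \<in> {a \<in> {1..2 * m}. vertex_of k C a < vertex_of k C (mate E a) \<or> vertex_of k C a = vertex_of k C (mate E a) \<and> a < mate E a}. (vertex_of k C a, vertex_of k C (mate E a)) = (i, j)}"
    using edge_ends[OF b(3)] ij vertex_of_eq[OF ij(1) b(1)] vertex_of_eq[OF ij(2) b(2)] by auto
next
  fix a assume a: "a \<in> {a \<in> {a \<in> {1..2 * m}. vertex_of k C a < vertex_of k C (mate E a) \<or> vertex_of k C a = vertex_of k C (mate E a) \<and> a < mate E a}. (vertex_of k C a, vertex_of k C (mate E a)) = (i, j)}"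
  then have "{a, mate E a} \<in> E" using mate_edge by simp
  moreover have "a \<in> C i" "mate E a \<in> C j"
    using a vertex_of_mem(2)[of a] vertex_of_mem(2)[OF edge_ends(3)[OF calculation]] by auto
  ultimately show "a \<in> edge_set C E i j" using a by (auto simp: edge_set_def)
qed

text \<open>The selected ends are in bijection with the edges, and grouping them by their two
  vertices gives the off-diagonal pairs and, for the loops, the diagonal \<open>?L\<close>.\<close>

lemma prod_edges:
  fixes G :: "nat set \<Rightarrow> complex"
  shows "(\<Prod>e\<in>E. G e) =
    (\<Prod>(i, j)\<in>{(i, j). 1 \<le> i \<and> i < j \<and> j \<le> k}. \<Prod>a\<in>edge_set C E i j. G {a, mate E a}) *
    (\<Prod>i\<in>{1..k}. \<Prod>a\<in>edge_set C E i i. G {a, mate E a})"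
proof -
  let ?R = "{a \<in> {1..2 * m}. vertex_of k C a < vertex_of k C (mate E a) \<or> vertex_of k C a = vertex_of k C (mate E a) \<and> a < mate E a}"
  let ?\<epsilon> = "\<lambda>a. {a, mate E a}"
  let ?K = "{(i, j). 1 \<le> i \<and> i < j \<and> j \<le> k}" and ?L = "(\<lambda>i. (i, i)) ` {1..k}"
  have "bij_betw ?\<epsilon> ?R E"
  proof (rule bij_betwI')
    fix a b assume ab: "a \<in> ?R" "b \<in> ?R"
    show "(?\<epsilon> a = ?\<epsilon> b) = (a = b)"
    proof
      assume "?\<epsilon> a = ?\<epsilon> b"
      then have "a = b \<or> b = mate E a \<and> a = mate E b" by (auto simp: doubleton_eq_iff)
      then show "a = b" using ab by auto
    qed simp
  next
    fix a assume "a \<in> ?R" then show "?\<epsilon> a \<in> E" using mate_edge by simp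
  next
    fix e assume e: "e \<in> E"
    then obtain a b where ab: "e = {a, b}" by (rule edge_obtain)
    note * = edge_ends[OF e[unfolded ab]]
    then have "a \<in> ?R \<or> b \<in> ?R" by auto
    then show "\<exists>a\<in>?R. e = ?\<epsilon> a" using * ab by (auto simp: insert_commute)
  qed
  then have "(\<Prod>e\<in>E. G e) = (\<Prod>a\<in>?R. G (?\<epsilon> a))"
    by (rule prod.reindex_bij_betw[symmetric])
  also have "\<dots> = (\<Prod>ij\<in>?K \<union> ?L. \<Prod>a\<in>{a \<in> ?R. (vertex_of k C a, vertex_of k C (mate E a)) = ij}. G (?\<epsilon> a))"
  proof (rule prod.group[symmetric])
    show "finite (?K \<union> ?L)"
      by (rule finite_subset[of _ "{1..k} \<times> {1..k}"]) auto
    show "(\<lambda>a. (vertex_of k C a, vertex_of k C (mate E a))) ` ?R \<subseteq> ?K \<union> ?L"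
    proof (rule image_subsetI)
      fix a assume a: "a \<in> ?R"
      then have "vertex_of k C a \<in> {1..k}" "vertex_of k C (mate E a) \<in> {1..k}"
        using vertex_of_mem(1)[of a] vertex_of_mem(1)[OF edge_ends(3)[OF mate_edge[of a]]] by auto
      then show "(vertex_of k C a, vertex_of k C (mate E a)) \<in> ?K \<union> ?L" using a by auto
    qed
  qed simp
  also have "\<dots> = (\<Prod>ij\<in>?K. \<Prod>a\<in>{a \<in> ?R. (vertex_of k C a, vertex_of k C (mate E a)) = ij}. G (?\<epsilon> a)) *
     (\<Prod>ij\<in>?L. \<Prod>a\<in>{a \<in> ?R. (vertex_of k C a, vertex_of k C (mate E a)) = ij}. G (?\<epsilon> a))"
    by (rule prod.union_disjoint) (auto intro: finite_subset[of _ "{1..k} \<times> {1..k}"])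
  also have "(\<Prod>ij\<in>?K. \<Prod>a\<in>{a \<in> ?R. (vertex_of k C a, vertex_of k C (mate E a)) = ij}. G (?\<epsilon> a)) =
      (\<Prod>(i, j)\<in>?K. \<Prod>a\<in>edge_set C E i j. G (?\<epsilon> a))"
  proof (intro prod.cong refl)
    fix ij assume "ij \<in> ?K"
    then obtain i j where ij: "ij = (i, j)" "i \<in> {1..k}" "j \<in> {1..k}" "i \<le> j" by auto
    show "(\<Prod>a\<in>{a \<in> ?R. (vertex_of k C a, vertex_of k C (mate E a)) = ij}. G (?\<epsilon> a)) =
      (case ij of (i, j) \<Rightarrow> \<Prod>a\<in>edge_set C E i j. G (?\<epsilon> a))"
      unfolding ij(1) prod.case edge_set_eq[OF ij(2-4)] ..
  qed
  also have "(\<Prod>ij\<in>?L. \<Prod>a\<in>{a \<in> ?R. (vertex_of k C a, vertex_of k C (mate E a)) = ij}. G (?\<epsilon> a)) =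
      (\<Prod>i\<in>{1..k}. \<Prod>a\<in>edge_set C E i i. G (?\<epsilon> a))"
    by (subst prod.reindex) (auto simp: inj_on_def edge_set_eq simp del: atLeastAtMost_iff intro!: prod.cong)
  finally show ?thesis .
qed

text \<open>On a subsystem at vertex i the indicator compares \<alpha>_i with the full cycle if the
  subsystem lies in S, and with the identity if it lies in T.\<close>

lemma sum_output_indices:
  assumes part: "S \<union> T = {1..2 * m}" "S \<inter> T = {}" and \<alpha>: "\<And>i. i \<in> {1..k} \<Longrightarrow> \<alpha> i \<in> sym_group p"
  shows "(\<Sum>s\<in>{1..p} \<rightarrow>\<^sub>E multi_index D S. \<Sum>z\<in>{1..p} \<rightarrow>\<^sub>E multi_index D T.
      \<Prod>i\<in>{1..k}. of_bool (\<forall>t\<in>{1..p}. restrict (merge S T (s (full_cycle p t), z t)) (C i) =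
        restrict (merge S T (s (\<alpha> i t), z (\<alpha> i t))) (C i))) =
    ((\<Prod>i\<in>{1..k}. (\<Prod>a\<in>S \<inter> C i. of_nat (D a)) ^ num_cycles p (inv (full_cycle p) \<circ> \<alpha> i)) *
    (\<Prod>i\<in>{1..k}. (\<Prod>a\<in>T \<inter> C i. of_nat (D a)) ^ num_cycles p (\<alpha> i)) :: complex)"
proof -
  have "finite (S \<union> T)" unfolding part(1) by simp
  then have fin: "finite S" "finite T" by simp_all
  have mem: "vertex_of k C a \<in> {1..k}" if "a \<in> S \<or> a \<in> T" for a using vertex_of_mem(1)[of a] that part by blast
  \<comment> \<open>The exponent depends only on the vertex, so a product over subsystems is
    collected vertex by vertex.\<close>
  have regroup: "(\<Prod>a\<in>J. of_nat (D a) ^ c (vertex_of k C a)) = (\<Prod>i\<in>{1..k}. (\<Prod>a\<in>J \<inter> C i. of_nat (D a)) ^ c i :: complex)"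
    if J: "J \<subseteq> {1..2 * m}" for J and c :: "nat \<Rightarrow> nat"
  proof -
    have "(\<Prod>a\<in>J. of_nat (D a) ^ c (vertex_of k C a)) = (\<Prod>i\<in>{1..k}. \<Prod>a\<in>{a \<in> J. vertex_of k C a = i}. (of_nat (D a) ^ c (vertex_of k C a) :: complex))"
      by (rule prod.group[symmetric]) (use J vertex_of_mem(1) finite_subset in auto)
    also have "\<dots> = (\<Prod>i\<in>{1..k}. \<Prod>a\<in>J \<inter> C i. (of_nat (D a) ^ c i))"
    proof (rule prod.cong[OF refl])
      fix i assume i: "i \<in> {1..k}"
      have "{a \<in> J. vertex_of k C a = i} = J \<inter> C i" using J i vertex_of_eq[OF i] vertex_of_mem(2) by blast
      then show "(\<Prod>a\<in>{a \<in> J. vertex_of k C a = i}. (of_nat (D a) ^ c (vertex_of k C a) :: complex)) = (\<Prod>a\<in>J \<inter> C i. (of_nat (D a) ^ c i))"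
        using vertex_of_eq[OF i] by (auto intro!: prod.cong)
    qed
    finally show ?thesis by (simp add: prod_power_distrib)
  qed
  have "(\<Prod>i\<in>{1..k}. of_bool (\<forall>t\<in>{1..p}. restrict (merge S T (s (full_cycle p t), z t)) (C i) =
        restrict (merge S T (s (\<alpha> i t), z (\<alpha> i t))) (C i))) =
      (of_bool (\<forall>a\<in>S. \<forall>t\<in>{1..p}. s (full_cycle p t) a = s (\<alpha> (vertex_of k C a) t) a) *
       of_bool (\<forall>a\<in>T. \<forall>t\<in>{1..p}. z (id t) a = z (\<alpha> (vertex_of k C a) t) a) :: complex)" for s z
  proof -
    let ?x' = "\<lambda>t. merge S T (s (full_cycle p t), z t)" and ?x = "\<lambda>t. merge S T (s t, z t)"
    have "(\<Prod>i\<in>{1..k}. of_bool (\<forall>t\<in>{1..p}. restrict (?x' t) (C i) = restrict (?x (\<alpha> i t)) (C i))) =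
      (of_bool (\<forall>i\<in>{1..k}. \<forall>t\<in>{1..p}. restrict (?x' t) (C i) = restrict (?x (\<alpha> i t)) (C i)) :: complex)"
      by (rule prod_of_bool) simp
    also have "(\<forall>i\<in>{1..k}. \<forall>t\<in>{1..p}. restrict (?x' t) (C i) = restrict (?x (\<alpha> i t)) (C i)) \<longleftrightarrow>
        (\<forall>i\<in>{1..k}. \<forall>a\<in>C i. \<forall>t\<in>{1..p}. ?x' t a = ?x (\<alpha> i t) a)"
      by (auto simp: restrict_def fun_eq_iff)
    also have "\<dots> \<longleftrightarrow> (\<forall>a\<in>S \<union> T. \<forall>t\<in>{1..p}. ?x' t a = ?x (\<alpha> (vertex_of k C a) t) a)"
      unfolding part(1) by (rule all_vertices_iff)
    also have "\<dots> \<longleftrightarrow> (\<forall>a\<in>S. \<forall>t\<in>{1..p}. s (full_cycle p t) a = s (\<alpha> (vertex_of k C a) t) a) \<and>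
        (\<forall>a\<in>T. \<forall>t\<in>{1..p}. z (id t) a = z (\<alpha> (vertex_of k C a) t) a)"
      using part(2) by (auto simp: merge_def)
    finally show ?thesis by (simp only: of_bool_conj)
  qed
  note pointwise = this
  have "(\<Sum>s\<in>{1..p} \<rightarrow>\<^sub>E multi_index D S. \<Sum>z\<in>{1..p} \<rightarrow>\<^sub>E multi_index D T.
      \<Prod>i\<in>{1..k}. of_bool (\<forall>t\<in>{1..p}. restrict (merge S T (s (full_cycle p t), z t)) (C i) =
        restrict (merge S T (s (\<alpha> i t), z (\<alpha> i t))) (C i))) =
     ((\<Sum>s\<in>{1..p} \<rightarrow>\<^sub>E multi_index D S. of_bool (\<forall>a\<in>S. \<forall>t\<in>{1..p}. s (full_cycle p t) a = s (\<alpha> (vertex_of k C a) t) a)) *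
      (\<Sum>z\<in>{1..p} \<rightarrow>\<^sub>E multi_index D T. of_bool (\<forall>a\<in>T. \<forall>t\<in>{1..p}. z (id t) a = z (\<alpha> (vertex_of k C a) t) a)) :: complex)"
    unfolding sum_product by (intro sum.cong refl pointwise)
  also have "\<dots> = (\<Prod>a\<in>S. of_nat (D a) ^ num_cycles p (inv (\<alpha> (vertex_of k C a)) \<circ> full_cycle p)) *
      (\<Prod>a\<in>T. of_nat (D a) ^ num_cycles p (inv (\<alpha> (vertex_of k C a)) \<circ> id))"
    by (intro arg_cong2[where f = "(*)"] sum_tuples_agree_multi_index fin full_cycle_in_sym_group sym_group_id \<alpha> mem) auto
  also have "\<dots> = (\<Prod>i\<in>{1..k}. (\<Prod>a\<in>S \<inter> C i. of_nat (D a)) ^ num_cycles p (inv (\<alpha> i) \<circ> full_cycle p)) *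
     (\<Prod>i\<in>{1..k}. (\<Prod>a\<in>T \<inter> C i. of_nat (D a)) ^ num_cycles p (inv (\<alpha> i) \<circ> id))"
    using part(1) by (intro arg_cong2[where f = "(*)"] regroup) auto
  also have "\<dots> = (\<Prod>i\<in>{1..k}. (\<Prod>a\<in>S \<inter> C i. of_nat (D a)) ^ num_cycles p (inv (full_cycle p) \<circ> \<alpha> i)) *
     (\<Prod>i\<in>{1..k}. (\<Prod>a\<in>T \<inter> C i. of_nat (D a)) ^ num_cycles p (\<alpha> i))"
  proof -
    \<comment> \<open>The count yields the inverse of the permutation in the theorem, with equally
      many cycles.\<close>
    have "num_cycles p (inv (\<alpha> i) \<circ> full_cycle p) = num_cycles p (inv (full_cycle p) \<circ> \<alpha> i)" if "i \<in> {1..k}" for i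
      using num_cycles_inv[OF sym_group_comp[OF sym_group_inv[OF full_cycle_in_sym_group] \<alpha>[OF that]]]
        sym_group_inv_comp[OF sym_group_inv[OF full_cycle_in_sym_group] \<alpha>[OF that]]
        sym_group_inv_inv[OF full_cycle_in_sym_group] by metis
    moreover have "num_cycles p (inv (\<alpha> i) \<circ> id) = num_cycles p (\<alpha> i)" if "i \<in> {1..k}" for i
      using num_cycles_inv[OF \<alpha>[OF that]] by simp
    ultimately show ?thesis by (intro arg_cong2[where f = "(*)"] prod.cong refl) simp_all
  qed
  finally show ?thesis .
qed

section \<open>Bell vectors and the sum over input labels\<close>

text \<open>Equality of the two labels is expressed by quantifying over the edge, so that no end has
  to be named first.\<close>

lemma bell_vec_eq:
  assumes e: "e \<in> E" and D: "\<And>a b. {a, b} \<in> E \<Longrightarrow> D a = D b" and h: "\<And>a. a \<in> e \<Longrightarrow> h a < D a"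
  shows "bell_vec D e h = of_real (1 / sqrt (real (D (Min e)))) * of_bool (\<forall>a\<in>e. \<forall>b\<in>e. h a = h b)"
proof -
  obtain a b where ab: "e = {a, b}" by (rule edge_obtain[OF e])
  have neq: "a \<noteq> b" and Dab: "D a = D b" using edge_ends(1) D e[unfolded ab] by simp_all
  have min: "D (Min e) = D a" using Dab by (auto simp: ab min_def)
  have "(\<Sum>z<D (Min e). \<Prod>a\<in>e. if h a = z then 1 else 0) =
      (\<Sum>z<D (Min e). if z = h a then of_bool (h a = h b) else (0 :: complex))"
    using neq by (intro sum.cong refl) (auto simp: ab)
  also have "\<dots> = of_bool (h a = h b)"
    using h[of a] unfolding min by (simp add: ab)
  also have "h a = h b \<longleftrightarrow> (\<forall>a\<in>e. \<forall>b\<in>e. h a = h b)"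
    unfolding ab by (simp add: eq_commute[of "h b" "h a"])
  finally show ?thesis by (simp add: bell_vec_def)
qed

text \<open>The number of p-tuples of labels on one edge that are compatible with the permutations
  at both ends. Like the Bell vector it refers to the edge without orienting it.\<close>

definition edge_count :: "(nat \<Rightarrow> nat) \<Rightarrow> nat \<Rightarrow> (nat \<Rightarrow> nat \<Rightarrow> nat) \<Rightarrow> nat set \<Rightarrow> complex" where
  "edge_count D p \<beta> e = (\<Sum>u\<in>{1..p} \<rightarrow>\<^sub>E {..<D (Min e)}.
     of_bool (\<forall>a\<in>e. \<forall>b\<in>e. \<forall>t\<in>{1..p}. u (\<beta> (vertex_of k C a) t) = u (\<beta> (vertex_of k C b) t)))"

lemma edge_count_eq:
  assumes e: "{a, b} \<in> E" and D: "\<And>a b. {a, b} \<in> E \<Longrightarrow> D a = D b" and \<beta>: "\<And>i. i \<in> {1..k} \<Longrightarrow> \<beta> i \<in> sym_group p"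
  shows "edge_count D p \<beta> {a, b} = of_nat (D a) ^ num_cycles p (inv (\<beta> (vertex_of k C a)) \<circ> \<beta> (vertex_of k C b))"
proof -
  have "D (Min {a, b}) = D a" using D[OF e] by (auto simp: min_def)
  moreover have "(\<forall>x\<in>{a, b}. \<forall>y\<in>{a, b}. \<forall>t\<in>{1..p}. u (\<beta> (vertex_of k C x) t) = u (\<beta> (vertex_of k C y) t)) \<longleftrightarrow>
    (\<forall>t\<in>{1..p}. u (\<beta> (vertex_of k C b) t) = u (\<beta> (vertex_of k C a) t))" for u :: "nat \<Rightarrow> nat"
    by auto
  ultimately show ?thesis
    unfolding edge_count_def
    using sum_tuples_agree[OF \<beta>[OF vertex_of_mem(1)[OF edge_ends(3)[OF e]]] \<beta>[OF vertex_of_mem(1)[OF edge_ends(2)[OF e]]]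
        finite_lessThan[of "D a"]]
    by (simp only: card_lessThan)
qed

text \<open>The kets force the label tuples at the two ends to be one tuple \<open>u\<close>; the
  bras force its two rearrangements by the permutations at the ends to agree. Each ket-bra pair
  contributes two factors 1/sqrt of the edge dimension.\<close>

lemma sum_bell_labels:
  assumes e: "e \<in> E" and D: "\<And>a b. {a, b} \<in> E \<Longrightarrow> D a = D b" and \<beta>: "\<And>i. i \<in> {1..k} \<Longrightarrow> \<beta> i \<in> sym_group p"
  shows "(\<Sum>h\<in>(\<Pi>\<^sub>E a\<in>e. {1..p} \<rightarrow>\<^sub>E {..<D a}). \<Prod>t\<in>{1..p}.
      bell_vec D e (\<lambda>a\<in>e. h a t) * cnj (bell_vec D e (\<lambda>a\<in>e. h a (\<beta> (vertex_of k C a) t)))) =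
    (1 / of_nat (D (Min e))) ^ p * edge_count D p \<beta> e"
proof -
  obtain a b where ab: "e = {a, b}" by (rule edge_obtain[OF e])
  have neq: "a \<noteq> b" and mem: "a \<in> {1..2 * m}" "b \<in> {1..2 * m}" and Dab: "D b = D a"
    using edge_ends(1-3)[OF e[unfolded ab]] D[OF e[unfolded ab]] by simp_all
  define q where "q = D (Min e)"
  have q: "D a = q" "D b = q" using Dab by (auto simp: q_def ab min_def)
  have \<beta>_in: "\<beta> (vertex_of k C c) t \<in> {1..p}" if "c \<in> e" "t \<in> {1..p}" for c t
    using that mem ab by (intro sym_group_in[OF \<beta>[OF vertex_of_mem(1)]]) auto
  let ?T = "{1..p} \<rightarrow>\<^sub>E {..<q}"
  let ?\<beta>a = "\<beta> (vertex_of k C a)" and ?\<beta>b = "\<beta> (vertex_of k C b)"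
  have bell: "(\<Prod>t\<in>{1..p}. bell_vec D e (\<lambda>a\<in>e. h a t) * cnj (bell_vec D e (\<lambda>a\<in>e. h a (\<beta> (vertex_of k C a) t)))) =
      (1 / of_nat q) ^ p * (of_bool (h a = h b) * of_bool (\<forall>t\<in>{1..p}. h a (?\<beta>a t) = h b (?\<beta>b t)))"
    if h: "h a \<in> ?T" "h b \<in> ?T" for h
  proof -
    have lt: "h c t < D c" if "c \<in> e" "t \<in> {1..p}" for c t
      using that h ab q PiE_mem[of _ "{1..p}" "\<lambda>_. {..<q}" t] by auto
    have sq: "complex_of_real (1 / sqrt (real q)) * complex_of_real (1 / sqrt (real q)) = 1 / of_nat q"
      by (simp flip: of_real_mult)
    have "bell_vec D e (\<lambda>a\<in>e. h a t) * cnj (bell_vec D e (\<lambda>a\<in>e. h a (\<beta> (vertex_of k C a) t))) =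
        (1 / of_nat q) * (of_bool (h a t = h b t) * of_bool (h a (?\<beta>a t) = h b (?\<beta>b t)))"
      if t: "t \<in> {1..p}" for t
    proof -
      have "bell_vec D e (\<lambda>a\<in>e. h a t) = of_real (1 / sqrt (real q)) * of_bool (h a t = h b t)"
        using lt t unfolding q_def by (subst bell_vec_eq[OF e D]) (auto simp: ab)
      moreover have "bell_vec D e (\<lambda>a\<in>e. h a (\<beta> (vertex_of k C a) t)) = of_real (1 / sqrt (real q)) * of_bool (h a (?\<beta>a t) = h b (?\<beta>b t))"
        using lt \<beta>_in[OF _ t] unfolding q_def by (subst bell_vec_eq[OF e D]) (auto simp: ab)
      ultimately show ?thesis unfolding sq[symmetric] by simp
    qed
    then have "(\<Prod>t\<in>{1..p}. bell_vec D e (\<lambda>a\<in>e. h a t) * cnj (bell_vec D e (\<lambda>a\<in>e. h a (\<beta> (vertex_of k C a) t)))) =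
       (\<Prod>t\<in>{1..p}. (1 / of_nat q) * (of_bool (h a t = h b t) * of_bool (h a (?\<beta>a t) = h b (?\<beta>b t))))"
      by (rule prod.cong[OF refl])
    also have "\<dots> = (1 / of_nat q) ^ p * (of_bool (\<forall>t\<in>{1..p}. h a t = h b t) * of_bool (\<forall>t\<in>{1..p}. h a (?\<beta>a t) = h b (?\<beta>b t)))"
      unfolding prod.distrib by (simp only: prod_of_bool finite_atLeastAtMost prod_constant card_atLeastAtMost diff_Suc_1 add_0_right)
    also have "(\<forall>t\<in>{1..p}. h a t = h b t) \<longleftrightarrow> h a = h b"
      using PiE_ext[OF h] by auto
    finally show ?thesis .
  qed
  have "(\<Sum>h\<in>(\<Pi>\<^sub>E a\<in>e. {1..p} \<rightarrow>\<^sub>E {..<D a}). \<Prod>t\<in>{1..p}.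
      bell_vec D e (\<lambda>a\<in>e. h a t) * cnj (bell_vec D e (\<lambda>a\<in>e. h a (\<beta> (vertex_of k C a) t)))) =
    (\<Sum>h\<in>(\<Pi>\<^sub>E a\<in>e. ?T). (1 / of_nat q) ^ p * (of_bool (h a = h b) * of_bool (\<forall>t\<in>{1..p}. h a (?\<beta>a t) = h b (?\<beta>b t))))"
  proof (rule sum.cong)
    show "(\<Pi>\<^sub>E a\<in>e. {1..p} \<rightarrow>\<^sub>E {..<D a}) = (\<Pi>\<^sub>E a\<in>e. ?T)"
      using q by (intro PiE_cong) (auto simp: ab)
    fix h assume "h \<in> (\<Pi>\<^sub>E a\<in>e. ?T)"
    then have "h a \<in> ?T" "h b \<in> ?T" by (auto simp: ab PiE_iff)
    then show "(\<Prod>t\<in>{1..p}. bell_vec D e (\<lambda>a\<in>e. h a t) * cnj (bell_vec D e (\<lambda>a\<in>e. h a (\<beta> (vertex_of k C a) t)))) =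
      (1 / of_nat q) ^ p * (of_bool (h a = h b) * of_bool (\<forall>t\<in>{1..p}. h a (?\<beta>a t) = h b (?\<beta>b t)))"
      by (rule bell)
  qed
  also have "\<dots> = (1 / of_nat q) ^ p * (\<Sum>u\<in>?T. \<Sum>w\<in>?T. of_bool (u = w) * of_bool (\<forall>t\<in>{1..p}. u (?\<beta>a t) = w (?\<beta>b t)))"
    using neq by (simp add: ab sum_PiE_insert sum_distrib_left)
  also have "(\<Sum>u\<in>?T. \<Sum>w\<in>?T. of_bool (u = w) * of_bool (\<forall>t\<in>{1..p}. u (?\<beta>a t) = w (?\<beta>b t))) =
      (\<Sum>u\<in>?T. \<Sum>w\<in>?T. if u = w then of_bool (\<forall>t\<in>{1..p}. u (?\<beta>a t) = u (?\<beta>b t)) else (0 :: complex))"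
    by (intro sum.cong refl) auto
  also have "\<dots> = (\<Sum>u\<in>?T. of_bool (\<forall>t\<in>{1..p}. u (?\<beta>a t) = u (?\<beta>b t)))"
    by (intro sum.cong refl) (simp add: finite_PiE)
  also have "\<dots> = edge_count D p \<beta> e"
    unfolding edge_count_def q_def[symmetric]
    by (intro sum.cong refl arg_cong[of _ _ of_bool]) (auto simp: ab)
  finally show ?thesis unfolding q_def .
qed

text \<open>The indicators determine the bra labels from the ket labels. The remaining sum over ket
  labels is transposed to one tuple per edge-end and then factors over the edges.\<close>

lemma sum_input_indices:
  assumes D: "\<And>a b. {a, b} \<in> E \<Longrightarrow> D a = D b" and \<beta>: "\<And>i. i \<in> {1..k} \<Longrightarrow> \<beta> i \<in> sym_group p"
  defines "\<phi> \<equiv> tensor_vec E (bell_vec D)"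
  shows "(\<Sum>y\<in>{1..p} \<rightarrow>\<^sub>E multi_index D {1..2 * m}. \<Sum>y'\<in>{1..p} \<rightarrow>\<^sub>E multi_index D {1..2 * m}.
      (\<Prod>t\<in>{1..p}. \<phi> (y t) * cnj (\<phi> (y' t))) *
      (\<Prod>i\<in>{1..k}. of_bool (\<forall>t\<in>{1..p}. restrict (y' t) (C i) = restrict (y (\<beta> i t)) (C i)))) =
    (\<Prod>e\<in>E. (1 / of_nat (D (Min e))) ^ p) * (\<Prod>e\<in>E. edge_count D p \<beta> e)"
proof -
  let ?T = "{1..p} \<rightarrow>\<^sub>E multi_index D {1..2 * m}"
  \<comment> \<open>The only bra labels that satisfy all vertex conditions: each edge-end is
    rearranged by the permutation of its own vertex.\<close>
  let ?y' = "\<lambda>y. \<lambda>t\<in>{1..p}. \<lambda>a\<in>{1..2 * m}. y (\<beta> (vertex_of k C a) t) a"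
  have \<beta>_in: "\<beta> (vertex_of k C a) t \<in> {1..p}" if "a \<in> {1..2 * m}" "t \<in> {1..p}" for a t
    using that by (intro sym_group_in[OF \<beta>[OF vertex_of_mem(1)]])
  have y'_mem: "?y' y \<in> ?T" if y: "y \<in> ?T" for y
  proof -
    have "y (\<beta> (vertex_of k C a) t) a < D a" if "a \<in> {1..2 * m}" "t \<in> {1..p}" for a t
      using PiE_mem[OF y \<beta>_in[OF that]] that(1) by (auto simp: multi_index_def)
    then show ?thesis by (auto simp: multi_index_def)
  qed
  have delta: "(\<Prod>i\<in>{1..k}. of_bool (\<forall>t\<in>{1..p}. restrict (y' t) (C i) = restrict (y (\<beta> i t)) (C i))) =
      (of_bool (y' = ?y' y) :: complex)" if y': "y' \<in> ?T" and y: "y \<in> ?T" for y y'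
  proof -
    have "(\<Prod>i\<in>{1..k}. of_bool (\<forall>t\<in>{1..p}. restrict (y' t) (C i) = restrict (y (\<beta> i t)) (C i))) =
      (of_bool (\<forall>i\<in>{1..k}. \<forall>t\<in>{1..p}. restrict (y' t) (C i) = restrict (y (\<beta> i t)) (C i)) :: complex)"
      by (rule prod_of_bool) simp
    also have "(\<forall>i\<in>{1..k}. \<forall>t\<in>{1..p}. restrict (y' t) (C i) = restrict (y (\<beta> i t)) (C i)) \<longleftrightarrow>
        (\<forall>i\<in>{1..k}. \<forall>a\<in>C i. \<forall>t\<in>{1..p}. y' t a = y (\<beta> i t) a)"
      by (auto simp: restrict_def fun_eq_iff)
    also have "\<dots> \<longleftrightarrow> (\<forall>a\<in>{1..2 * m}. \<forall>t\<in>{1..p}. y' t a = y (\<beta> (vertex_of k C a) t) a)"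
      by (rule all_vertices_iff)
    also have "\<dots> \<longleftrightarrow> y' = ?y' y"
    proof
      assume eq: "\<forall>a\<in>{1..2 * m}. \<forall>t\<in>{1..p}. y' t a = y (\<beta> (vertex_of k C a) t) a"
      show "y' = ?y' y"
      proof (rule PiE_ext[OF y' y'_mem[OF y]])
        fix t assume t: "t \<in> {1..p}"
        have "y' t \<in> (\<Pi>\<^sub>E a\<in>{1..2 * m}. {..<D a})" "?y' y t \<in> (\<Pi>\<^sub>E a\<in>{1..2 * m}. {..<D a})"
          using PiE_mem[OF y' t] PiE_mem[OF y'_mem[OF y] t] by (simp_all only: multi_index_def)
        then show "y' t = ?y' y t"
          by (rule PiE_ext) (use eq t in \<open>simp del: atLeastAtMost_iff\<close>)
      qed
    next
      assume "y' = ?y' y"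
      then show "\<forall>a\<in>{1..2 * m}. \<forall>t\<in>{1..p}. y' t a = y (\<beta> (vertex_of k C a) t) a"
        by (simp del: atLeastAtMost_iff)
    qed
    finally show ?thesis .
  qed
  have fin: "finite ?T" by (intro finite_PiE) (simp_all add: finite_multi_index)
  let ?g = "\<lambda>e h. \<Prod>t\<in>{1..p}. bell_vec D e (\<lambda>a\<in>e. h a t) * cnj (bell_vec D e (\<lambda>a\<in>e. h a (\<beta> (vertex_of k C a) t)))"
  have "(\<Sum>y\<in>?T. \<Sum>y'\<in>?T. (\<Prod>t\<in>{1..p}. \<phi> (y t) * cnj (\<phi> (y' t))) *
      (\<Prod>i\<in>{1..k}. of_bool (\<forall>t\<in>{1..p}. restrict (y' t) (C i) = restrict (y (\<beta> i t)) (C i)))) =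
    (\<Sum>y\<in>?T. \<Sum>y'\<in>?T. if y' = ?y' y then \<Prod>t\<in>{1..p}. \<phi> (y t) * cnj (\<phi> (y' t)) else 0)"
    by (intro sum.cong refl) (simp only: delta, simp)
  also have "\<dots> = (\<Sum>y\<in>?T. \<Prod>t\<in>{1..p}. \<phi> (y t) * cnj (\<phi> (?y' y t)))"
    by (intro sum.cong refl) (simp only: sum.delta[OF fin] y'_mem if_True)
  also have "\<dots> = (\<Sum>f\<in>(\<Pi>\<^sub>E a\<in>{1..2 * m}. {1..p} \<rightarrow>\<^sub>E {..<D a}). \<Prod>e\<in>E. ?g e (restrict f e))"
    unfolding sum_tuples_transpose
  proof (intro sum.cong refl)
    fix f :: "nat \<Rightarrow> nat \<Rightarrow> nat"
    let ?y = "\<lambda>t\<in>{1..p}. \<lambda>a\<in>{1..2 * m}. f a t"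
    have "\<phi> (?y t) = (\<Prod>e\<in>E. bell_vec D e (\<lambda>a\<in>e. (restrict f e) a t))" if t: "t \<in> {1..p}" for t
      unfolding \<phi>_def tensor_vec_def
    proof (intro prod.cong refl arg_cong[of _ _ "bell_vec D _"])
      fix e assume "e \<in> E"
      then have "e \<subseteq> {1..2 * m}" by (rule edge_subset)
      then show "restrict (?y t) e = (\<lambda>a\<in>e. (restrict f e) a t)"
        using t by (intro restrict_ext) auto
    qed
    moreover have "\<phi> (?y' ?y t) = (\<Prod>e\<in>E. bell_vec D e (\<lambda>a\<in>e. (restrict f e) a (\<beta> (vertex_of k C a) t)))" if t: "t \<in> {1..p}" for t
      unfolding \<phi>_def tensor_vec_def
    proof (intro prod.cong refl arg_cong[of _ _ "bell_vec D _"])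
      fix e assume "e \<in> E"
      then have "e \<subseteq> {1..2 * m}" by (rule edge_subset)
      then have "a \<in> {1..2 * m}" if "a \<in> e" for a using that by blast
      then show "restrict (?y' ?y t) e = (\<lambda>a\<in>e. (restrict f e) a (\<beta> (vertex_of k C a) t))"
        using t \<beta>_in[OF _ t] by (intro restrict_ext) (simp del: atLeastAtMost_iff)
    qed
    ultimately have "(\<Prod>t\<in>{1..p}. \<phi> (?y t) * cnj (\<phi> (?y' ?y t))) =
      (\<Prod>t\<in>{1..p}. \<Prod>e\<in>E. bell_vec D e (\<lambda>a\<in>e. (restrict f e) a t) * cnj (bell_vec D e (\<lambda>a\<in>e. (restrict f e) a (\<beta> (vertex_of k C a) t))))"
      by (intro prod.cong refl) (simp only: prod.distrib cnj_prod)
    then show "(\<Prod>t\<in>{1..p}. \<phi> (?y t) * cnj (\<phi> (?y' ?y t))) = (\<Prod>e\<in>E. ?g e (restrict f e))"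
      by (subst (asm) prod.swap)
  qed
  also have "\<dots> = (\<Prod>e\<in>E. \<Sum>h\<in>(\<Pi>\<^sub>E a\<in>e. {1..p} \<rightarrow>\<^sub>E {..<D a}). ?g e h)"
    by (rule sum_PiE_partition[OF edges_partition]) (auto intro: finite_PiE)
  also have "\<dots> = (\<Prod>e\<in>E. (1 / of_nat (D (Min e))) ^ p * edge_count D p \<beta> e)"
    by (intro prod.cong refl sum_bell_labels D \<beta>)
  finally show ?thesis by (simp only: prod.distrib)
qed

text \<open>The two ends of a loop carry the same \<beta>, so the relevant permutation is the
  identity, whose p cycles give the exponent p.\<close>

lemma prod_edge_count:
  assumes D: "\<And>a b. {a, b} \<in> E \<Longrightarrow> D a = D b" and \<beta>: "\<And>i. i \<in> {1..k} \<Longrightarrow> \<beta> i \<in> sym_group p"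
  shows "(\<Prod>e\<in>E. edge_count D p \<beta> e) =
    (\<Prod>(i, j)\<in>{(i, j). 1 \<le> i \<and> i < j \<and> j \<le> k}.
      (\<Prod>a\<in>edge_set C E i j. of_nat (D a)) ^ num_cycles p (inv (\<beta> i) \<circ> \<beta> j)) *
    (\<Prod>i\<in>{1..k}. (\<Prod>a\<in>edge_set C E i i. of_nat (D a)) ^ p)"
proof -
  have *: "(\<Prod>a\<in>edge_set C E i j. edge_count D p \<beta> {a, mate E a}) =
      (\<Prod>a\<in>edge_set C E i j. of_nat (D a)) ^ num_cycles p (inv (\<beta> i) \<circ> \<beta> j)"
    if ij: "i \<in> {1..k}" "j \<in> {1..k}" "i \<le> j" for i j
  proof -
    have "edge_count D p \<beta> {a, mate E a} = of_nat (D a) ^ num_cycles p (inv (\<beta> i) \<circ> \<beta> j)"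
      if "a \<in> edge_set C E i j" for a
    proof -
      have a: "a \<in> {1..2 * m}" "vertex_of k C a = i" "vertex_of k C (mate E a) = j" using that by (auto simp: edge_set_eq[OF ij])
      show ?thesis using edge_count_eq[of a "mate E a" D \<beta> p, OF mate_edge[OF a(1)] D \<beta>] a(2,3) by simp
    qed
    then show ?thesis by (simp add: prod_power_distrib)
  qed
  have "(\<Prod>(i, j)\<in>{(i, j). 1 \<le> i \<and> i < j \<and> j \<le> k}. \<Prod>a\<in>edge_set C E i j. edge_count D p \<beta> {a, mate E a}) =
    (\<Prod>(i, j)\<in>{(i, j). 1 \<le> i \<and> i < j \<and> j \<le> k}.
      (\<Prod>a\<in>edge_set C E i j. of_nat (D a)) ^ num_cycles p (inv (\<beta> i) \<circ> \<beta> j))"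
    by (intro prod.cong refl) (auto intro!: *)
  moreover have "(\<Prod>i\<in>{1..k}. \<Prod>a\<in>edge_set C E i i. edge_count D p \<beta> {a, mate E a}) =
      (\<Prod>i\<in>{1..k}. (\<Prod>a\<in>edge_set C E i i. of_nat (D a)) ^ p)"
    using sym_group_inv_o(1)[OF \<beta>] by (intro prod.cong refl) (simp add: * num_cycles_id)
  ultimately show ?thesis by (simp only: prod_edges)
qed

text \<open>Every edge has two ends of equal dimension. The square is what turns the Bell
  normalisations into the power -p/2 of the total dimension.\<close>

lemma prod_edge_dims:
  assumes D: "\<And>a b. {a, b} \<in> E \<Longrightarrow> D a = D b"
  shows "(\<Prod>a\<in>{1..2 * m}. D a) = (\<Prod>e\<in>E. D (Min e))\<^sup>2"
proof -
  have "(\<Prod>a\<in>\<Union>E. D a) = (\<Prod>e\<in>E. \<Prod>a\<in>e. D a)"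
  proof (subst prod.Union_disjoint)
    show "\<forall>e\<in>E. finite e" using finite_subset[OF edge_subset] by simp
    show "\<forall>e\<in>E. \<forall>e'\<in>E. e \<noteq> e' \<longrightarrow> e \<inter> e' = {}"
      using partition_onD2[OF edges_partition] by (simp add: disjoint_def)
  qed simp
  also have "\<dots> = (\<Prod>e\<in>E. (D (Min e))\<^sup>2)"
  proof (rule prod.cong[OF refl])
    fix e assume e: "e \<in> E"
    obtain a b where ab: "e = {a, b}" by (rule edge_obtain[OF e])
    have "a \<noteq> b" "D a = D b" using edge_ends(1) D e[unfolded ab] by simp_all
    then show "(\<Prod>a\<in>e. D a) = (D (Min e))\<^sup>2" by (auto simp: ab power2_eq_square min_def)
  qed
  finally show ?thesis
    unfolding partition_onD1[OF edges_partition, symmetric] by (simp only: power2_eq_square prod.distrib)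
qed

end

section \<open>Assembly of the exact formula\<close>

lemma restrict_in_multi_index:
  assumes "x \<in> multi_index D A" "B \<subseteq> A"
  shows "restrict x B \<in> multi_index D B"
  using assms by (auto simp: multi_index_def PiE_iff)

lemma merge_in_multi_index:
  assumes "x \<in> multi_index D S" "y \<in> multi_index D T"
  shows "merge S T (x, y) \<in> multi_index D (S \<union> T)"
  using assms by (auto simp: multi_index_def PiE_iff merge_def extensional_def)

theorem theorem5p1:
  fixes k m n N p :: nat
    and C :: "nat \<Rightarrow> nat set" and E :: "nat set set"
    and d :: "nat \<Rightarrow> real" and D :: "nat \<Rightarrow> nat"
    and S T :: "nat set"
    and M :: "'w measure" and U :: "nat \<Rightarrow> 'w \<Rightarrow> (nat \<Rightarrow> nat) op"
  defines "n \<equiv> 2 * m" and "D \<equiv> local_dim d N"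
  assumes graph: "graph_data k m C E"
    and d_pos: "\<And>i. i \<in> {1..n} \<Longrightarrow> d i > 0"
    and d_edge: "\<And>i j. {i, j} \<in> E \<Longrightarrow> d i = d j"
    and N_pos: "N > 0"
    and dN_int: "\<And>i. i \<in> {1..n} \<Longrightarrow> d i * real N \<in> \<int>"
    and part: "S \<union> T = {1..n}" "S \<inter> T = {}"
    and M: "prob_space M"
    and indep: "prob_space.indep_vars M (\<lambda>i. unitary_borel (multi_index D (C i))) U {1..k}"
    and haar: "\<And>i. i \<in> {1..k} \<Longrightarrow>
      is_haar (multi_index D (C i)) (distr M (unitary_borel (multi_index D (C i))) (U i))"
    and p: "p \<ge> 1"
    and dim_ge: "\<And>i. i \<in> {1..k} \<Longrightarrow> dim_prod d N (C i) \<ge> real p"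
  shows "prob_space.expectation M (\<lambda>\<omega>. op_trace (multi_index D S)
           (op_power (multi_index D S) (marginal D k m C E (\<lambda>i. U i \<omega>) S T) p)) =
    complex_of_real (dim_prod d N {1..n} powr (- real p / 2) *
      (\<Sum>\<alpha>\<in>{1..k} \<rightarrow>\<^sub>E sym_group p. \<Sum>\<beta>\<in>{1..k} \<rightarrow>\<^sub>E sym_group p.
          (\<Prod>i=1..k. dim_prod d N (S \<inter> C i) ^ num_cycles p (inv (full_cycle p) \<circ> \<alpha> i))
        * (\<Prod>i=1..k. dim_prod d N (T \<inter> C i) ^ num_cycles p (\<alpha> i))
        * (\<Prod>(i, j)\<in>{(i, j). 1 \<le> i \<and> i < j \<and> j \<le> k}.
             dim_prod d N (edge_set C E i j) ^ num_cycles p (inv (\<beta> i) \<circ> \<beta> j))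
        * (\<Prod>i=1..k. dim_prod d N (edge_set C E i i) ^ p)
        * (\<Prod>i=1..k. Wg p (dim_prod d N (C i)) (inv (\<alpha> i) \<circ> \<beta> i))))"
proof -
  interpret prob_space M by (fact M)
  let ?A = "{1..2 * m}" and ?G = "sym_group p"
  let ?TS = "{1..p} \<rightarrow>\<^sub>E multi_index D S" and ?TT = "{1..p} \<rightarrow>\<^sub>E multi_index D T"
  let ?TA = "{1..p} \<rightarrow>\<^sub>E multi_index D ?A" and ?P = "{1..k} \<rightarrow>\<^sub>E ?G"
  note CA = vertex_subset[OF graph]
  have finC: "finite (C i)" if "i \<in> {1..k}" for i using finite_subset[OF CA[OF that]] by simp
  have "finite (S \<union> T)" unfolding part(1) by simp
  then have finST: "finite S" "finite T" by simp_all
  \<comment> \<open>\<open>local_dim\<close> rounds down, but \<open>d a * real N\<close> is a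
    positive integer, so nothing is lost.\<close>
  have real_D: "real (D a) = d a * real N" if "a \<in> ?A" for a
  proof -
    have "d a * real N \<in> \<int>" using dN_int that by (simp add: n_def)
    then obtain z where z: "d a * real N = of_int z" by (rule Ints_cases)
    have "d a * real N > 0" using d_pos[of a] that N_pos by (simp add: n_def)
    then show ?thesis using z by (simp add: D_def local_dim_def)
  qed
  have dim: "dim_prod d N J = real (\<Prod>a\<in>J. D a)" if "J \<subseteq> ?A" for J
  proof -
    have "real (\<Prod>a\<in>J. D a) = (\<Prod>a\<in>J. d a * real N)"
      unfolding of_nat_prod using that real_D by (intro prod.cong) auto
    then show ?thesis by (simp add: dim_prod_def prod.distrib)
  qed
  have D_edge: "D a = D b" if "{a, b} \<in> E" for a b
    using d_edge[OF that] by (simp add: D_def local_dim_def)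
  have card_X: "real (card (multi_index D (C i))) = dim_prod d N (C i)" if "i \<in> {1..k}" for i
    using that by (simp only: card_multi_index[OF finC] dim[OF CA])
  have card_ge: "p \<le> card (multi_index D (C i))" if "i \<in> {1..k}" for i
    using dim_ge[OF that] card_X[OF that] by simp

  define \<phi> where "\<phi> = tensor_vec E (bell_vec D)"
  define \<Phi> where "\<Phi> y y' = (\<Prod>t\<in>{1..p}. \<phi> (y t) * cnj (\<phi> (y' t)))" for y y'
  define x where "x s z t = merge S T (s t, z t)" for s z :: "nat \<Rightarrow> nat \<Rightarrow> nat" and t
  define x' where "x' s z t = merge S T (s (full_cycle p t), z t)" for s z :: "nat \<Rightarrow> nat \<Rightarrow> nat" and t
  define mono where "mono s z y y' \<omega> = (\<Prod>i\<in>{1..k}. \<Prod>t\<in>{1..p}. U i \<omega> (restrict (x s z t) (C i)) (restrict (y t) (C i)) *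
      cnj (U i \<omega> (restrict (x' s z t) (C i)) (restrict (y' t) (C i))))"
    for s z y y' :: "nat \<Rightarrow> nat \<Rightarrow> nat" and \<omega>
  \<comment> \<open>The indicator \<open>a\<close> sees only output labels and \<alpha>, and
    \<open>b\<close> below only input labels and \<beta>; this is the shape that
    \<open>separate_sums\<close> requires.\<close>
  define a where "a s z \<alpha> = (\<Prod>i\<in>{1..k}. of_bool (\<forall>t\<in>{1..p}. restrict (x' s z t) (C i) = restrict (x s z (\<alpha> i t)) (C i)) :: complex)"
    for s z and \<alpha> :: "nat \<Rightarrow> nat \<Rightarrow> nat"
  define b where "b y y' \<beta> = (\<Prod>i\<in>{1..k}. of_bool (\<forall>t\<in>{1..p}. restrict (y' t) (C i) = restrict (y (\<beta> i t)) (C i)) :: complex)"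
    for y y' :: "nat \<Rightarrow> nat \<Rightarrow> nat" and \<beta> :: "nat \<Rightarrow> nat \<Rightarrow> nat"
  define w where "w \<alpha> \<beta> = (\<Prod>i\<in>{1..k}. Wg p (dim_prod d N (C i)) (inv (\<alpha> i) \<circ> \<beta> i))" for \<alpha> \<beta> :: "nat \<Rightarrow> nat \<Rightarrow> nat"

  have trace: "op_trace (multi_index D S) (op_power (multi_index D S) (marginal D k m C E (\<lambda>i. U i \<omega>) S T) p) =
      (\<Sum>s\<in>?TS. \<Sum>z\<in>?TT. \<Sum>y\<in>?TA. \<Sum>y'\<in>?TA. \<Phi> y y' * mono s z y y' \<omega>)" for \<omega>
    unfolding marginal_def trace_power_partial_trace_ket_bra[OF finST p] graph_state_def
      prod_op_apply_tensor_op[OF finite_multi_index[OF finite_atLeastAtMost] finite_atLeastAtMost]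
      \<Phi>_def mono_def x_def x'_def \<phi>_def ..

  have mono_int: "integrable M (mono s z y y')" for s z y y'
    unfolding mono_def by (rule indep_unitary_monomials[OF M indep]) (auto simp: finite_multi_index finC)
  have mono_expectation: "expectation (mono s z y y') = (\<Sum>\<alpha>\<in>?P. \<Sum>\<beta>\<in>?P. a s z \<alpha> * b y y' \<beta> * of_real (w \<alpha> \<beta>))"
    if s: "s \<in> ?TS" and z: "z \<in> ?TT" and y: "y \<in> ?TA" and y': "y' \<in> ?TA" for s z y y'
  proof -
    have x_mem: "x s z t \<in> multi_index D ?A" "x' s z t \<in> multi_index D ?A" if t: "t \<in> {1..p}" for t
      using merge_in_multi_index[OF PiE_mem[OF s t] PiE_mem[OF z t]]
        merge_in_multi_index[OF PiE_mem[OF s sym_group_in[OF full_cycle_in_sym_group t]] PiE_mem[OF z t]]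
      unfolding x_def x'_def part(1) n_def by simp_all
    have "expectation (mono s z y y') = (\<Prod>i\<in>{1..k}. unitary_moment p (distr M (unitary_borel (multi_index D (C i))) (U i))
        (\<lambda>t. restrict (y t) (C i)) (\<lambda>t. restrict (y' t) (C i)) (\<lambda>t. restrict (x s z t) (C i)) (\<lambda>t. restrict (x' s z t) (C i)))"
      unfolding mono_def by (rule indep_unitary_monomials[OF M indep]) (auto simp: finite_multi_index finC)
    also have "\<dots> = (\<Prod>i\<in>{1..k}. \<Sum>\<alpha>\<in>?G. \<Sum>\<beta>\<in>?G.
        of_bool (\<forall>t\<in>{1..p}. restrict (x' s z t) (C i) = restrict (x s z (\<alpha> t)) (C i)) *
        of_bool (\<forall>t\<in>{1..p}. restrict (y' t) (C i) = restrict (y (\<beta> t)) (C i)) *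
        of_real (Wg p (dim_prod d N (C i)) (inv \<alpha> \<circ> \<beta>)))"
    proof (rule prod.cong[OF refl])
      fix i assume i: "i \<in> {1..k}"
      show "unitary_moment p (distr M (unitary_borel (multi_index D (C i))) (U i))
        (\<lambda>t. restrict (y t) (C i)) (\<lambda>t. restrict (y' t) (C i)) (\<lambda>t. restrict (x s z t) (C i)) (\<lambda>t. restrict (x' s z t) (C i)) =
        (\<Sum>\<alpha>\<in>?G. \<Sum>\<beta>\<in>?G.
          of_bool (\<forall>t\<in>{1..p}. restrict (x' s z t) (C i) = restrict (x s z (\<alpha> t)) (C i)) *
          of_bool (\<forall>t\<in>{1..p}. restrict (y' t) (C i) = restrict (y (\<beta> t)) (C i)) *
          of_real (Wg p (dim_prod d N (C i)) (inv \<alpha> \<circ> \<beta>)))"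
        unfolding card_X[OF i, symmetric]
        by (rule unitary_moment_Weingarten_Pi[OF finite_multi_index[OF finC[OF i]] card_ge[OF i] haar[OF i]];
            intro Pi_I restrict_in_multi_index[OF _ CA[OF i]] x_mem PiE_mem[OF y] PiE_mem[OF y'])
    qed
    also have "\<dots> = (\<Sum>\<alpha>\<in>?P. \<Sum>\<beta>\<in>?P. a s z \<alpha> * b y y' \<beta> * of_real (w \<alpha> \<beta>))"
      unfolding prod_double_sum_PiE[OF finite_atLeastAtMost finite_sym_group finite_sym_group]
        prod.distrib a_def b_def w_def of_real_prod ..
    finally show ?thesis .
  qed

  have "expectation (\<lambda>\<omega>. op_trace (multi_index D S)
           (op_power (multi_index D S) (marginal D k m C E (\<lambda>i. U i \<omega>) S T) p)) =
      (\<Sum>s\<in>?TS. \<Sum>z\<in>?TT. \<Sum>y\<in>?TA. \<Sum>y'\<in>?TA. \<Phi> y y' * expectation (mono s z y y'))"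
    unfolding trace using mono_int
    by (simp add: Bochner_Integration.integral_sum Bochner_Integration.integrable_sum del: sum.cong)
  also have "\<dots> = (\<Sum>s\<in>?TS. \<Sum>z\<in>?TT. \<Sum>y\<in>?TA. \<Sum>y'\<in>?TA. \<Phi> y y' *
      (\<Sum>\<alpha>\<in>?P. \<Sum>\<beta>\<in>?P. a s z \<alpha> * b y y' \<beta> * of_real (w \<alpha> \<beta>)))"
    by (intro sum.cong refl arg_cong2[where f = "(*)"] mono_expectation)
  also have "\<dots> = (\<Sum>\<alpha>\<in>?P. \<Sum>\<beta>\<in>?P. (\<Sum>s\<in>?TS. \<Sum>z\<in>?TT. a s z \<alpha>) *
      (\<Sum>y\<in>?TA. \<Sum>y'\<in>?TA. \<Phi> y y' * b y y' \<beta>) * of_real (w \<alpha> \<beta>))"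
    by (rule separate_sums)
  also have "\<dots> = (\<Sum>\<alpha>\<in>?P. \<Sum>\<beta>\<in>?P. complex_of_real (
        ((\<Prod>i=1..k. dim_prod d N (S \<inter> C i) ^ num_cycles p (inv (full_cycle p) \<circ> \<alpha> i))
        * (\<Prod>i=1..k. dim_prod d N (T \<inter> C i) ^ num_cycles p (\<alpha> i)))
        * (dim_prod d N {1..n} powr (- real p / 2) * ((\<Prod>(i, j)\<in>{(i, j). 1 \<le> i \<and> i < j \<and> j \<le> k}.
             dim_prod d N (edge_set C E i j) ^ num_cycles p (inv (\<beta> i) \<circ> \<beta> j))
        * (\<Prod>i=1..k. dim_prod d N (edge_set C E i i) ^ p)))
        * w \<alpha> \<beta>))"
  proof (intro sum.cong refl)
    fix \<alpha> \<beta> assume \<alpha>: "\<alpha> \<in> ?P" and \<beta>: "\<beta> \<in> ?P"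
    have out: "(\<Sum>s\<in>?TS. \<Sum>z\<in>?TT. a s z \<alpha>) = complex_of_real (
        (\<Prod>i=1..k. dim_prod d N (S \<inter> C i) ^ num_cycles p (inv (full_cycle p) \<circ> \<alpha> i))
        * (\<Prod>i=1..k. dim_prod d N (T \<inter> C i) ^ num_cycles p (\<alpha> i)))"
    proof -
      have "S \<inter> C i \<subseteq> ?A" "T \<inter> C i \<subseteq> ?A" for i using part(1) by (auto simp: n_def)
      then show ?thesis
        unfolding a_def x_def x'_def
        by (subst sum_output_indices[OF graph part[unfolded n_def] PiE_mem[OF \<alpha>]]) (simp_all add: dim)
    qed
    \<comment> \<open>With \<open>q\<close> the product of the edge dimensions, the total dimension
      is the square of \<open>q\<close>; positivity of \<open>q\<close> allows the real power to be
      simplified to q^(-p).\<close>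
    have const: "(\<Prod>e\<in>E. (1 / of_nat (D (Min e))) ^ p) = complex_of_real (dim_prod d N {1..n} powr (- real p / 2))"
    proof -
      define q where "q = (\<Prod>e\<in>E. D (Min e))"
      have dim_q: "dim_prod d N {1..n} = (real q)\<^sup>2"
        using prod_edge_dims[OF graph D_edge] by (simp add: dim n_def q_def)
      have "dim_prod d N {1..n} > 0"
        unfolding dim_prod_def using d_pos N_pos by (auto intro!: mult_pos_pos prod_pos)
      then have q: "real q > 0" unfolding dim_q by (simp add: zero_less_power2)
      have "(real q)\<^sup>2 powr (- real p / 2) = real q powr (- real p)"
        using q by (simp add: powr_powr flip: powr_numeral)
      also have "\<dots> = (1 / real q) ^ p"
        using q by (simp add: powr_minus powr_realpow power_one_over divide_inverse power_inverse)
      finally have "complex_of_real (dim_prod d N {1..n} powr (- real p / 2)) = (1 / of_nat q) ^ p"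
        unfolding dim_q by simp
      also have "\<dots> = (\<Prod>e\<in>E. (1 / of_nat (D (Min e))) ^ p)"
        unfolding q_def by (simp add: prod_power_distrib prod_dividef power_one_over)
      finally show ?thesis by (rule sym)
    qed
    have "edge_set C E i j \<subseteq> ?A" if "i \<in> {1..k}" for i j
      using CA[OF that] by (auto simp: edge_set_def)
    then have dim_edge: "dim_prod d N (edge_set C E i j) = real (\<Prod>a\<in>edge_set C E i j. D a)" if "i \<in> {1..k}" for i j
      using that by (simp only: dim)
    have edges: "(\<Prod>e\<in>E. edge_count k C D p \<beta> e) = complex_of_real (
        (\<Prod>(i, j)\<in>{(i, j). 1 \<le> i \<and> i < j \<and> j \<le> k}.
             dim_prod d N (edge_set C E i j) ^ num_cycles p (inv (\<beta> i) \<circ> \<beta> j))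
        * (\<Prod>i=1..k. dim_prod d N (edge_set C E i i) ^ p))"
      by (subst prod_edge_count[OF graph], erule D_edge, erule PiE_mem[OF \<beta>], unfold of_real_mult of_real_prod,
        intro arg_cong2[where f = "(*)"] prod.cong refl) (auto simp: dim_edge)
    have inp: "(\<Sum>y\<in>?TA. \<Sum>y'\<in>?TA. \<Phi> y y' * b y y' \<beta>) = complex_of_real (dim_prod d N {1..n} powr (- real p / 2) *
        ((\<Prod>(i, j)\<in>{(i, j). 1 \<le> i \<and> i < j \<and> j \<le> k}.
             dim_prod d N (edge_set C E i j) ^ num_cycles p (inv (\<beta> i) \<circ> \<beta> j))
        * (\<Prod>i=1..k. dim_prod d N (edge_set C E i i) ^ p)))"
      unfolding \<Phi>_def b_def \<phi>_def of_real_mult[of "dim_prod d N {1..n} powr _"] edges[symmetric] const[symmetric]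
      by (rule sum_input_indices[OF graph], erule D_edge, erule PiE_mem[OF \<beta>])
    show "(\<Sum>s\<in>?TS. \<Sum>z\<in>?TT. a s z \<alpha>) * (\<Sum>y\<in>?TA. \<Sum>y'\<in>?TA. \<Phi> y y' * b y y' \<beta>) * of_real (w \<alpha> \<beta>) =
      complex_of_real (
        ((\<Prod>i=1..k. dim_prod d N (S \<inter> C i) ^ num_cycles p (inv (full_cycle p) \<circ> \<alpha> i))
        * (\<Prod>i=1..k. dim_prod d N (T \<inter> C i) ^ num_cycles p (\<alpha> i)))
        * (dim_prod d N {1..n} powr (- real p / 2) * ((\<Prod>(i, j)\<in>{(i, j). 1 \<le> i \<and> i < j \<and> j \<le> k}.
             dim_prod d N (edge_set C E i j) ^ num_cycles p (inv (\<beta> i) \<circ> \<beta> j))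
        * (\<Prod>i=1..k. dim_prod d N (edge_set C E i i) ^ p)))
        * w \<alpha> \<beta>)"
      by (simp only: out inp of_real_mult)
  qed
  finally show ?thesis
    unfolding of_real_sum[symmetric] w_def sum_distrib_left by (simp only: mult_ac)
qed

end
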